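(* Let $\mathcal{X} \subset \mathcal{C}(I,E)$ be a compact set of paths such that distinct elements of $\mathcal{X}$ are not tree-like equivalent, and let $F:\mathcal{P}(\mathcal{X})\to\mathbb{R}$ be a weakly continuous function. Let $\Phi:\mathcal{P}(\mathcal{X})\to\mathcal{C}(I,\mathcal{T}(E))$ be the pathwise expected signature, and let $\Lambda$ be the index set of the canonical orthonormal basis of $\mathcal{T}(E)$. Then for any $\epsilon>0$ there exist a truncation level $m\geq 0$ and real coefficients $\alpha_J$, indexed by the words $J\in\Lambda^k$ with $0\le k\le m$ and only finitely many of them nonzero, such that for every probability measure $\mu\in\mathcal{P}(\mathcal{X})$ $$\Big|F(\mu)-\sum_{k=0}^m\ \sum_{J\in\Lambda^k}\alpha_J\,S(\Phi(\mu))^{J}\Big|<\epsilon .$$ Here $S(\Phi(\mu))^J$ denotes the coordinate with index $J$ of the signature of the $\mathcal{T}(E)$-valued path $\Phi(\mu)$.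
   Context: Let $I=[a,T]$ with $0\le a<T$, and let $E$ be a real separable Hilbert space of (finite or countably infinite) dimension $d$ with orthonormal basis $\{e_1,e_2,\ldots\}$ (for $d=\infty$, $\{1,\ldots,d\}$ means $\mathbb{N}$). Paths: for a Hilbert space $V$, $\mathcal{C}(I,V)$ is the Banach space of Lipschitz-continuous functions $x:I\to V$ with norm $\|x\|_{Lip}=\|x_a\|+\sup_{s\neq t\in I}\frac{\|x_t-x_s\|}{|t-s|}$. Compactness of $\mathcal{X}$ is with respect to $\|\cdot\|_{Lip}$. Tensor space: $E^{\otimes 0}=\mathbb{R}$, and $E^{\otimes k}$ is the Hilbert space with orthonormal basis $\{e_{i_1}\otimes\cdots\otimes e_{i_k}\}$. $\mathcal{T}(E)$ is the Hilbert space direct sum of the $E^{\otimes k}$, $k\ge 0$, with $\langle A,B\rangle_{\mathcal{T}(E)}=\sum_{k\ge0}\langle A_k,B_k\rangle_{E^{\otimes k}}$. Its canonical orthonormal basis is indexed by the countable set $\Lambda=\bigcup_{k\ge0}\{1,\ldots,d\}^k$ of words. Signature: for a Hilbert space $V$ with orthonormal basis indexed by a countable set $L$ and $x\in\mathcal{C}(I,V)$ with coordinates $x^{(i)}$, $i\in L$, the signature of $x$ has coordinates $S(x)^{\emptyset}=1$ (empty word) and, for $(i_1,\ldots,i_k)\in L^k$, $$S(x)^{(i_1,\ldots,i_k)}=\int\cdots\int_{a<u_1<\cdots<u_k<T}dx^{(i_1)}_{u_1}\cdots dx^{(i_k)}_{u_k}$$ (Riemann–Stieltjes integrals). For $V=E$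 this defines $S:\mathcal{C}(I,E)\to\mathcal{T}(E)$; the signature of a path on a sub-interval $[a,t]$ is defined in the same way with $t$ in place of $T$. In $S(\Phi(\mu))^J$ this is applied with $V=\mathcal{T}(E)$ and $L=\Lambda$. Tree-like equivalence: two paths $x,y\in\mathcal{C}(I,E)$ are tree-like equivalent if and only if $S(x)=S(y)$. Measures: $\mathcal{P}(\mathcal{X})$ is the set of Borel probability measures on $\mathcal{X}$, with the topology of weak convergence ($\mu_n\to\mu$ weakly if $\int f\,d\mu_n\to\int f\,d\mu$ for every continuous $f:\mathcal{X}\to\mathbb{R}$). "Weakly continuous" means continuous for this topology. Pathwise expected signature: for $t\in I$ let $\Pi_t(x)=x|_{[a,t]}$. For $\mu\in\mathcal{P}(\mathcal{X})$, $\Phi(\mu):I\to\mathcal{T}(E)$ is the path $\Phi(\mu)_t=\mathbb{E}_{x\sim\mu}[S(\Pi_t(x))]$ (expectation taken coordinate-wise), which is an element of $\mathcal{C}(I,\mathcal{T}(E))$. *)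

theory Defs
  imports "HOL-Analysis.Analysis" "HOL-Probability.Probability"
begin

section \<open>Hilbert spaces with a given orthonormal basis\<close>

text \<open>
  A Hilbert space is a type of sort \<open>{real_inner, complete_space}\<close>; its orthonormal bases are
  families indexed by a type.  With a countable index type this covers the separable Hilbert
  spaces of finite or countably infinite dimension.
\<close>

definition orthonormal_basis :: "('l \<Rightarrow> 'v::real_inner) \<Rightarrow> bool" where
  "orthonormal_basis b \<longleftrightarrow>
     (\<forall>i j. inner (b i) (b j) = (if i = j then 1 else 0)) \<and> closure (span (range b)) = UNIV"

subsection \<open>The Hilbert space of square-summable families\<close>

typedef 'l ell2 = "{f :: 'l \<Rightarrow> real. (\<lambda>i. (f i)\<^sup>2) summable_on UNIV}"
  morphisms ell2_nth Abs_ell2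
  by (rule exI[of _ "\<lambda>_. 0"]) simp

setup_lifting type_definition_ell2

lemma ell2_eqI: "(\<And>i. ell2_nth A i = ell2_nth B i) \<Longrightarrow> A = B"
  by (metis ell2_nth_inject ext)

lemma ell2_square_summable: "(\<lambda>i. (ell2_nth A i)\<^sup>2) summable_on UNIV"
  using ell2_nth by auto

lemma square_summable_mult:
  fixes f g :: "'l \<Rightarrow> real"
  assumes "(\<lambda>i. (f i)\<^sup>2) summable_on UNIV" "(\<lambda>i. (g i)\<^sup>2) summable_on UNIV"
  shows "(\<lambda>i. f i * g i) summable_on UNIV"
proof -
  have "(\<lambda>i. norm (f i * g i)) summable_on UNIV"
  proof (rule summable_on_comparison_test)
    show "(\<lambda>i. (f i)\<^sup>2 + (g i)\<^sup>2) summable_on UNIV"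
      by (intro summable_on_add assms)
    show "norm (f i * g i) \<le> (f i)\<^sup>2 + (g i)\<^sup>2" for i
    proof -
      have "0 \<le> (\<bar>f i\<bar> - \<bar>g i\<bar>)\<^sup>2" "0 \<le> (f i)\<^sup>2" "0 \<le> (g i)\<^sup>2" by simp_all
      then have "2 * (\<bar>f i\<bar> * \<bar>g i\<bar>) \<le> (f i)\<^sup>2 + (g i)\<^sup>2"
        by (simp add: power2_diff)
      moreover have "0 \<le> \<bar>f i\<bar> * \<bar>g i\<bar>" by simp
      ultimately have "\<bar>f i\<bar> * \<bar>g i\<bar> \<le> (f i)\<^sup>2 + (g i)\<^sup>2" by linarith
      then show ?thesis by (simp add: abs_mult)
    qed
  qed auto
  then show ?thesis
    by (rule abs_summable_summable)
qed

lemma square_summable_add: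
  fixes f g :: "'l \<Rightarrow> real"
  assumes "(\<lambda>i. (f i)\<^sup>2) summable_on UNIV" "(\<lambda>i. (g i)\<^sup>2) summable_on UNIV"
  shows "(\<lambda>i. (f i + g i)\<^sup>2) summable_on UNIV"
proof -
  have "(\<lambda>i. (f i)\<^sup>2 + (g i)\<^sup>2 + 2 * (f i * g i)) summable_on UNIV"
    by (intro summable_on_add assms summable_on_cmult_right square_summable_mult)
  then show ?thesis
    by (simp add: power2_sum mult.assoc)
qed

instantiation ell2 :: (type) real_vector
begin

lift_definition zero_ell2 :: "'a ell2" is "\<lambda>_. 0" by simp

lift_definition plus_ell2 :: "'a ell2 \<Rightarrow> 'a ell2 \<Rightarrow> 'a ell2" is "\<lambda>f g i. f i + g i"
  by (simp add: square_summable_add)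

lift_definition uminus_ell2 :: "'a ell2 \<Rightarrow> 'a ell2" is "\<lambda>f i. - f i" by simp

lift_definition minus_ell2 :: "'a ell2 \<Rightarrow> 'a ell2 \<Rightarrow> 'a ell2" is "\<lambda>f g i. f i - g i"
  using square_summable_add[where g = "\<lambda>i. - g i" for g :: "'a \<Rightarrow> real"] by simp

lift_definition scaleR_ell2 :: "real \<Rightarrow> 'a ell2 \<Rightarrow> 'a ell2" is "\<lambda>c f i. c * f i"
  by (simp add: power_mult_distrib summable_on_cmult_right)

instance
  by standard (transfer; simp add: algebra_simps)+

end

instantiation ell2 :: (type) real_inner
begin

definition inner_ell2 :: "'a ell2 \<Rightarrow> 'a ell2 \<Rightarrow> real" where
  "inner_ell2 A B = (\<Sum>\<^sub>\<infinity>i. ell2_nth A i * ell2_nth B i)"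

definition norm_ell2 :: "'a ell2 \<Rightarrow> real" where
  "norm_ell2 A = sqrt (inner A A)"

definition dist_ell2 :: "'a ell2 \<Rightarrow> 'a ell2 \<Rightarrow> real" where
  "dist_ell2 A B = norm (A - B)"

definition sgn_ell2 :: "'a ell2 \<Rightarrow> 'a ell2" where
  "sgn_ell2 A = A /\<^sub>R norm A"

definition uniformity_ell2 :: "('a ell2 \<times> 'a ell2) filter" where
  "uniformity_ell2 = (INF e\<in>{0<..}. principal {(A, B). dist A B < e})"

definition open_ell2 :: "'a ell2 set \<Rightarrow> bool" where
  "open_ell2 U \<longleftrightarrow> (\<forall>A\<in>U. \<forall>\<^sub>F (A', B) in uniformity. A' = A \<longrightarrow> B \<in> U)"

instance
proof
  fix A B C :: "'a ell2" and r :: real and U :: "'a ell2 set"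
  show "dist A B = norm (A - B)" by (rule dist_ell2_def)
  show "sgn A = A /\<^sub>R norm A" by (rule sgn_ell2_def)
  show "(uniformity :: ('a ell2 \<times> 'a ell2) filter)
      = (INF e\<in>{0<..}. principal {(A, B). dist A B < e})"
    by (rule uniformity_ell2_def)
  show "open U \<longleftrightarrow> (\<forall>A\<in>U. \<forall>\<^sub>F (A', B) in uniformity. A' = A \<longrightarrow> B \<in> U)"
    by (rule open_ell2_def)
  show "inner A B = inner B A"
    by (simp add: inner_ell2_def mult.commute)
  have mult: "(\<lambda>i. ell2_nth A i * ell2_nth B i) summable_on UNIV" for A B :: "'a ell2"
    by (intro square_summable_mult ell2_square_summable)
  show "inner (A + B) C = inner A C + inner B C"
    by (simp add: inner_ell2_def plus_ell2.rep_eq distrib_right infsum_add mult)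
  show "inner (r *\<^sub>R A) B = r * inner A B"
    by (simp add: inner_ell2_def scaleR_ell2.rep_eq mult.assoc infsum_cmult_right')
  show "0 \<le> inner A A"
    by (auto simp: inner_ell2_def intro!: infsum_nonneg)
  show "inner A A = 0 \<longleftrightarrow> A = 0"
  proof
    assume "inner A A = 0"
    then have "ell2_nth A i * ell2_nth A i = 0" for i
      using mult[of A A]
      by (intro nonneg_infsum_le_0D[of "\<lambda>i. ell2_nth A i * ell2_nth A i" UNIV])
         (auto simp: inner_ell2_def)
    then show "A = 0"
      by (intro ell2_eqI) (simp add: zero_ell2.rep_eq)
  qed (simp add: inner_ell2_def zero_ell2.rep_eq)
  show "norm A = sqrt (inner A A)" by (rule norm_ell2_def)
qed

end

lemma ell2_norm_square: "(norm A)\<^sup>2 = (\<Sum>\<^sub>\<infinity>i. (ell2_nth A i)\<^sup>2)"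
  unfolding power2_norm_eq_inner inner_ell2_def by (simp add: power2_eq_square)

lemma ell2_sum_le: "finite F \<Longrightarrow> (\<Sum>i\<in>F. (ell2_nth A i)\<^sup>2) \<le> (norm A)\<^sup>2"
  unfolding ell2_norm_square
  by (rule finite_sum_le_infsum) (auto simp: ell2_square_summable)

lemma ell2_nth_le: "\<bar>ell2_nth A i\<bar> \<le> norm A"
  using ell2_sum_le[of "{i}" A] by (simp add: abs_le_square_iff[symmetric])

instance ell2 :: (type) complete_space
proof
  fix X :: "nat \<Rightarrow> 'a ell2"
  assume X: "Cauchy X"
  have "Cauchy (\<lambda>n. ell2_nth (X n) i)" for i
  proof (rule metric_CauchyI)
    fix e :: real assume "0 < e"
    then obtain N where N: "\<And>m n. m \<ge> N \<Longrightarrow> n \<ge> N \<Longrightarrow> dist (X m) (X n) < e"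
      using X metric_CauchyD by blast
    have "dist (ell2_nth (X m) i) (ell2_nth (X n) i) \<le> dist (X m) (X n)" for m n
      using ell2_nth_le[of "X m - X n" i] by (simp add: dist_norm minus_ell2.rep_eq)
    then show "\<exists>M. \<forall>m\<ge>M. \<forall>n\<ge>M. dist (ell2_nth (X m) i) (ell2_nth (X n) i) < e"
      using N le_less_trans by blast
  qed
  then obtain f where f: "\<And>i. (\<lambda>n. ell2_nth (X n) i) \<longlonglongrightarrow> f i"
    unfolding Cauchy_convergent_iff convergent_def by metis
  have tail: "\<exists>N. \<forall>n\<ge>N. \<forall>F. finite F \<longrightarrow> (\<Sum>i\<in>F. (ell2_nth (X n) i - f i)\<^sup>2) \<le> e\<^sup>2"
    if "0 < e" for e
  proof -
    obtain N where N: "\<And>m n. m \<ge> N \<Longrightarrow> n \<ge> N \<Longrightarrow> dist (X m) (X n) < e"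
      using X metric_CauchyD \<open>0 < e\<close> by blast
    have "(\<Sum>i\<in>F. (ell2_nth (X n) i - f i)\<^sup>2) \<le> e\<^sup>2" if "n \<ge> N" "finite F" for n F
    proof (rule LIMSEQ_le_const2)
      show "(\<lambda>m. \<Sum>i\<in>F. (ell2_nth (X n) i - ell2_nth (X m) i)\<^sup>2)
              \<longlonglongrightarrow> (\<Sum>i\<in>F. (ell2_nth (X n) i - f i)\<^sup>2)"
        by (intro tendsto_intros f)
      have "(\<Sum>i\<in>F. (ell2_nth (X n) i - ell2_nth (X m) i)\<^sup>2) \<le> e\<^sup>2" if "m \<ge> N" for m
      proof -
        have "(\<Sum>i\<in>F. (ell2_nth (X n) i - ell2_nth (X m) i)\<^sup>2) \<le> (norm (X n - X m))\<^sup>2"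
          using ell2_sum_le[OF \<open>finite F\<close>, of "X n - X m"] by (simp add: minus_ell2.rep_eq)
        also have "\<dots> \<le> e\<^sup>2"
          using N[OF \<open>n \<ge> N\<close> \<open>m \<ge> N\<close>] by (intro power_mono) (auto simp: dist_norm)
        finally show ?thesis .
      qed
      then show "\<exists>M. \<forall>m\<ge>M. (\<Sum>i\<in>F. (ell2_nth (X n) i - ell2_nth (X m) i)\<^sup>2) \<le> e\<^sup>2"
        by blast
    qed
    then show ?thesis by blast
  qed
  have diff: "(\<lambda>i. (ell2_nth (X n) i - f i)\<^sup>2) summable_on UNIV"
    if "\<forall>F. finite F \<longrightarrow> (\<Sum>i\<in>F. (ell2_nth (X n) i - f i)\<^sup>2) \<le> e\<^sup>2" for n e
    using that by (intro nonneg_bdd_above_summable_on) (auto simp: bdd_above_def)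
  have "(\<lambda>i. (f i)\<^sup>2) summable_on UNIV"
  proof -
    obtain N where N: "\<forall>F. finite F \<longrightarrow> (\<Sum>i\<in>F. (ell2_nth (X N) i - f i)\<^sup>2) \<le> 1\<^sup>2"
      using tail[of 1] by auto
    have "(\<lambda>i. (- (ell2_nth (X N) i - f i))\<^sup>2) summable_on UNIV"
      unfolding power2_minus by (rule diff[OF N])
    then have "(\<lambda>i. (ell2_nth (X N) i + - (ell2_nth (X N) i - f i))\<^sup>2) summable_on UNIV"
      by (intro square_summable_add ell2_square_summable)
    then show ?thesis by simp
  qed
  then have nth: "ell2_nth (Abs_ell2 f) = f"
    by (simp add: Abs_ell2_inverse)
  have "X \<longlonglongrightarrow> Abs_ell2 f"
  proof (rule metric_LIMSEQ_I)
    fix e :: real assume "0 < e"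
    then obtain N where
      N: "\<forall>n\<ge>N. \<forall>F. finite F \<longrightarrow> (\<Sum>i\<in>F. (ell2_nth (X n) i - f i)\<^sup>2) \<le> (e/2)\<^sup>2"
      using tail[of "e/2"] by auto
    have "dist (X n) (Abs_ell2 f) < e" if "n \<ge> N" for n
    proof -
      have "(norm (X n - Abs_ell2 f))\<^sup>2 \<le> (e/2)\<^sup>2"
        unfolding ell2_norm_square
        by (rule infsum_le_finite_sums)
           (use N that in \<open>auto simp: minus_ell2.rep_eq nth intro!: diff[where e = "e/2"]\<close>)
      then have "norm (X n - Abs_ell2 f) \<le> e/2"
        using \<open>0 < e\<close> by (simp add: power2_le_iff_abs_le)
      then show ?thesis
        using \<open>0 < e\<close> by (simp add: dist_norm)
    qed
    then show "\<exists>N. \<forall>n\<ge>N. dist (X n) (Abs_ell2 f) < e" by blast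
  qed
  then show "convergent X"
    by (auto simp: convergent_def)
qed

lift_definition ell2_unit :: "'l \<Rightarrow> 'l ell2" is "\<lambda>i j. if j = i then 1 else 0"
proof -
  fix i :: 'l
  show "(\<lambda>j. (if j = i then 1 else 0 :: real)\<^sup>2) summable_on UNIV"
    by (rule finite_nonzero_values_imp_summable_on) (rule finite_subset[of _ "{i}"], auto)
qed

lemma inner_ell2_unit: "inner A (ell2_unit i) = ell2_nth A i"
proof -
  have "inner A (ell2_unit i) = (\<Sum>\<^sub>\<infinity>j\<in>{i}. ell2_nth A j)"
    unfolding inner_ell2_def by (rule infsum_cong_neutral) (auto simp: ell2_unit.rep_eq)
  then show ?thesis by simp
qed

lemma orthonormal_basis_ell2_unit: "orthonormal_basis (ell2_unit :: 'l \<Rightarrow> 'l ell2)"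
  unfolding orthonormal_basis_def
proof (intro conjI allI)
  show "inner (ell2_unit i) (ell2_unit j :: 'l ell2) = (if i = j then 1 else 0)" for i j
    by (simp add: inner_ell2_unit ell2_unit.rep_eq)
  show "closure (span (range (ell2_unit :: 'l \<Rightarrow> 'l ell2))) = UNIV"
  proof (intro equalityI subsetI UNIV_I)
    fix A :: "'l ell2"
    have "\<exists>B\<in>span (range ell2_unit). dist B A < e" if "0 < e" for e
    proof -
      have "((\<lambda>i. (ell2_nth A i)\<^sup>2) has_sum (norm A)\<^sup>2) UNIV"
        by (simp add: ell2_norm_square ell2_square_summable)
      then have "\<forall>\<^sub>F F in finite_subsets_at_top UNIV.
                   dist (\<Sum>i\<in>F. (ell2_nth A i)\<^sup>2) ((norm A)\<^sup>2) < e\<^sup>2"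
        unfolding has_sum_def using \<open>0 < e\<close> by (intro tendstoD) auto
      then obtain F where "finite F" and F: "dist (\<Sum>i\<in>F. (ell2_nth A i)\<^sup>2) ((norm A)\<^sup>2) < e\<^sup>2"
        unfolding eventually_finite_subsets_at_top by blast
      define B where "B = (\<Sum>i\<in>F. ell2_nth A i *\<^sub>R ell2_unit i)"
      have nthsum: "ell2_nth (\<Sum>i\<in>F. c i *\<^sub>R ell2_unit i) j = (if j \<in> F then c j else 0)"
        for c :: "'l \<Rightarrow> real" and j
        using \<open>finite F\<close>
        by (simp flip: inner_ell2_unit add: inner_sum_left)
           (simp add: inner_ell2_unit ell2_unit.rep_eq if_distrib cong: if_cong)
      have "inner B A = (\<Sum>i\<in>F. (ell2_nth A i)\<^sup>2)"
        by (subst inner_commute) (simp add: B_def inner_sum_right inner_ell2_unit power2_eq_square)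
      moreover have "inner B B = (\<Sum>i\<in>F. (ell2_nth A i)\<^sup>2)"
      proof -
        have "inner B B = (\<Sum>i\<in>F. ell2_nth A i * ell2_nth B i)"
          by (subst (2) B_def) (simp add: inner_sum_right inner_ell2_unit)
        then show ?thesis by (simp add: B_def nthsum power2_eq_square)
      qed
      ultimately have "(dist B A)\<^sup>2 = (norm A)\<^sup>2 - (\<Sum>i\<in>F. (ell2_nth A i)\<^sup>2)"
        by (simp add: dist_norm power2_norm_eq_inner inner_diff inner_commute)
      also have "\<dots> < e\<^sup>2" using F by (simp add: dist_real_def)
      finally have "dist B A < e"
        using \<open>0 < e\<close> by (simp add: power2_less_imp_less)
      moreover have "B \<in> span (range ell2_unit)"
        unfolding B_def by (intro span_sum span_scale span_base) auto
      ultimately show ?thesis by blast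
    qed
    then show "A \<in> closure (span (range ell2_unit))"
      by (simp add: closure_approachable)
  qed
qed

text \<open>
  The tensor space over a Hilbert space with basis indexed by \<open>'i\<close>.  The summand of tensor degree
  \<open>k\<close> has an orthonormal basis indexed by the words of length \<open>k\<close>, so the Hilbert direct sum over
  all \<open>k\<close> is the space of square-summable families indexed by all words; \<^term>\<open>ell2_unit w\<close> is the
  elementary tensor of the basis vectors named by the letters of \<open>w\<close>.
\<close>

type_synonym 'i tensor_space = "'i list ell2"

lemma inner_tensor_space:
  fixes A B :: "'i tensor_space"
  shows "inner A B = (\<Sum>\<^sub>\<infinity>k. \<Sum>\<^sub>\<infinity>w\<in>{w. length w = k}. ell2_nth A w * ell2_nth B w)"
proof -
  let ?g = "\<lambda>w. ell2_nth A w * ell2_nth B w"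
  let ?S = "SIGMA k:UNIV. {w :: 'i list. length w = k}"
  have inj: "inj_on snd ?S" by (auto simp: inj_on_def)
  have img: "snd ` ?S = UNIV" by (force simp: image_iff)
  have "?g summable_on snd ` ?S"
    unfolding img by (intro square_summable_mult ell2_square_summable)
  then have "(\<lambda>(k, w). ?g w) summable_on ?S"
    using summable_on_reindex[OF inj, of ?g] by (simp add: comp_def case_prod_unfold)
  then have "(\<Sum>\<^sub>\<infinity>k. \<Sum>\<^sub>\<infinity>w\<in>{w. length w = k}. ?g w) = (\<Sum>\<^sub>\<infinity>(k, w)\<in>?S. ?g w)"
    by (rule infsum_Sigma'_banach)
  also have "\<dots> = (\<Sum>\<^sub>\<infinity>w\<in>snd ` ?S. ?g w)"
    by (simp add: infsum_reindex[OF inj] comp_def case_prod_unfold)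
  finally show ?thesis
    unfolding img inner_ell2_def by simp
qed

section \<open>Lipschitz paths\<close>

text \<open>Paths are total functions that are \<^term>\<open>undefined\<close> off the interval, so that equality of
  paths is equality on the interval.\<close>

definition lip_paths :: "real \<Rightarrow> real \<Rightarrow> (real \<Rightarrow> 'v::real_normed_vector) set" where
  "lip_paths a T = {x \<in> extensional {a..T}. \<exists>L. L-lipschitz_on {a..T} x}"

definition lip_norm :: "real \<Rightarrow> real \<Rightarrow> (real \<Rightarrow> 'v::real_normed_vector) \<Rightarrow> real" where
  "lip_norm a T x = norm (x a) +
     (SUP (s, t) \<in> {(s, t). s \<in> {a..T} \<and> t \<in> {a..T} \<and> s \<noteq> t}. norm (x t - x s) / \<bar>t - s\<bar>)"

text \<open>The value \<open>0\<close> off the space is irrelevant; the locale \<^locale>\<open>Metric_space\<close> demands a total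
  distance function that is nonnegative everywhere.\<close>

definition lip_dist ::
    "real \<Rightarrow> real \<Rightarrow> (real \<Rightarrow> 'v::real_normed_vector) \<Rightarrow> (real \<Rightarrow> 'v) \<Rightarrow> real" where
  "lip_dist a T x y =
     (if x \<in> lip_paths a T \<and> y \<in> lip_paths a T then lip_norm a T (\<lambda>t. x t - y t) else 0)"

definition lip_topology :: "real \<Rightarrow> real \<Rightarrow> (real \<Rightarrow> 'v::real_normed_vector) topology" where
  "lip_topology a T = Metric_space.mtopology (lip_paths a T) (lip_dist a T)"

lemma lip_quotient_bdd_above:
  assumes "L-lipschitz_on {a..T} x"
  shows "bdd_above ((\<lambda>(s, t). norm (x t - x s) / \<bar>t - s\<bar>) `
           {(s, t). s \<in> {a..T} \<and> t \<in> {a..T} \<and> s \<noteq> t})"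
proof (rule bdd_aboveI2[where M = L], clarify)
  fix s t assume st: "s \<in> {a..T}" "t \<in> {a..T}" "s \<noteq> t"
  then have "norm (x t - x s) \<le> L * \<bar>t - s\<bar>"
    using lipschitz_onD[OF assms, of t s] by (simp add: dist_norm)
  then show "norm (x t - x s) / \<bar>t - s\<bar> \<le> L"
    using st by (simp add: divide_le_eq)
qed

lemma Metric_space_lip:
  fixes a T :: real
  assumes "a < T"
  shows "Metric_space (lip_paths a T :: (real \<Rightarrow> 'v::real_normed_vector) set) (lip_dist a T)"
proof -
  let ?P = "{(s, t). s \<in> {a..T} \<and> t \<in> {a..T} \<and> s \<noteq> t}"
  let ?q = "\<lambda>(x :: real \<Rightarrow> 'v). \<lambda>(s, t). norm (x t - x s) / \<bar>t - s\<bar>"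
  have ne: "(a, T) \<in> ?P" using assms by simp
  have dist_eq: "lip_dist a T x y = norm (x a - y a) + (SUP p\<in>?P. ?q (\<lambda>t. x t - y t) p)"
    if "x \<in> lip_paths a T" "y \<in> lip_paths a T" for x y :: "real \<Rightarrow> 'v"
    using that by (simp add: lip_dist_def lip_norm_def case_prod_unfold)
  have bdd: "bdd_above (?q (\<lambda>t. x t - y t) ` ?P)"
    if xy: "x \<in> lip_paths a T" "y \<in> lip_paths a T" for x y :: "real \<Rightarrow> 'v"
  proof -
    obtain L M where "L-lipschitz_on {a..T} x" "M-lipschitz_on {a..T} y"
      using xy by (auto simp: lip_paths_def)
    then have "(L + M)-lipschitz_on {a..T} (\<lambda>t. x t - y t)"
      by (rule lipschitz_on_diff)
    then show ?thesis by (rule lip_quotient_bdd_above)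
  qed
  have upper: "?q (\<lambda>t. x t - y t) p \<le> (SUP p\<in>?P. ?q (\<lambda>t. x t - y t) p)"
    if "x \<in> lip_paths a T" "y \<in> lip_paths a T" "p \<in> ?P" for x y :: "real \<Rightarrow> 'v" and p
    using that by (intro cSUP_upper bdd)
  have nonneg: "0 \<le> (SUP p\<in>?P. ?q (\<lambda>t. x t - y t) p)"
    if "x \<in> lip_paths a T" "y \<in> lip_paths a T" for x y :: "real \<Rightarrow> 'v"
    using upper[OF that ne] by (rule order_trans[rotated]) simp
  show ?thesis
  proof
    fix x y :: "real \<Rightarrow> 'v"
    show "lip_dist a T x y = lip_dist a T y x"
    proof -
      have "?q (\<lambda>t. x t - y t) = ?q (\<lambda>t. y t - x t)"
      proof (rule ext, clarify)
        fix s t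
        have "norm (x t - y t - (x s - y s)) = norm (y t - x t - (y s - x s))"
          by (subst norm_minus_cancel[symmetric]) (simp add: algebra_simps)
        then show "norm (x t - y t - (x s - y s)) / \<bar>t - s\<bar>
                 = norm (y t - x t - (y s - x s)) / \<bar>t - s\<bar>" by simp
      qed
      then have "lip_norm a T (\<lambda>t. x t - y t) = lip_norm a T (\<lambda>t. y t - x t)"
        by (simp only: lip_norm_def norm_minus_commute[of "x a"])
      then show ?thesis by (simp add: lip_dist_def)
    qed
  next
    fix x y :: "real \<Rightarrow> 'v"
    show "0 \<le> lip_dist a T x y"
      using nonneg[of x y] dist_eq[of x y] by (auto simp: lip_dist_def)
  next
    fix x y :: "real \<Rightarrow> 'v"
    assume xy: "x \<in> lip_paths a T" "y \<in> lip_paths a T"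
    show "lip_dist a T x y = 0 \<longleftrightarrow> x = y"
    proof
      assume 0: "lip_dist a T x y = 0"
      then have *: "norm (x a - y a) = 0" "(SUP p\<in>?P. ?q (\<lambda>t. x t - y t) p) = 0"
        using nonneg[OF xy] norm_ge_zero[of "x a - y a"] unfolding dist_eq[OF xy] by linarith+
      have "x t = y t" if "t \<in> {a..T}" for t
      proof (cases "t = a")
        case False
        then have "(a, t) \<in> ?P" using that by auto
        then have "norm (x t - y t - (x a - y a)) / \<bar>t - a\<bar> \<le> 0"
          using upper[OF xy, of "(a, t)"] *(2) by simp
        then show ?thesis
          using False *(1) by (simp add: divide_le_0_iff)
      qed (use * in simp)
      then show "x = y"
        using xy by (auto simp: lip_paths_def intro: extensionalityI)
    next
      assume "x = y"
      have "(SUP p\<in>?P. 0 :: real) = 0"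
        using ne by (intro cSUP_const) blast
      with \<open>x = y\<close> show "lip_dist a T x y = 0"
        unfolding dist_eq[OF xy] by (simp add: case_prod_unfold)
    qed
  next
    fix x y z :: "real \<Rightarrow> 'v"
    assume xyz: "x \<in> lip_paths a T" "y \<in> lip_paths a T" "z \<in> lip_paths a T"
    have "(SUP p\<in>?P. ?q (\<lambda>t. x t - z t) p)
        \<le> (SUP p\<in>?P. ?q (\<lambda>t. x t - y t) p) + (SUP p\<in>?P. ?q (\<lambda>t. y t - z t) p)"
    proof (rule cSUP_least)
      show "?P \<noteq> {}" using ne by blast
      fix p assume p: "p \<in> ?P"
      obtain s t where st: "p = (s, t)" by fastforce
      have "norm (x t - z t - (x s - z s))
          \<le> norm (x t - y t - (x s - y s)) + norm (y t - z t - (y s - z s))"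
        using norm_triangle_ineq[of "x t - y t - (x s - y s)" "y t - z t - (y s - z s)"]
        by (simp add: algebra_simps)
      then have "?q (\<lambda>t. x t - z t) p \<le> ?q (\<lambda>t. x t - y t) p + ?q (\<lambda>t. y t - z t) p"
        by (simp add: st divide_right_mono flip: add_divide_distrib)
      also have "\<dots> \<le> (SUP p\<in>?P. ?q (\<lambda>t. x t - y t) p) + (SUP p\<in>?P. ?q (\<lambda>t. y t - z t) p)"
        using xyz p by (intro add_mono upper)
      finally show "?q (\<lambda>t. x t - z t) p
        \<le> (SUP p\<in>?P. ?q (\<lambda>t. x t - y t) p) + (SUP p\<in>?P. ?q (\<lambda>t. y t - z t) p)" .
    qed
    moreover have "norm (x a - z a) \<le> norm (x a - y a) + norm (y a - z a)"
      using norm_triangle_ineq[of "x a - y a" "y a - z a"] by simp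
    ultimately show "lip_dist a T x z \<le> lip_dist a T x y + lip_dist a T y z"
      using xyz by (simp add: dist_eq)
  qed
qed

section \<open>Signatures\<close>

subsection \<open>The Riemann--Stieltjes integral\<close>

definition has_rs_integral ::
    "(real \<Rightarrow> real) \<Rightarrow> (real \<Rightarrow> real) \<Rightarrow> real \<Rightarrow> real \<Rightarrow> real \<Rightarrow> bool" where
  "has_rs_integral f g s t I \<longleftrightarrow>
     (\<forall>\<epsilon>>0. \<exists>\<delta>>0. \<forall>p. p tagged_division_of {s..t} \<and> (\<lambda>u. ball u \<delta>) fine p \<longrightarrow>
        \<bar>(\<Sum>(u, K)\<in>p. f u * (g (Sup K) - g (Inf K))) - I\<bar> < \<epsilon>)"

definition rs_integral ::
    "real \<Rightarrow> real \<Rightarrow> (real \<Rightarrow> real) \<Rightarrow> (real \<Rightarrow> real) \<Rightarrow> real" where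
  "rs_integral s t f g = (THE I. has_rs_integral f g s t I)"

lemma has_rs_integral_unique:
  assumes "has_rs_integral f g s t I" "has_rs_integral f g s t J"
  shows "I = J"
proof (rule ccontr)
  assume "I \<noteq> J"
  then have e: "\<bar>I - J\<bar> / 2 > 0" by simp
  let ?sum = "\<lambda>p. \<Sum>(u, K)\<in>p. f u * (g (Sup K) - g (Inf K))"
  obtain d where d: "d > 0"
    "\<And>p. p tagged_division_of {s..t} \<Longrightarrow> (\<lambda>u. ball u d) fine p \<Longrightarrow> \<bar>?sum p - I\<bar> < \<bar>I - J\<bar> / 2"
    using assms(1)[unfolded has_rs_integral_def, rule_format, OF e] by auto
  obtain d' where d': "d' > 0"
    "\<And>p. p tagged_division_of {s..t} \<Longrightarrow> (\<lambda>u. ball u d') fine p \<Longrightarrow> \<bar>?sum p - J\<bar> < \<bar>I - J\<bar> / 2"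
    using assms(2)[unfolded has_rs_integral_def, rule_format, OF e] by auto
  have "gauge (\<lambda>u :: real. ball u (min d d'))"
    using d(1) d'(1) by (intro gaugeI) auto
  then obtain p where p: "p tagged_division_of {s..t}" "(\<lambda>u. ball u (min d d')) fine p"
    by (rule fine_division_exists_real)
  have fine: "(\<lambda>u. ball u d) fine p" "(\<lambda>u. ball u d') fine p"
    using p(2) unfolding fine_def by fastforce+
  show False
    using d(2)[OF p(1) fine(1)] d'(2)[OF p(1) fine(2)]
      abs_triangle_ineq4[of "?sum p - J" "?sum p - I"] by simp
qed

lemma rs_integral_eq: "has_rs_integral f g s t I \<Longrightarrow> rs_integral s t f g = I"
  unfolding rs_integral_def by (blast intro: has_rs_integral_unique)

subsection \<open>Iterated integrals\<close>

text \<open>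
  \<open>sig_coord b a t x w\<close> is the coordinate with index \<open>w\<close> of the signature of \<open>x\<close> over \<open>{a..t}\<close>, with
  respect to the orthonormal basis \<open>b\<close>.  The last letter of \<open>w\<close> belongs to the largest variable of the
  simplex \<open>a < u\<^sub>1 < \<dots> < u\<^sub>k < t\<close>, hence to the outermost integral, see \<open>sig_coord_snoc\<close>.
\<close>

definition sig_coord ::
    "('l \<Rightarrow> 'v::real_inner) \<Rightarrow> real \<Rightarrow> real \<Rightarrow> (real \<Rightarrow> 'v) \<Rightarrow> 'l list \<Rightarrow> real" where
  "sig_coord b a t x w =
     foldl (\<lambda>G i u. rs_integral a u G (\<lambda>r. inner (x r) (b i))) (\<lambda>_. 1) w t"

lemma sig_coord_Nil [simp]: "sig_coord b a t x [] = 1"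
  by (simp add: sig_coord_def)

lemma sig_coord_snoc:
  "sig_coord b a t x (w @ [i]) =
     rs_integral a t (\<lambda>u. sig_coord b a u x w) (\<lambda>r. inner (x r) (b i))"
  by (simp add: sig_coord_def)

definition signature ::
    "('i \<Rightarrow> 'v::real_inner) \<Rightarrow> real \<Rightarrow> real \<Rightarrow> (real \<Rightarrow> 'v) \<Rightarrow> 'i tensor_space" where
  "signature e a t x = Abs_ell2 (sig_coord e a t x)"

definition tree_like_equiv ::
    "('i \<Rightarrow> 'v::real_inner) \<Rightarrow> real \<Rightarrow> real \<Rightarrow> (real \<Rightarrow> 'v) \<Rightarrow> (real \<Rightarrow> 'v) \<Rightarrow> bool" where
  "tree_like_equiv e a T x y \<longleftrightarrow> signature e a T x = signature e a T y"

section \<open>Probability measures and weak convergence\<close>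

definition prob_measures :: "'p topology \<Rightarrow> 'p measure set" where
  "prob_measures X =
     {\<mu>. prob_space \<mu> \<and> space \<mu> = topspace X \<and> sets \<mu> = sigma_sets (topspace X) {U. openin X U}}"

text \<open>The coarsest topology on the probability measures for which \<open>\<mu> \<mapsto> \<integral>f d\<mu>\<close> is continuous for every
  continuous \<open>f\<close>.  No boundedness of \<open>f\<close> is required: the definition is for compact spaces.\<close>

definition weak_topology :: "'p topology \<Rightarrow> 'p measure topology" where
  "weak_topology X = topology_generated_by
     {{\<mu> \<in> prob_measures X. integral\<^sup>L \<mu> f \<in> U} | f U.
        continuous_map X euclideanreal f \<and> open U}"

lemma topspace_weak_topology [simp]: "topspace (weak_topology X) = prob_measures X"
proof -
  let ?\<G> = "{{\<mu> \<in> prob_measures X. integral\<^sup>L \<mu> f \<in> U} | f U.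
        continuous_map X euclideanreal f \<and> open U}"
  have "continuous_map X euclideanreal (\<lambda>_. 0) \<and> open (UNIV :: real set)" by simp
  then have "{\<mu> \<in> prob_measures X. integral\<^sup>L \<mu> (\<lambda>_. 0 :: real) \<in> UNIV} \<in> ?\<G>" by blast
  then have "prob_measures X \<in> ?\<G>" by (simp only: UNIV_I simp_thms Collect_mem_eq)
  then have "prob_measures X \<subseteq> \<Union>?\<G>" by (rule Union_upper)
  moreover have "\<Union>?\<G> \<subseteq> prob_measures X" by blast
  ultimately show ?thesis
    unfolding weak_topology_def topology_generated_by_topspace by (rule equalityI[rotated])
qed

definition expected_signature ::
    "('i \<Rightarrow> 'v::real_inner) \<Rightarrow> real \<Rightarrow> real \<Rightarrow> (real \<Rightarrow> 'v) measure \<Rightarrow> real \<Rightarrow> 'i tensor_space" where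
  "expected_signature e a T \<mu> = (\<lambda>t\<in>{a..T}.
     Abs_ell2 (\<lambda>w. LINT x|\<mu>. ell2_nth (signature e a t (restrict x {a..t})) w))"

end

theory Submission
  imports Defs
begin

text \<open>
  The first-level coordinates of \<open>S(\<Phi>(\<mu>))\<close> are the moments \<open>\<integral> S(x)\<^sup>w d\<mu>(x)\<close> (up to the constant \<open>1\<close> for
  \<open>w = []\<close>), and by the shuffle identity products of them are again linear combinations of coordinates
  of \<open>S(\<Phi>(\<mu>))\<close>.  On the compact set \<open>X\<close> the coordinates \<open>S(x)\<^sup>w\<close> are continuous, separate points and span
  an algebra, so by Stone--Weierstrass the moments determine all integrals of continuous functions and
  convergence of moments is weak convergence.  Hence \<open>F\<close> is a continuous function of the moment
  sequence, which ranges over a compact set because the probability measures on \<open>X\<close> are weakly compact,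
  and a second application of Stone--Weierstrass, on this set, gives the claim.  Continuity of the
  coordinates of \<open>S(\<Phi>(\<mu>))\<close> of higher level in \<open>\<mu>\<close> is never needed.
\<close>

section \<open>Riemann--Stieltjes integrals of Lipschitz functions\<close>

text \<open>Integrals are handled through the estimate in \<open>rs_primitive\<close>. A function
  whose increments over \<open>[s,t]\<close> are at most \<open>C * (t - s)^2\<close> in absolute
  value is constant, as subdivision shows, so the product rule behind the shuffle identity, the size
  bounds and the continuity in the path are all checked on small increments. Riemann sums serve
  chiefly to identify the integral with such a primitive. Compactness of \<open>X\<close> also
  yields one Lipschitz constant \<open>L\<close> for all its paths, so that the coordinate estimates
  are uniform and survive the expectation. Elements of the tensor space are produced by
  \<open>Abs_ell2\<close>, which is meaningful only on square-summable families; hence the factorial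
  bound is proved for the Euclidean norm of a whole level and not just for single coordinates. The
  higher coordinates of \<open>S(\<Phi>(\<mu>))\<close> matter only through a span that is closed
  under products: Stone-Weierstrass is applied to those continuous functions of the moment sequence
  whose pullback lies in this span. Moment sequences live in a countable product of lines, so
  arguments with sequences suffice.\<close>

text \<open>Cutting \<open>[a,b]\<close> into \<open>n\<close> equal pieces leaves a total error of
  \<open>n * C * ((b - a) / n)^2\<close>, which tends to 0. Inequalities between integrals are
  thereby reduced to their infinitesimal form.\<close>

lemma telescope_quadratic_le:
  fixes \<psi> :: "real \<Rightarrow> real"
  assumes "a \<le> b"
    and local: "\<And>s t. a \<le> s \<Longrightarrow> s \<le> t \<Longrightarrow> t \<le> b \<Longrightarrow> \<psi> t - \<psi> s \<le> C * (t - s)\<^sup>2"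
  shows "\<psi> b \<le> \<psi> a"
proof -
  have bound: "\<psi> b - \<psi> a \<le> C * (b - a)\<^sup>2 * inverse (real (Suc n))" for n
  proof -
    define h where "h = (b - a) / real (Suc n)"
    have h: "0 \<le> h" "real (Suc n) * h = b - a"
      using \<open>a \<le> b\<close> by (simp_all add: h_def)
    have "\<psi> b - \<psi> a = (\<Sum>k<Suc n. \<psi> (a + real (Suc k) * h) - \<psi> (a + real k * h))"
      using h(2) by (subst sum_lessThan_telescope) simp
    also have "\<dots> \<le> (\<Sum>k<Suc n. C * h\<^sup>2)"
    proof (rule sum_mono)
      fix k assume "k \<in> {..<Suc n}"
      then have "real (Suc k) * h \<le> b - a"
        unfolding h(2)[symmetric] using h(1) by (intro mult_right_mono) auto
      then have "\<psi> (a + real (Suc k) * h) - \<psi> (a + real k * h)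
                  \<le> C * (a + real (Suc k) * h - (a + real k * h))\<^sup>2"
        using h(1) by (intro local) (auto simp: algebra_simps)
      then show "\<psi> (a + real (Suc k) * h) - \<psi> (a + real k * h) \<le> C * h\<^sup>2"
        by (simp add: algebra_simps)
    qed
    also have "\<dots> = C * (real (Suc n) * h)\<^sup>2 * inverse (real (Suc n))"
      by (simp add: power2_eq_square field_simps del: of_nat_Suc)
    finally show ?thesis unfolding h(2) .
  qed
  have "\<psi> b - \<psi> a \<le> C * (b - a)\<^sup>2 * 0"
    by (rule LIMSEQ_le_const[OF tendsto_mult[OF tendsto_const LIMSEQ_inverse_real_of_nat]])
       (use bound in auto)
  then show ?thesis by simp
qed

text \<open>The one-sided lemma is applied to \<open>\<psi> r - \<beta> * r\<close> and to
  \<open>- \<psi> r - \<beta> * r\<close>. The case \<open>\<beta> = 0\<close> shows that a function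
  with quadratic increments is constant; uniqueness of primitives and the product rule are of this
  kind.\<close>

lemma linear_bound_from_quadratic:
  fixes \<psi> :: "real \<Rightarrow> real"
  assumes "a \<le> s" "s \<le> t" "t \<le> b"
    and local: "\<And>s t. a \<le> s \<Longrightarrow> s \<le> t \<Longrightarrow> t \<le> b \<Longrightarrow>
      \<bar>\<psi> t - \<psi> s\<bar> \<le> \<beta> * (t - s) + C * (t - s)\<^sup>2"
  shows "\<bar>\<psi> t - \<psi> s\<bar> \<le> \<beta> * (t - s)"
proof -
  have loc: "\<bar>\<psi> t' - \<psi> s'\<bar> \<le> \<beta> * (t' - s') + C * (t' - s')\<^sup>2"
    if "s \<le> s'" "s' \<le> t'" "t' \<le> t" for s' t'
    using assms that by (intro local) auto
  have "\<psi> t - \<beta> * t \<le> \<psi> s - \<beta> * s"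
  proof (rule telescope_quadratic_le[where C = C and \<psi> = "\<lambda>r. \<psi> r - \<beta> * r", OF \<open>s \<le> t\<close>])
    show "\<psi> t' - \<beta> * t' - (\<psi> s' - \<beta> * s') \<le> C * (t' - s')\<^sup>2" if "s \<le> s'" "s' \<le> t'" "t' \<le> t" for s' t'
      using loc[OF that] by (simp add: right_diff_distrib)
  qed
  moreover have "- \<psi> t - \<beta> * t \<le> - \<psi> s - \<beta> * s"
  proof (rule telescope_quadratic_le[where C = C and \<psi> = "\<lambda>r. - \<psi> r - \<beta> * r", OF \<open>s \<le> t\<close>])
    show "- \<psi> t' - \<beta> * t' - (- \<psi> s' - \<beta> * s') \<le> C * (t' - s')\<^sup>2" if "s \<le> s'" "s' \<le> t'" "t' \<le> t" for s' t'
      using loc[OF that] by (simp add: right_diff_distrib)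
  qed
  ultimately show ?thesis by (simp add: algebra_simps abs_le_iff)
qed

text \<open>For Lipschitz \<open>f\<close> and \<open>g\<close> this local estimate characterises the indefinite integral of \<open>f\<close>
  against \<open>g\<close> up to a constant.\<close>

definition rs_primitive ::
    "real \<Rightarrow> real \<Rightarrow> (real \<Rightarrow> real) \<Rightarrow> (real \<Rightarrow> real) \<Rightarrow> (real \<Rightarrow> real) \<Rightarrow> bool" where
  "rs_primitive a T f g G \<longleftrightarrow>
     (\<exists>C. \<forall>s t. a \<le> s \<longrightarrow> s \<le> t \<longrightarrow> t \<le> T \<longrightarrow> \<bar>G t - G s - f s * (g t - g s)\<bar> \<le> C * (t - s)\<^sup>2)"

lemma rs_primitiveE:
  assumes "rs_primitive a T f g G"
  obtains C where "0 \<le> C"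
    "\<And>s t. a \<le> s \<Longrightarrow> s \<le> t \<Longrightarrow> t \<le> T \<Longrightarrow> \<bar>G t - G s - f s * (g t - g s)\<bar> \<le> C * (t - s)\<^sup>2"
proof -
  obtain C where C: "\<And>s t. a \<le> s \<Longrightarrow> s \<le> t \<Longrightarrow> t \<le> T \<Longrightarrow>
      \<bar>G t - G s - f s * (g t - g s)\<bar> \<le> C * (t - s)\<^sup>2"
    using assms unfolding rs_primitive_def by blast
  have "C * (t - s)\<^sup>2 \<le> \<bar>C\<bar> * (t - s)\<^sup>2" for s t :: real
    by (intro mult_right_mono) auto
  then show thesis
    using C by (intro that[of "\<bar>C\<bar>"]) (auto intro: order_trans[OF C])
qed

lemma lipschitz_on_realD:
  fixes f :: "real \<Rightarrow> 'a::real_normed_vector"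
  assumes "L-lipschitz_on {a..T} f" "a \<le> s" "s \<le> t" "t \<le> T"
  shows "norm (f t - f s) \<le> L * (t - s)"
proof -
  have "dist (f t) (f s) \<le> L * dist t s"
    using assms(2-) by (intro lipschitz_onD[OF assms(1)]) auto
  then show ?thesis using \<open>s \<le> t\<close> by (simp add: dist_norm)
qed

lemma lipschitz_on_realI:
  fixes f :: "real \<Rightarrow> 'a::real_normed_vector"
  assumes "0 \<le> L" "\<And>s t. a \<le> s \<Longrightarrow> s \<le> t \<Longrightarrow> t \<le> T \<Longrightarrow> norm (f t - f s) \<le> L * (t - s)"
  shows "L-lipschitz_on {a..T} f"
proof (rule lipschitz_onI[OF _ assms(1)])
  fix s t assume "s \<in> {a..T}" "t \<in> {a..T}"
  then show "dist (f s) (f t) \<le> L * dist s t"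
    using assms(2)[of s t] assms(2)[of t s]
    by (cases "s \<le> t") (auto simp: dist_norm norm_minus_commute)
qed

lemma lipschitz_on_real_bounded:
  fixes f :: "real \<Rightarrow> real"
  assumes "L-lipschitz_on {a..T} f"
  obtains M where "0 \<le> M" "\<And>t. a \<le> t \<Longrightarrow> t \<le> T \<Longrightarrow> \<bar>f t\<bar> \<le> M"
proof -
  have "bounded (f ` {a..T})"
    by (intro compact_imp_bounded compact_continuous_image lipschitz_on_continuous_on[OF assms]) auto
  then obtain M where "\<forall>t\<in>{a..T}. \<bar>f t\<bar> \<le> M" by (auto simp: bounded_iff)
  then show thesis by (intro that[of "max M 0"]) (auto intro: le_max_iff_disj[THEN iffD2])
qed

text \<open>If \<open>M\<close> bounds \<open>f\<close>, increments of \<open>G\<close> have rate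
  \<open>M * Lg\<close> up to a quadratic term, which drops out. A primitive can therefore serve as
  the next integrand, so iterated integrals stay among Lipschitz functions.\<close>

lemma rs_primitive_lipschitz:
  assumes "rs_primitive a T f g G" and f: "Lf-lipschitz_on {a..T} f" and g: "Lg-lipschitz_on {a..T} g"
  obtains L where "L-lipschitz_on {a..T} G"
proof -
  obtain C where C: "0 \<le> C"
    "\<And>s t. a \<le> s \<Longrightarrow> s \<le> t \<Longrightarrow> t \<le> T \<Longrightarrow> \<bar>G t - G s - f s * (g t - g s)\<bar> \<le> C * (t - s)\<^sup>2"
    using rs_primitiveE[OF assms(1)] by blast
  obtain M where M: "0 \<le> M" "\<And>t. a \<le> t \<Longrightarrow> t \<le> T \<Longrightarrow> \<bar>f t\<bar> \<le> M"
    using lipschitz_on_real_bounded[OF f] by blast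
  have Lg: "0 \<le> Lg" using lipschitz_on_nonneg[OF g] .
  have "\<bar>G t - G s\<bar> \<le> M * Lg * (t - s) + C * (t - s)\<^sup>2" if "a \<le> s" "s \<le> t" "t \<le> T" for s t
  proof -
    have "\<bar>f s * (g t - g s)\<bar> \<le> M * (Lg * (t - s))"
      unfolding abs_mult using M lipschitz_on_realD[OF g that] that by (intro mult_mono) auto
    then show ?thesis using C(2)[OF that] by linarith
  qed
  then have "\<bar>G t - G s\<bar> \<le> M * Lg * (t - s)" if "a \<le> s" "s \<le> t" "t \<le> T" for s t
    by (intro linear_bound_from_quadratic[OF that])
  then show thesis
    using M Lg by (intro that[of "M * Lg"] lipschitz_on_realI) auto
qed

text \<open>The increments of \<open>G\<close> telescope over the division. On an interval of length
  \<open>l\<close>, moving the tag to the left end costs at most \<open>Lf * Lg * l^2\<close> and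
  replacing the product by the increment of \<open>G\<close> at most \<open>C * l^2\<close>, so the
  total error is proportional to the mesh.\<close>

lemma has_rs_integral_primitive:
  assumes G: "rs_primitive a T f g G"
    and f: "Lf-lipschitz_on {a..T} f" and g: "Lg-lipschitz_on {a..T} g"
    and t: "a \<le> t" "t \<le> T"
  shows "has_rs_integral f g a t (G t - G a)"
  unfolding has_rs_integral_def
proof (intro allI impI)
  fix \<epsilon> :: real assume "\<epsilon> > 0"
  obtain C where C: "0 \<le> C"
    "\<And>s t. a \<le> s \<Longrightarrow> s \<le> t \<Longrightarrow> t \<le> T \<Longrightarrow> \<bar>G t - G s - f s * (g t - g s)\<bar> \<le> C * (t - s)\<^sup>2"
    using rs_primitiveE[OF G] by blast
  have Lfg: "0 \<le> Lf" "0 \<le> Lg" using lipschitz_on_nonneg[OF f] lipschitz_on_nonneg[OF g] by auto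
  define D where "D = C + Lf * Lg"
  have D: "0 \<le> D" using C Lfg by (simp add: D_def)
  \<comment> \<open>Intervals inside \<open>ball u \<delta>\<close> have length at most
    \<open>2 * \<delta>\<close>, so the error is at most \<open>2 * \<delta> * D * (t - a)\<close>.
    The added 1 keeps the denominator positive and the final inequality strict.\<close>
  define \<delta> where "\<delta> = \<epsilon> / (2 * (D * (t - a) + 1))"
  have pos: "D * (t - a) + 1 > 0" using D t by (simp add: add_nonneg_pos)
  then have \<delta>: "\<delta> > 0" using \<open>\<epsilon> > 0\<close> by (simp add: \<delta>_def)
  have "\<bar>(\<Sum>(u, K)\<in>p. f u * (g (Sup K) - g (Inf K))) - (G t - G a)\<bar> < \<epsilon>"
    if p: "p tagged_division_of {a..t}" and fine: "(\<lambda>u. ball u \<delta>) fine p" for p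
  proof -
    have est: "\<bar>f u * (g (Sup K) - g (Inf K)) - (G (Sup K) - G (Inf K))\<bar> \<le> 2 * \<delta> * D * measure lborel K"
      if "(u, K) \<in> p" for u K
    proof -
      from p that have u: "u \<in> K" "K \<subseteq> {a..t}" and "\<exists>c d. K = cbox c d"
        by (auto simp: tagged_division_of_def tagged_partial_division_of_def)
      then obtain c d where K: "K = {c..d}" by auto
      have cd: "c \<le> u" "u \<le> d" "a \<le> c" "d \<le> T" "c \<le> d" using u t K by auto
      have SI: "Sup K = d" "Inf K = c" "measure lborel K = d - c" using cd K by auto
      have "K \<subseteq> ball u \<delta>" using fine that by (auto simp: fine_def)
      then have "dist u d < \<delta>" "dist u c < \<delta>" using K cd by (auto simp: subset_iff)
      then have d: "d - c \<le> 2 * \<delta>" using cd by (simp add: dist_real_def)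
      have fu: "\<bar>f u - f c\<bar> \<le> Lf * (d - c)"
      proof -
        have "\<bar>f u - f c\<bar> \<le> Lf * (u - c)"
          using lipschitz_on_realD[OF f, of c u] cd by simp
        also have "\<dots> \<le> Lf * (d - c)" using Lfg cd by (intro mult_left_mono) auto
        finally show ?thesis .
      qed
      have gdc: "\<bar>g d - g c\<bar> \<le> Lg * (d - c)"
        using lipschitz_on_realD[OF g, of c d] cd by simp
      have "\<bar>(f u - f c) * (g d - g c)\<bar> \<le> (Lf * (d - c)) * (Lg * (d - c))"
        unfolding abs_mult using fu gdc Lfg cd by (intro mult_mono) auto
      moreover have "\<bar>G d - G c - f c * (g d - g c)\<bar> \<le> C * (d - c)\<^sup>2"
        using C(2) cd by simp
      moreover have "f u * (g d - g c) - (G d - G c)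
          = (f u - f c) * (g d - g c) - (G d - G c - f c * (g d - g c))"
        by (simp add: algebra_simps)
      ultimately have "\<bar>f u * (g d - g c) - (G d - G c)\<bar>
          \<le> (Lf * (d - c)) * (Lg * (d - c)) + C * (d - c)\<^sup>2" by linarith
      also have "\<dots> = D * (d - c) * (d - c)"
        by (simp add: D_def power2_eq_square algebra_simps)
      also have "\<dots> \<le> D * (2 * \<delta>) * (d - c)"
        using d D cd by (intro mult_right_mono mult_left_mono) auto
      finally show ?thesis unfolding SI by (simp add: algebra_simps)
    qed
    have GS: "(\<Sum>(u, K)\<in>p. G (Sup K) - G (Inf K)) = G t - G a"
      by (rule additive_tagged_division_1[OF t(1) p])
    have "\<bar>(\<Sum>(u, K)\<in>p. f u * (g (Sup K) - g (Inf K))) - (G t - G a)\<bar>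
        = \<bar>\<Sum>(u, K)\<in>p. f u * (g (Sup K) - g (Inf K)) - (G (Sup K) - G (Inf K))\<bar>"
      unfolding GS[symmetric] by (simp add: sum_subtractf case_prod_unfold)
    also have "\<dots> \<le> (\<Sum>(u, K)\<in>p. \<bar>f u * (g (Sup K) - g (Inf K)) - (G (Sup K) - G (Inf K))\<bar>)"
      by (rule order_trans[OF sum_abs]) (simp add: case_prod_unfold)
    also have "\<dots> \<le> (\<Sum>(u, K)\<in>p. 2 * \<delta> * D * measure lborel K)"
      using est by (intro sum_mono) auto
    also have "\<dots> = 2 * \<delta> * D * (\<Sum>(u, K)\<in>p. measure lborel K)"
      by (simp add: sum_distrib_left case_prod_unfold)
    also have "(\<Sum>(u, K)\<in>p. measure lborel K) = t - a"
      using additive_content_tagged_division[of p a t] p t by simp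
    also have "2 * \<delta> * D * (t - a) < \<epsilon>"
    proof -
      have "2 * \<delta> * (D * (t - a)) < 2 * \<delta> * (D * (t - a) + 1)" using \<delta> by simp
      also have "\<dots> = \<epsilon>" using pos unfolding \<delta>_def by (simp only: times_divide_eq_left times_divide_eq_right) (simp add: field_simps)
      finally show ?thesis by (simp add: mult.assoc)
    qed
    finally show ?thesis .
  qed
  then show "\<exists>\<delta>>0. \<forall>p. p tagged_division_of {a..t} \<and> (\<lambda>u. ball u \<delta>) fine p \<longrightarrow>
        \<bar>(\<Sum>(u, K)\<in>p. f u * (g (Sup K) - g (Inf K))) - (G t - G a)\<bar> < \<epsilon>"
    using \<delta> by blast
qed

lemma rs_primitive_unique:
  assumes "rs_primitive a T f g G" "rs_primitive a T f g H" "a \<le> t" "t \<le> T"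
  shows "G t - G a = H t - H a"
proof -
  obtain C where C: "\<And>s t. a \<le> s \<Longrightarrow> s \<le> t \<Longrightarrow> t \<le> T \<Longrightarrow> \<bar>G t - G s - f s * (g t - g s)\<bar> \<le> C * (t - s)\<^sup>2"
    using assms(1) unfolding rs_primitive_def by blast
  obtain D where D: "\<And>s t. a \<le> s \<Longrightarrow> s \<le> t \<Longrightarrow> t \<le> T \<Longrightarrow> \<bar>H t - H s - f s * (g t - g s)\<bar> \<le> D * (t - s)\<^sup>2"
    using assms(2) unfolding rs_primitive_def by blast
  have "\<bar>(G t - H t) - (G a - H a)\<bar> \<le> 0 * (t - a)"
  proof (rule linear_bound_from_quadratic[where C = "C + D" and a = a and b = T])
    fix s t assume "a \<le> s" "s \<le> t" "t \<le> T"
    with C[of s t] D[of s t]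
    show "\<bar>(G t - H t) - (G s - H s)\<bar> \<le> 0 * (t - s) + (C + D) * (t - s)\<^sup>2"
      by (simp add: distrib_right)
  qed (use assms in auto)
  then show ?thesis by simp
qed

text \<open>The Lebesgue-Stieltjes measure of \<open>g\<close> gives \<open>{s<..t}\<close> the mass
  \<open>g t - g s\<close>, at most \<open>Lg * (t - s)\<close>, and on this interval
  \<open>f\<close> deviates from \<open>f s\<close> by at most \<open>Lf * (t - s)\<close>. The
  integral of \<open>f\<close> over \<open>{a<..t}\<close> is thus a primitive with constant
  \<open>Lf * Lg\<close>.\<close>

lemma rs_primitive_exists_mono:
  fixes f g :: "real \<Rightarrow> real"
  assumes "mono g" and f: "Lf-lipschitz_on UNIV f" and g: "Lg-lipschitz_on UNIV g"
  shows "\<exists>G. rs_primitive a T f g G"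
proof -
  define M where "M = interval_measure g"
  have contg: "continuous (at_right x) g" for x
    using lipschitz_on_continuous_on[OF g]
    by (simp add: continuous_on_eq_continuous_within continuous_at_imp_continuous_within)
  have emeas: "emeasure M {s<..t} = ennreal (g t - g s)" if "s \<le> t" for s t
    unfolding M_def using that \<open>mono g\<close> contg
    by (intro emeasure_interval_measure_Ioc) (auto dest: monoD)
  have meas: "measure M {s<..t} = g t - g s" if "s \<le> t" for s t
    using emeas[OF that] monoD[OF \<open>mono g\<close> that] by (simp add: measure_def)
  have sets: "sets M = sets borel" by (simp add: M_def)
  have contf: "continuous_on S f" for S
    using lipschitz_on_continuous_on[OF f] continuous_on_subset by blast
  have fmeas: "f \<in> borel_measurable M"
    using borel_measurable_continuous_onI[OF contf] measurable_cong_sets[OF sets refl] by blast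
  have Lfg: "0 \<le> Lf" "0 \<le> Lg" using lipschitz_on_nonneg[OF f] lipschitz_on_nonneg[OF g] by auto
  have int: "set_integrable M {s<..t} f" if "s \<le> t" for s t
  proof -
    have "bounded (f ` {s..t})" by (intro compact_imp_bounded compact_continuous_image contf) auto
    then obtain B where B: "\<forall>x\<in>{s..t}. \<bar>f x\<bar> \<le> B" by (auto simp: bounded_iff)
    show ?thesis unfolding set_integrable_def
    proof (rule integrableI_bounded_set_indicator[where B = B])
      show "AE x in M. x \<in> {s<..t} \<longrightarrow> norm (f x) \<le> B" using B by auto
    qed (use fmeas emeas[OF that] sets in auto)
  qed
  have "rs_primitive a T f g (\<lambda>t. LINT x:{a<..t}|M. f x)"
    unfolding rs_primitive_def
  proof (intro exI allI impI)
    fix s t assume st: "a \<le> s" "s \<le> t" "t \<le> T"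
    have "{a<..t} = {a<..s} \<union> {s<..t}" using st by auto
    then have "(LINT x:{a<..t}|M. f x) - (LINT x:{a<..s}|M. f x) = (LINT x:{s<..t}|M. f x)"
      using int st by (simp add: set_integral_Un)
    moreover have "f s * (g t - g s) = (LINT x:{s<..t}|M. f s)"
      using meas st emeas sets by (simp add: set_integral_const mult.commute)
    moreover have ints: "set_integrable M {s<..t} (\<lambda>_. f s)"
      using st emeas sets by (simp add: set_integrable_def)
    ultimately have eq: "(LINT x:{a<..t}|M. f x) - (LINT x:{a<..s}|M. f x) - f s * (g t - g s)
        = (LINT x:{s<..t}|M. f x - f s)"
      using int st by (simp add: set_integral_diff)
    have "\<bar>LINT x:{s<..t}|M. f x - f s\<bar> \<le> (LINT x:{s<..t}|M. Lf * (t - s))"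
    proof (rule order_trans[OF set_integral_norm_bound[of M "{s<..t}" "\<lambda>x. f x - f s", simplified real_norm_def]])
      show int': "set_integrable M {s<..t} (\<lambda>x. f x - f s)"
        using int ints st by (intro set_integral_diff)
      show "(LINT x:{s<..t}|M. \<bar>f x - f s\<bar>) \<le> (LINT x:{s<..t}|M. Lf * (t - s))"
      proof (rule set_integral_mono)
        show "set_integrable M {s<..t} (\<lambda>x. \<bar>f x - f s\<bar>)"
          using set_integrable_abs[OF int'] .
        show "set_integrable M {s<..t} (\<lambda>x. Lf * (t - s))"
          using st emeas sets by (simp add: set_integrable_def)
        fix x assume "x \<in> {s<..t}"
        then have "\<bar>f x - f s\<bar> \<le> Lf * (x - s)"
          using lipschitz_onD[OF f, of x s] by (simp add: dist_real_def)
        also have "\<dots> \<le> Lf * (t - s)" using Lfg \<open>x \<in> {s<..t}\<close> by (intro mult_left_mono) auto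
        finally show "\<bar>f x - f s\<bar> \<le> Lf * (t - s)" .
      qed
    qed
    also have "\<dots> = Lf * (t - s) * (g t - g s)"
      using meas st emeas sets by (simp add: set_integral_const mult.commute)
    also have "\<dots> \<le> Lf * (t - s) * (Lg * (t - s))"
      using lipschitz_onD[OF g, of t s] Lfg st by (intro mult_left_mono) (auto simp: dist_real_def)
    finally show "\<bar>(LINT x:{a<..t}|M. f x) - (LINT x:{a<..s}|M. f x) - f s * (g t - g s)\<bar>
        \<le> Lf * Lg * (t - s)\<^sup>2"
      unfolding eq by (simp add: power2_eq_square algebra_simps)
  qed
  then show ?thesis by blast
qed

text \<open>Interval measures need an integrator on the whole line. Composing with the nonexpansive
  projection onto \<open>[a,T]\<close> extends a function without enlarging its Lipschitz
  constant.\<close>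

lemma lipschitz_on_clamp:
  fixes f :: "real \<Rightarrow> real"
  assumes "L-lipschitz_on {a..T} f" "a \<le> T"
  shows "L-lipschitz_on UNIV (\<lambda>t. f (max a (min t T)))"
proof (rule lipschitz_onI)
  fix s t :: real
  have "dist (f (max a (min s T))) (f (max a (min t T))) \<le> L * dist (max a (min s T)) (max a (min t T))"
    using assms by (intro lipschitz_onD[OF assms(1)]) auto
  also have "\<dots> \<le> L * dist s t"
    using lipschitz_on_nonneg[OF assms(1)] by (intro mult_left_mono) (auto simp: dist_real_def)
  finally show "dist (f (max a (min s T))) (f (max a (min t T))) \<le> L * dist s t" .
qed (rule lipschitz_on_nonneg[OF assms(1)])

text \<open>Adding a linear function makes the Lipschitz integrator increasing, so that the integral is a
  difference of two integrals against interval measures.\<close>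

lemma rs_primitive_exists:
  assumes f: "Lf-lipschitz_on {a..T} f" and g: "Lg-lipschitz_on {a..T} g" and "a \<le> T"
  obtains G where "rs_primitive a T f g G"
proof -
  let ?c = "\<lambda>t. max a (min t T)"
  define f' where "f' = (\<lambda>t. f (?c t))"
  define g1 where "g1 = (\<lambda>t. g (?c t) + Lg * t)"
  define g2 where "g2 = (\<lambda>t :: real. Lg * t)"
  have Lg: "0 \<le> Lg" using lipschitz_on_nonneg[OF g] .
  have f': "Lf-lipschitz_on UNIV f'"
    unfolding f'_def by (rule lipschitz_on_clamp[OF f \<open>a \<le> T\<close>])
  have gc: "Lg-lipschitz_on UNIV (\<lambda>t. g (?c t))"
    by (rule lipschitz_on_clamp[OF g \<open>a \<le> T\<close>])
  have g2: "Lg-lipschitz_on UNIV g2"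
    unfolding g2_def using Lg by (intro lipschitz_onI) (auto simp: dist_real_def abs_mult simp flip: right_diff_distrib)
  have g1: "(Lg + Lg)-lipschitz_on UNIV g1"
    unfolding g1_def by (intro lipschitz_on_add gc) (use g2 in \<open>simp add: g2_def\<close>)
  have "mono g2" using Lg by (auto simp: g2_def mono_def intro: mult_left_mono)
  moreover have "mono g1"
  proof (rule monoI)
    fix s t :: real assume "s \<le> t"
    then show "g1 s \<le> g1 t"
      using lipschitz_onD[OF gc, of s t] by (simp add: g1_def dist_real_def algebra_simps abs_le_iff)
  qed
  ultimately obtain G1 G2 where "rs_primitive a T f' g1 G1" "rs_primitive a T f' g2 G2"
    using rs_primitive_exists_mono[OF _ f' g1] rs_primitive_exists_mono[OF _ f' g2] by meson
  then obtain C D where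
    C: "\<And>s t. a \<le> s \<Longrightarrow> s \<le> t \<Longrightarrow> t \<le> T \<Longrightarrow> \<bar>G1 t - G1 s - f' s * (g1 t - g1 s)\<bar> \<le> C * (t - s)\<^sup>2" and
    D: "\<And>s t. a \<le> s \<Longrightarrow> s \<le> t \<Longrightarrow> t \<le> T \<Longrightarrow> \<bar>G2 t - G2 s - f' s * (g2 t - g2 s)\<bar> \<le> D * (t - s)\<^sup>2"
    by (metis rs_primitiveE)
  have "rs_primitive a T f g (\<lambda>t. G1 t - G2 t)"
    unfolding rs_primitive_def
  proof (intro exI allI impI)
    fix s t assume st: "a \<le> s" "s \<le> t" "t \<le> T"
    then have "f' s = f s" "g1 t - g1 s - (g2 t - g2 s) = g t - g s"
      by (auto simp: f'_def g1_def g2_def max_def min_def)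
    then have "G1 t - G2 t - (G1 s - G2 s) - f s * (g t - g s)
      = (G1 t - G1 s - f' s * (g1 t - g1 s)) - (G2 t - G2 s - f' s * (g2 t - g2 s))"
      by (simp add: algebra_simps flip: \<open>g1 t - g1 s - (g2 t - g2 s) = g t - g s\<close>)
    then show "\<bar>G1 t - G2 t - (G1 s - G2 s) - f s * (g t - g s)\<bar> \<le> (C + D) * (t - s)\<^sup>2"
      using C[OF st] D[OF st] by (simp add: distrib_right)
  qed
  then show thesis by (rule that)
qed

text \<open>Any primitive \<open>G\<close> forces the integral, defined by \<open>THE\<close>, to be
  \<open>G t - G a\<close>. The indefinite integral thus satisfies the local estimate itself, and
  later estimates start from that instead of from Riemann sums.\<close>

lemma rs_integral_primitive:
  assumes f: "Lf-lipschitz_on {a..T} f" and g: "Lg-lipschitz_on {a..T} g"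
  shows "rs_primitive a T f g (\<lambda>t. rs_integral a t f g)" "a \<le> T \<Longrightarrow> rs_integral a a f g = 0"
proof -
  have *: "rs_primitive a T f g (\<lambda>t. rs_integral a t f g) \<and> rs_integral a a f g = 0" if aT: "a \<le> T"
  proof -
    obtain G where G: "rs_primitive a T f g G"
      using rs_primitive_exists[OF f g aT] by blast
    have eq: "rs_integral a t f g = G t - G a" if "a \<le> t" "t \<le> T" for t
      using has_rs_integral_primitive[OF G f g that] by (rule rs_integral_eq)
    from G obtain C where
      "\<And>s t. a \<le> s \<Longrightarrow> s \<le> t \<Longrightarrow> t \<le> T \<Longrightarrow> \<bar>G t - G s - f s * (g t - g s)\<bar> \<le> C * (t - s)\<^sup>2"
      using rs_primitiveE by metis
    then have "rs_primitive a T f g (\<lambda>t. rs_integral a t f g)"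
      unfolding rs_primitive_def by (intro exI[of _ C]) (auto simp: eq)
    with eq[of a] aT show ?thesis by simp
  qed
  then show "a \<le> T \<Longrightarrow> rs_integral a a f g = 0" by blast
  show "rs_primitive a T f g (\<lambda>t. rs_integral a t f g)"
    using * by (cases "a \<le> T") (auto simp: rs_primitive_def)
qed

text \<open>Tags and end points of a division of \<open>{s..t}\<close> lie in \<open>{s..t}\<close>.
  This later allows a restricted path to be replaced by the full one.\<close>

lemma rs_integral_cong:
  assumes "\<And>u. u \<in> {s..t} \<Longrightarrow> f u = f' u" "\<And>u. u \<in> {s..t} \<Longrightarrow> g u = g' u"
  shows "rs_integral s t f g = rs_integral s t f' g'"
proof -
  have "(\<Sum>(u, K)\<in>p. f u * (g (Sup K) - g (Inf K))) = (\<Sum>(u, K)\<in>p. f' u * (g' (Sup K) - g' (Inf K)))"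
    if p: "p tagged_division_of {s..t}" for p
  proof (rule sum.cong[OF refl], clarify)
    fix u K assume "(u, K) \<in> p"
    with p have u: "u \<in> K" "K \<subseteq> {s..t}" and "\<exists>c d. K = cbox c d"
      by (auto simp: tagged_division_of_def tagged_partial_division_of_def)
    then obtain c d where K: "K = {c..d}" by auto
    then have "Sup K \<in> {s..t}" "Inf K \<in> {s..t}" "u \<in> {s..t}" using u by auto
    then show "f u * (g (Sup K) - g (Inf K)) = f' u * (g' (Sup K) - g' (Inf K))"
      using assms by simp
  qed
  then have "has_rs_integral f g s t = has_rs_integral f' g' s t"
    unfolding has_rs_integral_def by (intro ext) (simp cong: conj_cong imp_cong)
  then show ?thesis by (simp add: rs_integral_def)
qed

lemma rs_primitive_cong:
  assumes "rs_primitive a T f g G" "\<And>s. s \<in> {a..T} \<Longrightarrow> f s = f' s"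
  shows "rs_primitive a T f' g G"
  using assms(1) unfolding rs_primitive_def by (auto simp: assms(2))

text \<open>A list, not a finite set, because shuffles are counted with multiplicity.\<close>

lemma rs_primitive_sum_list:
  assumes "\<And>w. w \<in> set ws \<Longrightarrow> rs_primitive a T (f w) g (G w)"
  shows "rs_primitive a T (\<lambda>s. \<Sum>w\<leftarrow>ws. f w s) g (\<lambda>t. \<Sum>w\<leftarrow>ws. G w t)"
  using assms
proof (induction ws)
  case Nil
  show ?case by (auto simp: rs_primitive_def intro: exI[of _ 0])
next
  case (Cons w ws)
  obtain C where C: "\<And>s t. a \<le> s \<Longrightarrow> s \<le> t \<Longrightarrow> t \<le> T \<Longrightarrow>
      \<bar>G w t - G w s - f w s * (g t - g s)\<bar> \<le> C * (t - s)\<^sup>2"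
    using Cons.prems[of w] unfolding rs_primitive_def by auto
  obtain D where D: "\<And>s t. a \<le> s \<Longrightarrow> s \<le> t \<Longrightarrow> t \<le> T \<Longrightarrow>
      \<bar>(\<Sum>w\<leftarrow>ws. G w t) - (\<Sum>w\<leftarrow>ws. G w s) - (\<Sum>w\<leftarrow>ws. f w s) * (g t - g s)\<bar> \<le> D * (t - s)\<^sup>2"
  proof -
    have "rs_primitive a T (\<lambda>s. \<Sum>w\<leftarrow>ws. f w s) g (\<lambda>t. \<Sum>w\<leftarrow>ws. G w t)"
      using Cons by simp
    then show thesis using that unfolding rs_primitive_def by metis
  qed
  show ?case unfolding rs_primitive_def
  proof (intro exI allI impI)
    fix s t assume st: "a \<le> s" "s \<le> t" "t \<le> T"
    show "\<bar>(\<Sum>w\<leftarrow>w # ws. G w t) - (\<Sum>w\<leftarrow>w # ws. G w s) - (\<Sum>w\<leftarrow>w # ws. f w s) * (g t - g s)\<bar>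
        \<le> (C + D) * (t - s)\<^sup>2"
      using C[OF st] D[OF st] by (simp add: distrib_right abs_le_iff)
  qed
qed

text \<open>Integration by parts: an increment of \<open>G * H\<close> is
  \<open>G s * dH + H s * dG + dG * dH\<close>, and the last product is quadratic because both
  factors are Lipschitz. Hence \<open>G * H - P - Q\<close> has quadratic increments and is
  constant.\<close>

lemma rs_primitive_mult:
  assumes G: "rs_primitive a T A g G" and H: "rs_primitive a T B h H"
    and P: "rs_primitive a T (\<lambda>s. A s * H s) g P" and Q: "rs_primitive a T (\<lambda>s. G s * B s) h Q"
    and lipG: "LG-lipschitz_on {a..T} G" and lipH: "LH-lipschitz_on {a..T} H"
    and t: "a \<le> t" "t \<le> T"
  shows "G t * H t - G a * H a = (P t - P a) + (Q t - Q a)"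
proof -
  obtain C1 where C1: "\<And>s t. a \<le> s \<Longrightarrow> s \<le> t \<Longrightarrow> t \<le> T \<Longrightarrow>
      \<bar>G t - G s - A s * (g t - g s)\<bar> \<le> C1 * (t - s)\<^sup>2"
    using G unfolding rs_primitive_def by auto
  obtain C2 where C2: "\<And>s t. a \<le> s \<Longrightarrow> s \<le> t \<Longrightarrow> t \<le> T \<Longrightarrow>
      \<bar>H t - H s - B s * (h t - h s)\<bar> \<le> C2 * (t - s)\<^sup>2"
    using H unfolding rs_primitive_def by auto
  obtain C3 where C3: "\<And>s t. a \<le> s \<Longrightarrow> s \<le> t \<Longrightarrow> t \<le> T \<Longrightarrow>
      \<bar>P t - P s - A s * H s * (g t - g s)\<bar> \<le> C3 * (t - s)\<^sup>2"
    using P unfolding rs_primitive_def by auto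
  obtain C4 where C4: "\<And>s t. a \<le> s \<Longrightarrow> s \<le> t \<Longrightarrow> t \<le> T \<Longrightarrow>
      \<bar>Q t - Q s - G s * B s * (h t - h s)\<bar> \<le> C4 * (t - s)\<^sup>2"
    using Q unfolding rs_primitive_def by auto
  obtain MG where MG: "0 \<le> MG" "\<And>t. a \<le> t \<Longrightarrow> t \<le> T \<Longrightarrow> \<bar>G t\<bar> \<le> MG"
    using lipschitz_on_real_bounded[OF lipG] by metis
  obtain MH where MH: "0 \<le> MH" "\<And>t. a \<le> t \<Longrightarrow> t \<le> T \<Longrightarrow> \<bar>H t\<bar> \<le> MH"
    using lipschitz_on_real_bounded[OF lipH] by metis
  have L: "0 \<le> LG" "0 \<le> LH" using lipschitz_on_nonneg[OF lipG] lipschitz_on_nonneg[OF lipH] by auto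
  let ?\<psi> = "\<lambda>t. G t * H t - P t - Q t"
  have "\<bar>?\<psi> t - ?\<psi> a\<bar> \<le> 0 * (t - a)"
  proof (rule linear_bound_from_quadratic[where C = "MG * C2 + MH * C1 + LG * LH + C3 + C4" and a = a and b = T])
    fix s t assume st: "a \<le> s" "s \<le> t" "t \<le> T"
    have 1: "\<bar>G s * (H t - H s - B s * (h t - h s))\<bar> \<le> MG * (C2 * (t - s)\<^sup>2)"
      unfolding abs_mult using MG C2[OF st] st by (intro mult_mono) auto
    have 2: "\<bar>H s * (G t - G s - A s * (g t - g s))\<bar> \<le> MH * (C1 * (t - s)\<^sup>2)"
      unfolding abs_mult using MH C1[OF st] st by (intro mult_mono) auto
    have 3: "\<bar>(G t - G s) * (H t - H s)\<bar> \<le> (LG * (t - s)) * (LH * (t - s))"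
      unfolding abs_mult
      using lipschitz_on_realD[OF lipG st] lipschitz_on_realD[OF lipH st] L st
      by (intro mult_mono) auto
    have "?\<psi> t - ?\<psi> s = G s * (H t - H s - B s * (h t - h s)) + H s * (G t - G s - A s * (g t - g s))
        + (G t - G s) * (H t - H s)
        - (P t - P s - A s * H s * (g t - g s)) - (Q t - Q s - G s * B s * (h t - h s))"
      by (simp add: algebra_simps)
    then have "\<bar>?\<psi> t - ?\<psi> s\<bar> \<le> MG * (C2 * (t - s)\<^sup>2) + MH * (C1 * (t - s)\<^sup>2)
        + (LG * (t - s)) * (LH * (t - s)) + C3 * (t - s)\<^sup>2 + C4 * (t - s)\<^sup>2"
      using 1 2 3 C3[OF st] C4[OF st] by linarith
    also have "\<dots> = 0 * (t - s) + (MG * C2 + MH * C1 + LG * LH + C3 + C4) * (t - s)\<^sup>2"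
      by (simp add: algebra_simps power2_eq_square)
    finally show "\<bar>?\<psi> t - ?\<psi> s\<bar> \<le> 0 * (t - s) + (MG * C2 + MH * C1 + LG * LH + C3 + C4) * (t - s)\<^sup>2" .
  qed (use t in auto)
  then show ?thesis by simp
qed

section \<open>Signatures of Lipschitz paths\<close>

text \<open>Each coordinate has its own constant, so that the notion also covers the tensor-valued
  path \<open>\<Phi>(\<mu>)\<close>, whose coordinates are controlled one at a time.\<close>

definition lipschitz_coords :: "('l \<Rightarrow> 'v::real_inner) \<Rightarrow> real \<Rightarrow> real \<Rightarrow> (real \<Rightarrow> 'v) \<Rightarrow> bool" where
  "lipschitz_coords b a T x \<longleftrightarrow> (\<forall>i. \<exists>L. L-lipschitz_on {a..T} (\<lambda>r. inner (x r) (b i)))"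

lemma sig_coord_lipschitz:
  assumes "lipschitz_coords b a T x"
  obtains L where "L-lipschitz_on {a..T} (\<lambda>u. sig_coord b a u x w)"
proof -
  have "\<exists>L. L-lipschitz_on {a..T} (\<lambda>u. sig_coord b a u x w)"
  proof (induction w rule: rev_induct)
    case Nil
    show ?case by (auto intro!: exI[of _ 0] lipschitz_onI)
  next
    case (snoc i w)
    then obtain L where L: "L-lipschitz_on {a..T} (\<lambda>u. sig_coord b a u x w)" by blast
    obtain K where K: "K-lipschitz_on {a..T} (\<lambda>r. inner (x r) (b i))"
      using assms by (auto simp: lipschitz_coords_def)
    show ?case
      unfolding sig_coord_snoc
      using rs_primitive_lipschitz[OF rs_integral_primitive(1)[OF L K] L K] by blast
  qed
  then show thesis using that by blast
qed

lemma sig_coord_primitive: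
  assumes "lipschitz_coords b a T x"
  shows "rs_primitive a T (\<lambda>u. sig_coord b a u x w) (\<lambda>r. inner (x r) (b i))
           (\<lambda>u. sig_coord b a u x (w @ [i]))"
proof -
  obtain L where L: "L-lipschitz_on {a..T} (\<lambda>u. sig_coord b a u x w)"
    using sig_coord_lipschitz[OF assms] by blast
  obtain K where K: "K-lipschitz_on {a..T} (\<lambda>r. inner (x r) (b i))"
    using assms by (auto simp: lipschitz_coords_def)
  show ?thesis unfolding sig_coord_snoc by (rule rs_integral_primitive(1)[OF L K])
qed

lemma sig_coord_initial:
  assumes "lipschitz_coords b a T x" "a \<le> T"
  shows "sig_coord b a a x w = (if w = [] then 1 else 0)"
proof (cases w rule: rev_exhaust)
  case (snoc v i)
  obtain L where L: "L-lipschitz_on {a..T} (\<lambda>u. sig_coord b a u x v)"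
    using sig_coord_lipschitz[OF assms(1)] by blast
  obtain K where K: "K-lipschitz_on {a..T} (\<lambda>r. inner (x r) (b i))"
    using assms(1) by (auto simp: lipschitz_coords_def)
  show ?thesis using rs_integral_primitive(2)[OF L K assms(2)] by (simp add: snoc sig_coord_snoc)
qed simp

text \<open>The coordinate of the path is itself a primitive of the constant 1, with error 0. For
  the path \<open>\<Phi>(\<mu>)\<close> this turns moments into coordinates of the outer
  signature.\<close>

lemma sig_coord_singleton:
  assumes "lipschitz_coords b a T x" "a \<le> t" "t \<le> T"
  shows "sig_coord b a t x [i] = inner (x t) (b i) - inner (x a) (b i)"
proof -
  let ?g = "\<lambda>r. inner (x r) (b i)"
  have "rs_primitive a T (\<lambda>u. 1) ?g (\<lambda>u. sig_coord b a u x [i])"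
    using sig_coord_primitive[OF assms(1), of "[]" i] by simp
  moreover have "rs_primitive a T (\<lambda>u. 1) ?g ?g"
    by (auto simp: rs_primitive_def intro: exI[of _ 0])
  ultimately have "sig_coord b a t x [i] - sig_coord b a a x [i] = ?g t - ?g a"
    using assms(2,3) by (rule rs_primitive_unique)
  then show ?thesis using sig_coord_initial[OF assms(1)] assms(2,3) by simp
qed

lemma sig_coord_cong:
  assumes "\<And>u. u \<in> {a..t} \<Longrightarrow> x u = y u" "r \<le> t"
  shows "sig_coord b a r x w = sig_coord b a r y w"
  using assms(2)
proof (induction w arbitrary: r rule: rev_induct)
  case (snoc i w)
  then show ?case
    unfolding sig_coord_snoc using assms(1) by (intro rs_integral_cong) auto
qed simp

text \<open>The list \<open>us\<close> enumerates the shuffles of \<open>v\<close> and \<open>w\<close> with multiplicity.  What matters is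
  that it depends neither on the path nor on the time.\<close>

lemma sig_coord_shuffle:
  fixes b :: "'l \<Rightarrow> 'v::real_inner"
  obtains us where "\<And>x t. lipschitz_coords b a T x \<Longrightarrow> a \<le> t \<Longrightarrow> t \<le> T \<Longrightarrow>
    sig_coord b a t x v * sig_coord b a t x w = (\<Sum>u\<leftarrow>us. sig_coord b a t x u)"
proof -
  have "\<exists>us. \<forall>x t. lipschitz_coords b a T x \<longrightarrow> a \<le> t \<longrightarrow> t \<le> T \<longrightarrow>
    sig_coord b a t x v * sig_coord b a t x w = (\<Sum>u\<leftarrow>us. sig_coord b a t x u)"
  proof (induction "length v + length w" arbitrary: v w rule: less_induct)
    case less
    show ?case
    proof (cases "v = [] \<or> w = []")
      case True
      then show ?thesis
        by (auto intro!: exI[of _ "[v @ w]"])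
    next
      case False
      then obtain v' i w' j where vw: "v = v' @ [i]" "w = w' @ [j]"
        by (meson rev_exhaust)
      obtain us1 where us1: "\<And>x t. lipschitz_coords b a T x \<Longrightarrow> a \<le> t \<Longrightarrow> t \<le> T \<Longrightarrow>
          sig_coord b a t x v' * sig_coord b a t x w = (\<Sum>u\<leftarrow>us1. sig_coord b a t x u)"
        using less[of v' w] by (auto simp: vw)
      obtain us2 where us2: "\<And>x t. lipschitz_coords b a T x \<Longrightarrow> a \<le> t \<Longrightarrow> t \<le> T \<Longrightarrow>
          sig_coord b a t x v * sig_coord b a t x w' = (\<Sum>u\<leftarrow>us2. sig_coord b a t x u)"
        using less[of v w'] by (auto simp: vw)
      \<comment> \<open>A shuffle of \<open>v\<close> and \<open>w\<close> ends either in
        \<open>i\<close>, after a shuffle of \<open>v'\<close> and \<open>w\<close>, or in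
        \<open>j\<close>, after a shuffle of \<open>v\<close> and \<open>w'\<close>. The two cases
        are the two terms of the product rule.\<close>
      have "sig_coord b a t x v * sig_coord b a t x w
          = (\<Sum>u\<leftarrow>map (\<lambda>u. u @ [i]) us1 @ map (\<lambda>u. u @ [j]) us2. sig_coord b a t x u)"
        if x: "lipschitz_coords b a T x" and t: "a \<le> t" "t \<le> T" for x t
      proof -
        define P where "P = (\<lambda>t. \<Sum>u\<leftarrow>us1. sig_coord b a t x (u @ [i]))"
        define Q where "Q = (\<lambda>t. \<Sum>u\<leftarrow>us2. sig_coord b a t x (u @ [j]))"
        have P: "rs_primitive a T (\<lambda>s. sig_coord b a s x v' * sig_coord b a s x w) (\<lambda>r. inner (x r) (b i)) P"
          unfolding P_def
          by (rule rs_primitive_cong[OF rs_primitive_sum_list[OF sig_coord_primitive[OF x]]])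
             (use us1 x in auto)
        have Q: "rs_primitive a T (\<lambda>s. sig_coord b a s x v * sig_coord b a s x w') (\<lambda>r. inner (x r) (b j)) Q"
          unfolding Q_def
          by (rule rs_primitive_cong[OF rs_primitive_sum_list[OF sig_coord_primitive[OF x]]])
             (use us2 x in auto)
        obtain LG where LG: "LG-lipschitz_on {a..T} (\<lambda>u. sig_coord b a u x v)"
          using sig_coord_lipschitz[OF x] by blast
        obtain LH where LH: "LH-lipschitz_on {a..T} (\<lambda>u. sig_coord b a u x w)"
          using sig_coord_lipschitz[OF x] by blast
        have "sig_coord b a t x v * sig_coord b a t x w - sig_coord b a a x v * sig_coord b a a x w
            = (P t - P a) + (Q t - Q a)"
          using sig_coord_primitive[OF x] P Q LG LH t unfolding vw
          by (intro rs_primitive_mult) auto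
        moreover have "P a = 0" "Q a = 0" "sig_coord b a a x v = 0"
          using sig_coord_initial[OF x] t by (simp_all add: P_def Q_def vw sum_list_0)
        ultimately show ?thesis by (simp add: P_def Q_def comp_def)
      qed
      then show ?thesis by blast
    qed
  qed
  then show thesis using that by blast
qed

section \<open>Factorial decay and square summability of the signature\<close>

lemma Bessel_inequality:
  assumes "orthonormal_basis e" "finite I"
  shows "(\<Sum>i\<in>I. (inner v (e i))\<^sup>2) \<le> (norm v)\<^sup>2"
proof -
  let ?p = "\<Sum>i\<in>I. inner v (e i) *\<^sub>R e i"
  have orth: "inner (e i) (e j) = (if i = j then 1 else 0)" for i j
    using assms(1) by (simp add: orthonormal_basis_def)
  have "inner v ?p = (\<Sum>i\<in>I. (inner v (e i))\<^sup>2)"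
    by (simp add: inner_sum_right power2_eq_square)
  moreover have "inner ?p ?p = (\<Sum>i\<in>I. (inner v (e i))\<^sup>2)"
    using assms(2)
    by (simp add: inner_sum_right inner_sum_left orth power2_eq_square if_distrib sum.delta cong: if_cong)
  ultimately have "(norm (v - ?p))\<^sup>2 = (norm v)\<^sup>2 - (\<Sum>i\<in>I. (inner v (e i))\<^sup>2)"
    by (simp add: power2_norm_eq_inner inner_diff inner_commute)
  then show ?thesis using zero_le_power2[of "norm (v - ?p)"] by linarith
qed

lemma lipschitz_coords_orthonormal:
  assumes "orthonormal_basis e" "L-lipschitz_on {a..T} x"
  shows "lipschitz_coords e a T x"
  unfolding lipschitz_coords_def
proof (intro allI exI)
  fix i
  have ei: "norm (e i) = 1" using assms(1) by (simp add: orthonormal_basis_def norm_eq_sqrt_inner)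
  show "L-lipschitz_on {a..T} (\<lambda>r. inner (x r) (e i))"
  proof (rule lipschitz_on_realI[OF lipschitz_on_nonneg[OF assms(2)]])
    fix s t assume "a \<le> s" "s \<le> t" "t \<le> T"
    then have "norm (x t - x s) \<le> L * (t - s)" by (rule lipschitz_on_realD[OF assms(2)])
    moreover have "\<bar>inner (x t - x s) (e i)\<bar> \<le> norm (x t - x s)"
      using Cauchy_Schwarz_ineq2[of "x t - x s" "e i"] ei by simp
    ultimately show "norm (inner (x t) (e i) - inner (x s) (e i)) \<le> L * (t - s)"
      by (simp add: inner_diff_left)
  qed
qed

text \<open>A nonempty word is determined by its \<open>butlast\<close> and its \<open>last\<close>.
  The sum over \<open>W\<close> is therefore part of the sum over the product of the two images of
  \<open>W\<close>, which factorises.\<close>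

lemma L2_set_snoc_le:
  assumes "finite W" "[] \<notin> W"
  shows "L2_set (\<lambda>w. f (butlast w) * g (last w)) W \<le> L2_set f (butlast ` W) * L2_set g (last ` W)"
proof -
  let ?h = "\<lambda>w. (butlast w, last w)"
  have inj: "inj_on ?h W"
  proof (rule inj_onI)
    fix v w assume "v \<in> W" "w \<in> W" "?h v = ?h w"
    then show "v = w" using assms(2) by (metis Pair_inject append_butlast_last_id)
  qed
  have "(\<Sum>w\<in>W. (f (butlast w) * g (last w))\<^sup>2) = (\<Sum>(v, i)\<in>?h ` W. (f v * g i)\<^sup>2)"
    by (subst sum.reindex[OF inj]) simp
  also have "\<dots> \<le> (\<Sum>(v, i)\<in>butlast ` W \<times> last ` W. (f v * g i)\<^sup>2)"
    using assms(1) by (intro sum_mono2) auto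
  also have "\<dots> = (\<Sum>v\<in>butlast ` W. (f v)\<^sup>2) * (\<Sum>i\<in>last ` W. (g i)\<^sup>2)"
    by (simp add: sum_product sum.cartesian_product power_mult_distrib)
  finally show ?thesis
    unfolding L2_set_def by (simp flip: real_sqrt_mult)
qed

text \<open>In the factorisation of \<open>y ^ Suc k - x ^ Suc k\<close> by \<open>y - x\<close>,
  each of the \<open>k + 1\<close> terms of the cofactor is at least \<open>x ^ k\<close>. This
  tangent-line bound lets the majorant in the next lemma absorb one more integration.\<close>

lemma power_Suc_diff_ge:
  fixes x y :: real
  assumes "0 \<le> x" "x \<le> y"
  shows "real (Suc k) * x ^ k * (y - x) \<le> y ^ Suc k - x ^ Suc k"
proof -
  have "real (Suc k) * x ^ k = (\<Sum>i<Suc k. x ^ i * x ^ (k - i))"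
    by (simp flip: power_add)
  also have "\<dots> \<le> (\<Sum>i<Suc k. x ^ i * y ^ (k - i))"
    using assms by (intro sum_mono mult_left_mono power_mono) auto
  finally have "(y - x) * (real (Suc k) * x ^ k) \<le> (y - x) * (\<Sum>i<Suc k. x ^ i * y ^ (k - i))"
    using assms by (intro mult_left_mono) auto
  also have "\<dots> = y ^ Suc k - x ^ Suc k"
    unfolding power_diff_sumr2[of y "Suc k" x]
    by (simp add: sum.nat_diff_reindex[symmetric, of "\<lambda>i. x ^ i * y ^ (k - i)"] mult.commute
        del: sum.lessThan_Suc cong: sum.cong_simp)
  finally show ?thesis by (simp add: mult_ac)
qed

text \<open>Bounds on single coordinates cannot be summed over an infinite alphabet, so the
  induction on the level runs with the Euclidean norm over a finite set \<open>W\<close> of words.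
  Up to quadratic errors, each increment of that norm is at most the increment of the majorant
  \<open>?B\<close>, and the errors vanish by telescoping.\<close>

lemma sig_coord_L2_bound:
  assumes e: "orthonormal_basis e" and x: "L-lipschitz_on {a..T} x"
    and "finite W" "W \<subseteq> {w. length w = k}" "a \<le> t" "t \<le> T"
  shows "L2_set (sig_coord e a t x) W \<le> (L * (t - a)) ^ k / fact k"
  using assms(3-)
proof (induction k arbitrary: W t)
  case 0
  have "L2_set (sig_coord e a t x) W \<le> L2_set (sig_coord e a t x) {[]}"
    unfolding L2_set_def using 0 by (intro real_sqrt_le_mono sum_mono2) auto
  then show ?case by simp
next
  case (Suc k)
  have lip: "lipschitz_coords e a T x" by (rule lipschitz_coords_orthonormal[OF e x])
  have L: "0 \<le> L" using lipschitz_on_nonneg[OF x] .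
  have ne: "w \<noteq> []" if "w \<in> W" for w using Suc.prems that by auto
  have "\<exists>C. \<forall>s t. a \<le> s \<longrightarrow> s \<le> t \<longrightarrow> t \<le> T \<longrightarrow>
      \<bar>sig_coord e a t x w - sig_coord e a s x w
        - sig_coord e a s x (butlast w) * (inner (x t) (e (last w)) - inner (x s) (e (last w)))\<bar>
      \<le> C * (t - s)\<^sup>2" if "w \<in> W" for w
    using sig_coord_primitive[OF lip, of "butlast w" "last w"] ne[OF that]
    unfolding rs_primitive_def by simp
  then obtain C where C: "\<And>w s t. w \<in> W \<Longrightarrow> a \<le> s \<Longrightarrow> s \<le> t \<Longrightarrow> t \<le> T \<Longrightarrow>
      \<bar>sig_coord e a t x w - sig_coord e a s x w
        - sig_coord e a s x (butlast w) * (inner (x t) (e (last w)) - inner (x s) (e (last w)))\<bar>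
      \<le> C w * (t - s)\<^sup>2"
    by metis
  let ?\<phi> = "\<lambda>t. L2_set (sig_coord e a t x) W"
  let ?B = "\<lambda>t. (L * (t - a)) ^ Suc k / fact (Suc k)"
  have "?\<phi> t - ?B t \<le> ?\<phi> a - ?B a"
  \<comment> \<open>Each word has its own error constant; as \<open>W\<close> is finite, their sum
    is one constant for the whole norm.\<close>
  proof (rule telescope_quadratic_le[where \<psi> = "\<lambda>t. ?\<phi> t - ?B t" and C = "\<Sum>w\<in>W. C w"])
    show "a \<le> t" by fact
    fix s t' assume st: "a \<le> s" "s \<le> t'" "t' \<le> t"
    then have t': "t' \<le> T" using Suc.prems by simp
    let ?dx = "\<lambda>i. inner (x t') (e i) - inner (x s) (e i)"
    let ?main = "\<lambda>w. sig_coord e a s x (butlast w) * ?dx (last w)"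
    let ?err = "\<lambda>w. sig_coord e a t' x w - sig_coord e a s x w - ?main w"
    \<comment> \<open>Bessel controls the increments of all integrators together by the norm of the
      increment of the path.\<close>
    have "L2_set ?dx (last ` W) = sqrt (\<Sum>i\<in>last ` W. (inner (x t' - x s) (e i))\<^sup>2)"
      by (simp add: L2_set_def inner_diff_left)
    also have "\<dots> \<le> norm (x t' - x s)"
      using Bessel_inequality[OF e, of "last ` W"] Suc.prems by (intro real_le_lsqrt) auto
    also have "\<dots> \<le> L * (t' - s)" by (rule lipschitz_on_realD[OF x]) (use st t' in auto)
    finally have dx: "L2_set ?dx (last ` W) \<le> L * (t' - s)" .
    have "L2_set ?main W \<le> L2_set (sig_coord e a s x) (butlast ` W) * L2_set ?dx (last ` W)"
      using Suc.prems ne by (intro L2_set_snoc_le) auto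
    also have "\<dots> \<le> (L * (s - a)) ^ k / fact k * (L * (t' - s))"
    proof (intro mult_mono dx Suc.IH)
      show "0 \<le> (L * (s - a)) ^ k / fact k" using L st by simp
    qed (use Suc.prems st t' in auto)
    also have "\<dots> = real (Suc k) * (L * (s - a)) ^ k * (L * (t' - a) - L * (s - a)) / fact (Suc k)"
    proof -
      have "L * (t' - a) - L * (s - a) = L * (t' - s)" by (simp add: algebra_simps)
      then show ?thesis by (simp add: mult.assoc del: of_nat_Suc)
    qed
    also have "\<dots> \<le> ((L * (t' - a)) ^ Suc k - (L * (s - a)) ^ Suc k) / fact (Suc k)"
      using L st by (intro divide_right_mono power_Suc_diff_ge mult_left_mono) auto
    also have "\<dots> = ?B t' - ?B s" by (simp only: diff_divide_distrib)
    finally have main: "L2_set ?main W \<le> ?B t' - ?B s" .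
    have err: "L2_set ?err W \<le> (\<Sum>w\<in>W. C w) * (t' - s)\<^sup>2"
      unfolding sum_distrib_right using C st t'
      by (intro order_trans[OF L2_set_le_sum_abs] sum_mono) auto
    have "?\<phi> t' = L2_set (\<lambda>w. sig_coord e a s x w + (?main w + ?err w)) W"
      by (rule L2_set_cong) auto
    also have "\<dots> \<le> ?\<phi> s + (L2_set ?main W + L2_set ?err W)"
      by (intro order_trans[OF L2_set_triangle_ineq] add_mono L2_set_triangle_ineq order_refl)
    finally show "?\<phi> t' - ?B t' - (?\<phi> s - ?B s) \<le> (\<Sum>w\<in>W. C w) * (t' - s)\<^sup>2"
      using main err by linarith
  qed
  moreover have "?\<phi> a = 0"
    using sig_coord_initial[OF lip] Suc.prems ne by (intro L2_set_0') auto
  ultimately show ?case by simp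
qed

lemma sig_coord_bound:
  assumes "orthonormal_basis e" "L-lipschitz_on {a..T} x" "a \<le> t" "t \<le> T"
  shows "\<bar>sig_coord e a t x w\<bar> \<le> (L * (T - a)) ^ length w / fact (length w)"
proof -
  have "\<bar>sig_coord e a t x w\<bar> \<le> (L * (t - a)) ^ length w / fact (length w)"
    using sig_coord_L2_bound[OF assms(1,2) _ _ assms(3,4), of "{w}" "length w"] by simp
  also have "\<dots> \<le> (L * (T - a)) ^ length w / fact (length w)"
    using assms lipschitz_on_nonneg[OF assms(2)]
    by (intro divide_right_mono power_mono mult_left_mono mult_nonneg_nonneg) auto
  finally show ?thesis .
qed

text \<open>With \<open>r = L * (T - a)\<close>, the words of length \<open>k\<close> contribute at
  most \<open>r ^ (2 * k) / (fact k)^2\<close>. Giving away one factorial leaves a partial sum of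
  the exponential series of \<open>r^2\<close>. The bound depends on the path only through
  \<open>L\<close>, so it passes to expectations.\<close>

lemma sig_coord_square_sum_bound:
  assumes e: "orthonormal_basis e" and x: "L-lipschitz_on {a..T} x"
    and W: "finite W" and t: "a \<le> t" "t \<le> T"
  shows "(\<Sum>w\<in>W. (sig_coord e a t x w)\<^sup>2) \<le> exp ((L * (T - a))\<^sup>2)"
proof -
  let ?r = "L * (T - a)"
  have L: "0 \<le> L" using lipschitz_on_nonneg[OF x] .
  obtain n where n: "length ` W \<subseteq> {..<n}"
    using finite_imageI[OF W, of length] by (metis finite_nat_iff_bounded)
  have "(\<Sum>w\<in>W. (sig_coord e a t x w)\<^sup>2)
      = (\<Sum>k<n. \<Sum>w\<in>{w \<in> W. length w = k}. (sig_coord e a t x w)\<^sup>2)"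
    using W n by (intro sum.group[symmetric]) auto
  also have "\<dots> \<le> (\<Sum>k<n. (?r\<^sup>2) ^ k /\<^sub>R fact k)"
  proof (rule sum_mono)
    fix k
    have "(\<Sum>w\<in>{w \<in> W. length w = k}. (sig_coord e a t x w)\<^sup>2)
        = (L2_set (sig_coord e a t x) {w \<in> W. length w = k})\<^sup>2"
      by (simp add: L2_set_def sum_nonneg)
    also have "\<dots> \<le> ((L * (t - a)) ^ k / fact k)\<^sup>2"
      using W t by (intro power_mono sig_coord_L2_bound[OF e x]) auto
    also have "\<dots> \<le> (?r ^ k / fact k)\<^sup>2"
      using t L by (intro power_mono divide_right_mono mult_left_mono) auto
    also have "\<dots> = (?r\<^sup>2) ^ k / (fact k * fact k)"
      by (simp add: power_divide power2_eq_square power_mult_distrib)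
    also have "\<dots> \<le> (?r\<^sup>2) ^ k / fact k"
      by (intro divide_left_mono) (auto simp: mult_le_cancel_left1)
    finally show "(\<Sum>w\<in>{w \<in> W. length w = k}. (sig_coord e a t x w)\<^sup>2) \<le> (?r\<^sup>2) ^ k /\<^sub>R fact k"
      by (simp add: divide_inverse mult.commute)
  qed
  also have "\<dots> \<le> exp (?r\<^sup>2)"
    unfolding exp_def by (intro sum_le_suminf summable_exp_generic) auto
  finally show ?thesis .
qed

text \<open>\<open>Abs_ell2\<close> keeps the given coordinates only if they are square-summable,
  which the preceding bound supplies.\<close>

lemma ell2_nth_signature:
  assumes "orthonormal_basis e" "L-lipschitz_on {a..T} x" "a \<le> t" "t \<le> T"
  shows "ell2_nth (signature e a t x) w = sig_coord e a t x w"
proof -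
  have "(\<lambda>w. (sig_coord e a t x w)\<^sup>2) summable_on UNIV"
    using sig_coord_square_sum_bound[OF assms(1,2) _ assms(3,4)]
    by (intro nonneg_bdd_above_summable_on bdd_aboveI2[where M = "exp ((L * (T - a))\<^sup>2)"]) auto
  then show ?thesis by (simp add: signature_def Abs_ell2_inverse)
qed

section \<open>Dependence of the coordinates on time and on the path\<close>

text \<open>To survive averaging over \<open>\<mu>\<close> the constant may depend on the path only
  through \<open>L\<close>. The factorial bound \<open>M\<close> on the integrand is of this kind,
  and so is \<open>M * L\<close>.\<close>

lemma sig_coord_lipschitz_uniform:
  fixes e :: "'i \<Rightarrow> 'v::real_inner"
  assumes e: "orthonormal_basis e" and "0 \<le> L" "a \<le> T"
  obtains K where "\<And>x :: real \<Rightarrow> 'v. L-lipschitz_on {a..T} x \<Longrightarrow> K-lipschitz_on {a..T} (\<lambda>t. sig_coord e a t x w)"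
proof (cases w rule: rev_exhaust)
  case Nil
  then show thesis by (intro that[of 0]) (auto intro: lipschitz_onI)
next
  case (snoc v i)
  define M where "M = (L * (T - a)) ^ length v / fact (length v)"
  have M: "0 \<le> M" using assms by (simp add: M_def)
  have ei: "norm (e i) = 1" using e by (simp add: orthonormal_basis_def norm_eq_sqrt_inner)
  show thesis
  proof (rule that[of "M * L"], rule lipschitz_on_realI)
    fix x :: "real \<Rightarrow> 'v" and s t assume x: "L-lipschitz_on {a..T} x" and st: "a \<le> s" "s \<le> t" "t \<le> T"
    obtain C where C: "\<And>s t. a \<le> s \<Longrightarrow> s \<le> t \<Longrightarrow> t \<le> T \<Longrightarrow>
        \<bar>sig_coord e a t x w - sig_coord e a s x w
          - sig_coord e a s x v * (inner (x t) (e i) - inner (x s) (e i))\<bar> \<le> C * (t - s)\<^sup>2"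
      using sig_coord_primitive[OF lipschitz_coords_orthonormal[OF e x], of v i]
      unfolding rs_primitive_def snoc by metis
    have "\<bar>sig_coord e a t x w - sig_coord e a s x w\<bar> \<le> M * L * (t - s)"
    proof (rule linear_bound_from_quadratic[OF st])
      fix s t assume st: "a \<le> s" "s \<le> t" "t \<le> T"
      have "\<bar>inner (x t) (e i) - inner (x s) (e i)\<bar> \<le> L * (t - s)"
        using Cauchy_Schwarz_ineq2[of "x t - x s" "e i"] lipschitz_on_realD[OF x st] ei
        by (simp add: inner_diff_left)
      then have "\<bar>sig_coord e a s x v * (inner (x t) (e i) - inner (x s) (e i))\<bar> \<le> M * (L * (t - s))"
        unfolding abs_mult M_def using sig_coord_bound[OF e x, of s v] st assms
        by (intro mult_mono) auto
      then show "\<bar>sig_coord e a t x w - sig_coord e a s x w\<bar> \<le> M * L * (t - s) + C * (t - s)\<^sup>2"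
        using C[OF st] by (simp add: mult.assoc)
    qed
    then show "norm (sig_coord e a t x w - sig_coord e a s x w) \<le> M * L * (t - s)" by simp
  qed (use M assms in simp)
qed

text \<open>Induction on the last letter: a difference of products splits into a difference of
  integrators, controlled by \<open>D\<close>, and a difference of integrands, controlled by the
  induction hypothesis.\<close>

lemma sig_coord_diff_bound:
  fixes e :: "'i \<Rightarrow> 'v::real_inner"
  assumes e: "orthonormal_basis e" and "0 \<le> L" "a \<le> T"
  obtains C where "0 \<le> C"
    "\<And>(x :: real \<Rightarrow> 'v) y D t. L-lipschitz_on {a..T} x \<Longrightarrow> L-lipschitz_on {a..T} y \<Longrightarrow>
       D-lipschitz_on {a..T} (\<lambda>r. x r - y r) \<Longrightarrow> a \<le> t \<Longrightarrow> t \<le> T \<Longrightarrow>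
       \<bar>sig_coord e a t x w - sig_coord e a t y w\<bar> \<le> C * D"
proof -
  have "\<exists>C\<ge>0. \<forall>(x :: real \<Rightarrow> 'v) y D t. L-lipschitz_on {a..T} x \<longrightarrow> L-lipschitz_on {a..T} y \<longrightarrow>
       D-lipschitz_on {a..T} (\<lambda>r. x r - y r) \<longrightarrow> a \<le> t \<longrightarrow> t \<le> T \<longrightarrow>
       \<bar>sig_coord e a t x w - sig_coord e a t y w\<bar> \<le> C * D"
  proof (induction w rule: rev_induct)
    case Nil
    show ?case by (intro exI[of _ 0]) auto
  next
    case (snoc i v)
    then obtain C where C: "0 \<le> C" "\<And>(x :: real \<Rightarrow> 'v) y D t. L-lipschitz_on {a..T} x \<Longrightarrow> L-lipschitz_on {a..T} y \<Longrightarrow>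
       D-lipschitz_on {a..T} (\<lambda>r. x r - y r) \<Longrightarrow> a \<le> t \<Longrightarrow> t \<le> T \<Longrightarrow>
       \<bar>sig_coord e a t x v - sig_coord e a t y v\<bar> \<le> C * D" by blast
    define M where "M = (L * (T - a)) ^ length v / fact (length v)"
    have M: "0 \<le> M" using assms by (simp add: M_def)
    have ei: "norm (e i) = 1" using e by (simp add: orthonormal_basis_def norm_eq_sqrt_inner)
    \<comment> \<open>\<open>M\<close> stems from the differing integrators, \<open>C * L\<close>
      from the differing integrands; the resulting rate acts over a time of at most
      \<open>T - a\<close>.\<close>
    let ?K = "(M + C * L) * (T - a)"
    have "\<bar>sig_coord e a t x (v @ [i]) - sig_coord e a t y (v @ [i])\<bar> \<le> ?K * D"
      if x: "L-lipschitz_on {a..T} x" and y: "L-lipschitz_on {a..T} y"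
        and D: "D-lipschitz_on {a..T} (\<lambda>r. x r - y r)" and t: "a \<le> t" "t \<le> T" for x y :: "real \<Rightarrow> 'v" and D t
    proof -
      note lx = lipschitz_coords_orthonormal[OF e x] and ly = lipschitz_coords_orthonormal[OF e y]
      have D0: "0 \<le> D" using lipschitz_on_nonneg[OF D] .
      obtain C1 where C1: "\<And>s t. a \<le> s \<Longrightarrow> s \<le> t \<Longrightarrow> t \<le> T \<Longrightarrow>
        \<bar>sig_coord e a t x (v @ [i]) - sig_coord e a s x (v @ [i])
          - sig_coord e a s x v * (inner (x t) (e i) - inner (x s) (e i))\<bar> \<le> C1 * (t - s)\<^sup>2"
        using sig_coord_primitive[OF lx, of v i] unfolding rs_primitive_def by metis
      obtain C2 where C2: "\<And>s t. a \<le> s \<Longrightarrow> s \<le> t \<Longrightarrow> t \<le> T \<Longrightarrow>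
        \<bar>sig_coord e a t y (v @ [i]) - sig_coord e a s y (v @ [i])
          - sig_coord e a s y v * (inner (y t) (e i) - inner (y s) (e i))\<bar> \<le> C2 * (t - s)\<^sup>2"
        using sig_coord_primitive[OF ly, of v i] unfolding rs_primitive_def by metis
      let ?\<psi> = "\<lambda>t. sig_coord e a t x (v @ [i]) - sig_coord e a t y (v @ [i])"
      have "\<bar>?\<psi> t - ?\<psi> a\<bar> \<le> (M * D + C * D * L) * (t - a)"
      proof (rule linear_bound_from_quadratic[where C = "C1 + C2" and a = a and b = T])
        fix s t assume st: "a \<le> s" "s \<le> t" "t \<le> T"
        let ?dx = "inner (x t) (e i) - inner (x s) (e i)" and ?dy = "inner (y t) (e i) - inner (y s) (e i)"
        have "\<bar>?dx - ?dy\<bar> \<le> D * (t - s)"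
          using Cauchy_Schwarz_ineq2[of "x t - y t - (x s - y s)" "e i"] lipschitz_on_realD[OF D st] ei
          by (simp add: inner_diff_left algebra_simps)
        then have 1: "\<bar>sig_coord e a s x v * (?dx - ?dy)\<bar> \<le> M * (D * (t - s))"
          unfolding abs_mult M_def using sig_coord_bound[OF e x, of s v] st assms
          by (intro mult_mono) auto
        have "\<bar>?dy\<bar> \<le> L * (t - s)"
          using Cauchy_Schwarz_ineq2[of "y t - y s" "e i"] lipschitz_on_realD[OF y st] ei
          by (simp add: inner_diff_left)
        then have 2: "\<bar>(sig_coord e a s x v - sig_coord e a s y v) * ?dy\<bar> \<le> (C * D) * (L * (t - s))"
          unfolding abs_mult using C(2)[OF x y D, of s] st C(1) D0 by (intro mult_mono) auto
        have "?\<psi> t - ?\<psi> s = sig_coord e a s x v * (?dx - ?dy)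
            + (sig_coord e a s x v - sig_coord e a s y v) * ?dy
            + (sig_coord e a t x (v @ [i]) - sig_coord e a s x (v @ [i]) - sig_coord e a s x v * ?dx)
            - (sig_coord e a t y (v @ [i]) - sig_coord e a s y (v @ [i]) - sig_coord e a s y v * ?dy)"
          by (simp add: algebra_simps)
        then have "\<bar>?\<psi> t - ?\<psi> s\<bar> \<le> M * (D * (t - s)) + (C * D) * (L * (t - s))
            + C1 * (t - s)\<^sup>2 + C2 * (t - s)\<^sup>2"
          using 1 2 C1[OF st] C2[OF st] by linarith
        then show "\<bar>?\<psi> t - ?\<psi> s\<bar> \<le> (M * D + C * D * L) * (t - s) + (C1 + C2) * (t - s)\<^sup>2"
          by (simp add: algebra_simps)
      qed (use t in auto)
      also have "\<dots> \<le> (M * D + C * D * L) * (T - a)"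
        using M C(1) D0 assms t by (intro mult_left_mono) auto
      finally show ?thesis
        using sig_coord_initial[OF lx] sig_coord_initial[OF ly] assms by (simp add: algebra_simps)
    qed
    moreover have "0 \<le> ?K" using M C(1) assms by simp
    ultimately show ?case by blast
  qed
  then show thesis using that by blast
qed

lemma lip_dist_lipschitz:
  fixes x y :: "real \<Rightarrow> 'v::real_normed_vector"
  assumes "x \<in> lip_paths a T" "y \<in> lip_paths a T" "a < T"
  shows "(lip_dist a T x y)-lipschitz_on {a..T} (\<lambda>r. x r - y r)"
proof -
  let ?P = "{(s, t). s \<in> {a..T} \<and> t \<in> {a..T} \<and> s \<noteq> t}"
  let ?z = "\<lambda>r. x r - y r"
  let ?q = "\<lambda>(s, t). norm (?z t - ?z s) / \<bar>t - s\<bar>"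
  obtain K L where "K-lipschitz_on {a..T} x" "L-lipschitz_on {a..T} y"
    using assms by (auto simp: lip_paths_def)
  then have "(K + L)-lipschitz_on {a..T} ?z" by (rule lipschitz_on_diff)
  then have bdd: "bdd_above (?q ` ?P)" by (rule lip_quotient_bdd_above)
  have d: "lip_dist a T x y = norm (?z a) + (SUP p\<in>?P. ?q p)"
    using assms by (simp add: lip_dist_def lip_norm_def)
  have upper: "norm (?z t - ?z s) / \<bar>t - s\<bar> \<le> lip_dist a T x y" if "(s, t) \<in> ?P" for s t
    using cSUP_upper[OF that bdd] unfolding d by (simp add: add_increasing)
  show ?thesis
  proof (rule lipschitz_on_realI)
    show "0 \<le> lip_dist a T x y"
      using upper[of a T] assms(3) by (auto intro: order_trans[rotated])
    fix s t assume st: "a \<le> s" "s \<le> t" "t \<le> T"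
    show "norm (?z t - ?z s) \<le> lip_dist a T x y * (t - s)"
    proof (cases "s = t")
      case False
      then show ?thesis using upper[of s t] st by (simp add: pos_divide_le_eq)
    qed simp
  qed
qed

text \<open>A compact set lies in a ball of radius \<open>B\<close> around some path
  \<open>c\<close>, and \<open>x = c - (c - x)\<close> has as Lipschitz constant that of
  \<open>c\<close> plus \<open>B\<close>.\<close>

lemma compactin_lip_topology_lipschitz:
  fixes X :: "(real \<Rightarrow> 'v::real_normed_vector) set"
  assumes "compactin (lip_topology a T) X" "X \<subseteq> lip_paths a T" "a < T"
  obtains L where "0 \<le> L" "\<And>x. x \<in> X \<Longrightarrow> L-lipschitz_on {a..T} x"
proof (cases "X = {}")
  case True
  then show thesis using that[of 0] by simp
next
  case False
  interpret Metric_space "lip_paths a T :: (real \<Rightarrow> 'v) set" "lip_dist a T"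
    by (rule Metric_space_lip[OF assms(3)])
  have "mbounded X" using assms(1) unfolding lip_topology_def by (rule compactin_imp_mbounded)
  then obtain c B where cB: "X \<subseteq> mcball c B" by (auto simp: mbounded_def)
  then have c: "c \<in> lip_paths a T" using False by auto
  then obtain K where K: "K-lipschitz_on {a..T} c" by (auto simp: lip_paths_def)
  have "(K + B)-lipschitz_on {a..T} x" if "x \<in> X" for x
  proof -
    have x: "x \<in> lip_paths a T" "lip_dist a T c x \<le> B" using that cB by auto
    have "B-lipschitz_on {a..T} (\<lambda>r. c r - x r)"
      using lipschitz_on_le[OF lip_dist_lipschitz[OF c x(1) assms(3)] x(2)] .
    from lipschitz_on_diff[OF K this] show ?thesis by simp
  qed
  moreover have "0 \<le> K + B" using False calculation lipschitz_on_nonneg by blast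
  ultimately show thesis using that by blast
qed

lemma continuous_map_sig_coord:
  fixes e :: "'i \<Rightarrow> 'v::real_inner"
  assumes e: "orthonormal_basis e" and aT: "a < T" and t: "a \<le> t" "t \<le> T"
    and sub: "X \<subseteq> lip_paths a T" and L: "0 \<le> L" "\<And>x. x \<in> X \<Longrightarrow> L-lipschitz_on {a..T} x"
  shows "continuous_map (subtopology (lip_topology a T) X) euclideanreal (\<lambda>x. sig_coord e a t x w)"
proof -
  interpret Metric_space "lip_paths a T :: (real \<Rightarrow> 'v) set" "lip_dist a T"
    by (rule Metric_space_lip[OF aT])
  interpret sub: Submetric "lip_paths a T :: (real \<Rightarrow> 'v) set" "lip_dist a T" X
    by unfold_locales (rule sub)
  obtain C where C: "0 \<le> C"
    "\<And>(x :: real \<Rightarrow> 'v) y D t. L-lipschitz_on {a..T} x \<Longrightarrow> L-lipschitz_on {a..T} y \<Longrightarrow>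
       D-lipschitz_on {a..T} (\<lambda>r. x r - y r) \<Longrightarrow> a \<le> t \<Longrightarrow> t \<le> T \<Longrightarrow>
       \<bar>sig_coord e a t x w - sig_coord e a t y w\<bar> \<le> C * D"
    using sig_coord_diff_bound[OF e L(1) less_imp_le[OF aT], of w] by blast
  have "continuous_map sub.sub.mtopology euclideanreal (\<lambda>x. sig_coord e a t x w)"
    unfolding sub.sub.continuous_map_from_metric
  proof (intro conjI ballI allI impI)
    fix x U assume x: "x \<in> X" and U: "openin euclideanreal U \<and> sig_coord e a t x w \<in> U"
    then obtain \<epsilon> where \<epsilon>: "0 < \<epsilon>" "ball (sig_coord e a t x w) \<epsilon> \<subseteq> U"
      by (auto simp: open_contains_ball)
    \<comment> \<open>The radius uses \<open>C + 1\<close> because \<open>C\<close> may be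
      0.\<close>
    have "sig_coord e a t y w \<in> U" if y: "y \<in> X" "lip_dist a T x y < \<epsilon> / (C + 1)" for y
    proof -
      have "\<bar>sig_coord e a t x w - sig_coord e a t y w\<bar> \<le> C * lip_dist a T x y"
        using x y sub by (intro C(2) L lip_dist_lipschitz aT t) auto
      also have "\<dots> \<le> (C + 1) * lip_dist a T x y" by (intro mult_right_mono) auto
      also have "\<dots> < \<epsilon>" using y(2) C(1) by (simp add: pos_less_divide_eq mult.commute)
      finally show ?thesis using \<epsilon>(2) by (auto simp: dist_real_def)
    qed
    then show "\<exists>r>0. \<forall>y. y \<in> X \<and> lip_dist a T x y < r \<longrightarrow> sig_coord e a t y w \<in> U"
      using \<epsilon>(1) C(1) by (intro exI[of _ "\<epsilon> / (C + 1)"]) auto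
  qed simp
  then show ?thesis by (simp add: lip_topology_def sub.mtopology_submetric)
qed

section \<open>The Stone--Weierstrass theorem for spans\<close>

text \<open>Equality is demanded only on \<open>P\<close>, where the shuffle identities hold. The
  index type is free, so that words over the basis of \<open>E\<close> and words over words are
  treated alike.\<close>

definition in_span_on :: "'p set \<Rightarrow> ('j \<Rightarrow> 'p \<Rightarrow> real) \<Rightarrow> ('p \<Rightarrow> real) \<Rightarrow> bool" where
  "in_span_on P \<sigma> g \<longleftrightarrow> (\<exists>J \<alpha>. finite J \<and> (\<forall>p\<in>P. g p = (\<Sum>j\<in>J. \<alpha> j * \<sigma> j p)))"

lemma in_span_on_base: "in_span_on P \<sigma> (\<sigma> j)"
  unfolding in_span_on_def by (intro exI[of _ "{j}"] exI[of _ "\<lambda>_. 1"]) simp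

lemma in_span_on_zero: "in_span_on P \<sigma> (\<lambda>_. 0)"
  unfolding in_span_on_def by (intro exI[of _ "{}"]) simp

lemma in_span_on_cong:
  assumes "in_span_on P \<sigma> g" "\<And>p. p \<in> P \<Longrightarrow> g' p = g p"
  shows "in_span_on P \<sigma> g'"
  using assms unfolding in_span_on_def by simp

lemma in_span_on_cmult:
  assumes "in_span_on P \<sigma> g"
  shows "in_span_on P \<sigma> (\<lambda>p. c * g p)"
proof -
  obtain J \<alpha> where "finite J" "\<forall>p\<in>P. g p = (\<Sum>j\<in>J. \<alpha> j * \<sigma> j p)"
    using assms by (auto simp: in_span_on_def)
  then show ?thesis unfolding in_span_on_def
    by (intro exI[of _ J] exI[of _ "\<lambda>j. c * \<alpha> j"]) (simp add: sum_distrib_left mult.assoc)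
qed

lemma in_span_on_add:
  assumes "in_span_on P \<sigma> g" "in_span_on P \<sigma> g'"
  shows "in_span_on P \<sigma> (\<lambda>p. g p + g' p)"
proof -
  obtain J \<alpha> where J: "finite J" "\<forall>p\<in>P. g p = (\<Sum>j\<in>J. \<alpha> j * \<sigma> j p)"
    using assms by (auto simp: in_span_on_def)
  obtain K \<beta> where K: "finite K" "\<forall>p\<in>P. g' p = (\<Sum>j\<in>K. \<beta> j * \<sigma> j p)"
    using assms by (auto simp: in_span_on_def)
  define \<gamma> where "\<gamma> j = (if j \<in> J then \<alpha> j else 0) + (if j \<in> K then \<beta> j else 0)" for j
  have 1: "(\<Sum>j\<in>J \<union> K. (if j \<in> J then \<alpha> j else 0) * \<sigma> j p) = (\<Sum>j\<in>J. \<alpha> j * \<sigma> j p)" for p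
    by (rule sum.mono_neutral_cong_right) (use J K in auto)
  have 2: "(\<Sum>j\<in>J \<union> K. (if j \<in> K then \<beta> j else 0) * \<sigma> j p) = (\<Sum>j\<in>K. \<beta> j * \<sigma> j p)" for p
    by (rule sum.mono_neutral_cong_right) (use J K in auto)
  show ?thesis unfolding in_span_on_def
  proof (intro exI conjI ballI)
    show "finite (J \<union> K)" using J K by simp
    fix p assume "p \<in> P"
    then have "g p + g' p = (\<Sum>j\<in>J. \<alpha> j * \<sigma> j p) + (\<Sum>j\<in>K. \<beta> j * \<sigma> j p)"
      using J K by simp
    also have "\<dots> = (\<Sum>j\<in>J \<union> K. \<gamma> j * \<sigma> j p)"
      unfolding \<gamma>_def distrib_right sum.distrib 1 2 ..
    finally show "g p + g' p = (\<Sum>j\<in>J \<union> K. \<gamma> j * \<sigma> j p)" .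
  qed
qed

lemma in_span_on_sum:
  assumes "\<And>i. i \<in> I \<Longrightarrow> in_span_on P \<sigma> (g i)"
  shows "in_span_on P \<sigma> (\<lambda>p. \<Sum>i\<in>I. g i p)"
  using assms
proof (induction I rule: infinite_finite_induct)
  case (insert i I)
  then have "in_span_on P \<sigma> (\<lambda>p. g i p + (\<Sum>i\<in>I. g i p))" by (intro in_span_on_add) simp_all
  then show ?case using insert by simp
qed (simp_all add: in_span_on_zero)

lemma in_span_on_sum_list:
  "in_span_on P \<sigma> (\<lambda>p. \<Sum>j\<leftarrow>ls. \<sigma> j p)"
proof (induction ls)
  case (Cons j ls)
  from in_span_on_add[OF in_span_on_base Cons] show ?case by simp
qed (simp add: in_span_on_zero)

lemma in_span_on_mult:
  assumes closed: "\<And>i j. in_span_on P \<sigma> (\<lambda>p. \<sigma> i p * \<sigma> j p)"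
    and "in_span_on P \<sigma> g" "in_span_on P \<sigma> g'"
  shows "in_span_on P \<sigma> (\<lambda>p. g p * g' p)"
proof -
  obtain J \<alpha> where J: "finite J" "\<forall>p\<in>P. g p = (\<Sum>j\<in>J. \<alpha> j * \<sigma> j p)"
    using assms by (auto simp: in_span_on_def)
  obtain K \<beta> where K: "finite K" "\<forall>p\<in>P. g' p = (\<Sum>j\<in>K. \<beta> j * \<sigma> j p)"
    using assms by (auto simp: in_span_on_def)
  have "in_span_on P \<sigma> (\<lambda>p. \<Sum>j\<in>J. \<Sum>k\<in>K. (\<alpha> j * \<beta> k) * (\<sigma> j p * \<sigma> k p))"
    by (intro in_span_on_sum in_span_on_cmult closed)
  then show ?thesis
    by (rule in_span_on_cong) (simp add: J K sum_product mult_ac)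
qed

lemma in_span_on_finite_support:
  assumes "in_span_on P \<sigma> g"
  obtains \<alpha> where "finite {j. \<alpha> j \<noteq> 0}" "\<forall>p\<in>P. g p = (\<Sum>j | \<alpha> j \<noteq> 0. \<alpha> j * \<sigma> j p)"
proof -
  obtain J \<alpha> where J: "finite J" "\<forall>p\<in>P. g p = (\<Sum>j\<in>J. \<alpha> j * \<sigma> j p)"
    using assms by (auto simp: in_span_on_def)
  define \<beta> where "\<beta> j = (if j \<in> J then \<alpha> j else 0)" for j
  have sub: "{j. \<beta> j \<noteq> 0} \<subseteq> J" by (auto simp: \<beta>_def)
  have "(\<Sum>j | \<beta> j \<noteq> 0. \<beta> j * \<sigma> j p) = (\<Sum>j\<in>J. \<alpha> j * \<sigma> j p)" for p
    by (rule sum.mono_neutral_cong_left) (use J sub in \<open>auto simp: \<beta>_def\<close>)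
  with J sub show thesis by (intro that[of \<beta>]) (auto intro: finite_subset)
qed

text \<open>The ring \<open>R\<close> consists of the continuous functions on the image of
  \<open>H\<close> whose pullback lies in the span. The \<open>\<sigma> j\<close> themselves may
  thus fail to factor through \<open>H\<close>: the coordinate projections belong to
  \<open>R\<close> and already separate points, and the span is closed under products.\<close>

lemma Stone_Weierstrass_in_span:
  fixes H :: "'p \<Rightarrow> ('w::countable \<Rightarrow> real)"
  assumes compact: "compact (H ` P)"
    and one: "in_span_on P \<sigma> (\<lambda>_. 1)"
    and closed: "\<And>i j. in_span_on P \<sigma> (\<lambda>p. \<sigma> i p * \<sigma> j p)"
    and coord: "\<And>w. in_span_on P \<sigma> (\<lambda>p. H p w)"
    and f: "continuous_on (H ` P) f" and "0 < \<epsilon>"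
  obtains g where "in_span_on P \<sigma> g" "\<And>p. p \<in> P \<Longrightarrow> \<bar>f (H p) - g p\<bar> < \<epsilon>"
proof -
  define R where "R = {g. continuous_on (H ` P) g \<and> in_span_on P \<sigma> (\<lambda>p. g (H p))}"
  interpret function_ring_on R "H ` P"
  proof
    show "compact (H ` P)" by fact
    show "continuous_on (H ` P) g" if "g \<in> R" for g using that by (simp add: R_def)
    show "(\<lambda>x. g x + g' x) \<in> R" if "g \<in> R" "g' \<in> R" for g g'
      using that by (auto simp: R_def intro: continuous_on_add in_span_on_add)
    show "(\<lambda>x. g x * g' x) \<in> R" if "g \<in> R" "g' \<in> R" for g g'
      using that by (auto simp: R_def intro: continuous_on_mult in_span_on_mult[OF closed])
    show "(\<lambda>_. c) \<in> R" for c
      using in_span_on_cmult[OF one, of c] by (simp add: R_def)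
    show "\<exists>g\<in>R. g x \<noteq> g y" if xy: "x \<in> H ` P" "y \<in> H ` P" "x \<noteq> y" for x y
    proof -
      obtain w where "x w \<noteq> y w" using xy(3) by blast
      moreover have "continuous_on (H ` P) (\<lambda>y. y w)"
        by (rule continuous_on_product_then_coordinatewise) (rule continuous_on_id)
      then have "(\<lambda>y. y w) \<in> R"
        using coord by (simp add: R_def)
      ultimately show ?thesis by (intro bexI[of _ "\<lambda>y. y w"])
    qed
  qed
  obtain g where "g \<in> R" "\<forall>x\<in>H ` P. \<bar>f x - g x\<bar> < \<epsilon>"
    using Stone_Weierstrass_basic[OF f \<open>0 < \<epsilon>\<close>] by blast
  then show thesis by (intro that[of "\<lambda>p. g (H p)"]) (auto simp: R_def)
qed

section \<open>Weak compactness of the probability measures\<close>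

text \<open>Weierstrass test with majorant \<open>(1 / \<gamma>) ^ Suc n\<close>. Base 3 is used for
  storing a digit sequence in a real number, base 2 for evaluating the digits at the positions
  \<open>p n\<close>.\<close>

lemma continuous_on_digit_series:
  fixes S :: "(nat \<Rightarrow> real) set" and \<gamma> :: real
  assumes "1 < \<gamma>" "\<And>c m. c \<in> S \<Longrightarrow> \<bar>c m\<bar> \<le> 1"
  shows "continuous_on S (\<lambda>c. \<Sum>n. c (p n) / \<gamma> ^ Suc n)"
proof -
  have lim: "uniform_limit S (\<lambda>n c. \<Sum>i<n. c (p i) / \<gamma> ^ Suc i) (\<lambda>c. \<Sum>i. c (p i) / \<gamma> ^ Suc i) sequentially"
  proof (rule Weierstrass_m_test)
    show "norm (c (p n) / \<gamma> ^ Suc n) \<le> (1 / \<gamma>) ^ Suc n" if "c \<in> S" for n c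
      using assms that by (simp add: power_one_over divide_simps abs_mult)
    show "summable (\<lambda>n. (1 / \<gamma>) ^ Suc n)"
      using assms(1) by (subst summable_Suc_iff) (auto intro!: summable_geometric)
  qed
  have cont: "continuous_on S (\<lambda>c. \<Sum>i<n. c (p i) / \<gamma> ^ Suc i)" for n
    using assms(1)
    by (intro continuous_intros continuous_on_product_then_coordinatewise[OF continuous_on_id]) auto
  show ?thesis
    by (rule uniform_limit_theorem[OF _ lim]) (use cont in auto)
qed

text \<open>Base 3 leaves gaps between the values of binary sequences, so that equal sums have equal
  digits.\<close>

lemma ternary_series_inj:
  fixes c d :: "nat \<Rightarrow> real"
  assumes c: "\<And>m. c m \<in> {0, 1}" and d: "\<And>m. d m \<in> {0, 1}"
    and eq: "(\<Sum>n. c n / 3 ^ Suc n) = (\<Sum>n. d n / 3 ^ Suc n)"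
  shows "c = d"
proof (rule ccontr)
  assume "c \<noteq> d"
  then have ex: "\<exists>m. c m \<noteq> d m" by blast
  define m where "m = (LEAST m. c m \<noteq> d m)"
  have m: "c m \<noteq> d m" unfolding m_def by (rule LeastI_ex[OF ex])
  have below: "c k = d k" if "k < m" for k
    using not_less_Least that unfolding m_def by blast
  define \<delta> where "\<delta> n = (c n - d n) / 3 ^ Suc n" for n
  have geo: "summable (\<lambda>n. (1/3 :: real) ^ Suc n)"
    by (subst summable_Suc_iff) (auto intro!: summable_geometric)
  have \<delta>le: "\<bar>\<delta> n\<bar> \<le> (1/3) ^ Suc n" for n
    using c[of n] d[of n] by (auto simp: \<delta>_def power_one_over)
  have cd: "\<bar>c n\<bar> \<le> 1" "\<bar>d n\<bar> \<le> 1" for n using c[of n] d[of n] by auto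
  have sc: "summable (\<lambda>n. c n / 3 ^ Suc n)"
    by (rule summable_comparison_test'[OF geo, of 0]) (simp add: power_one_over cd divide_right_mono)
  have sd: "summable (\<lambda>n. d n / 3 ^ Suc n)"
    by (rule summable_comparison_test'[OF geo, of 0]) (simp add: power_one_over cd divide_right_mono)
  have s\<delta>: "summable \<delta>" unfolding \<delta>_def diff_divide_distrib by (intro summable_diff sc sd)
  have "suminf \<delta> = 0"
    unfolding \<delta>_def diff_divide_distrib using suminf_diff[OF sc sd] eq by simp
  moreover have "suminf \<delta> = (\<Sum>n. \<delta> (n + Suc m)) + sum \<delta> {..<Suc m}"
    by (rule suminf_split_initial_segment[OF s\<delta>])
  moreover have "sum \<delta> {..<Suc m} = \<delta> m"
    using below by (simp add: \<delta>_def)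
  \<comment> \<open>The first differing digit weighs \<open>(1/3) ^ Suc m\<close>, while all later
    digits together weigh at most half of that.\<close>
  ultimately have "\<bar>\<delta> m\<bar> = \<bar>\<Sum>n. \<delta> (n + Suc m)\<bar>" by linarith
  also have "\<dots> \<le> (\<Sum>n. (1/3) ^ Suc (n + Suc m))"
  proof -
    have sg: "summable (\<lambda>n. (1/3 :: real) ^ Suc (n + Suc m))"
      using geo by (rule summable_ignore_initial_segment)
    have sa: "summable (\<lambda>n. \<bar>\<delta> (n + Suc m)\<bar>)"
      by (rule summable_comparison_test'[OF sg, of 0]) (simp only: real_norm_def abs_idempotent \<delta>le)
    have "\<bar>\<Sum>n. \<delta> (n + Suc m)\<bar> \<le> (\<Sum>n. \<bar>\<delta> (n + Suc m)\<bar>)"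
      using sa by (rule summable_rabs)
    also have "\<dots> \<le> (\<Sum>n. (1/3) ^ Suc (n + Suc m))"
      by (intro suminf_le sa sg) (rule \<delta>le)
    finally show ?thesis .
  qed
  also have "\<dots> = (1/3) ^ Suc (Suc m) * (\<Sum>n. (1/3) ^ n)"
    by (subst suminf_mult[symmetric]) (auto intro!: summable_geometric simp: power_add mult_ac)
  also have "(\<Sum>n. (1/3 :: real) ^ n) = 3 / 2"
    by (subst suminf_geometric) auto
  finally have "\<bar>\<delta> m\<bar> \<le> (1/3) ^ Suc m * (1/2)" by simp
  moreover have "\<bar>\<delta> m\<bar> = (1/3) ^ Suc m"
    using m c[of m] d[of m] by (auto simp: \<delta>_def power_one_over)
  ultimately show False by simp
qed

text \<open>The digit after the binary point at position \<open>n + 1\<close>. The form with floors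
  makes it Borel in \<open>u\<close> and makes the partial sums of the expansion collapse.\<close>

definition binary_digit :: "real \<Rightarrow> nat \<Rightarrow> real" where
  "binary_digit u n = real_of_int (\<lfloor>2 ^ Suc n * u\<rfloor> - 2 * \<lfloor>2 ^ n * u\<rfloor>)"

lemma binary_digit_range: "binary_digit u n \<in> {0, 1}"
proof -
  have "2 * \<lfloor>2 ^ n * u\<rfloor> \<le> \<lfloor>2 ^ Suc n * u\<rfloor>" "\<lfloor>2 ^ Suc n * u\<rfloor> < 2 * \<lfloor>2 ^ n * u\<rfloor> + 2"
    by (simp_all add: le_floor_iff floor_less_iff) linarith+
  then have "\<lfloor>2 ^ Suc n * u\<rfloor> - 2 * \<lfloor>2 ^ n * u\<rfloor> = 0 \<or> \<lfloor>2 ^ Suc n * u\<rfloor> - 2 * \<lfloor>2 ^ n * u\<rfloor> = 1"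
    by linarith
  then show ?thesis unfolding binary_digit_def by auto
qed

text \<open>The partial sums collapse to \<open>\<lfloor>2 ^ N * u\<rfloor> / 2 ^ N\<close>, within
  \<open>(1/2) ^ N\<close> below \<open>u\<close>. The bounds on \<open>u\<close> make the floor for
  \<open>N = 0\<close> vanish.\<close>

lemma binary_digit_sums:
  assumes "0 \<le> u" "u < 1"
  shows "(\<lambda>n. binary_digit u n / 2 ^ Suc n) sums u"
proof -
  have sum: "(\<Sum>n<N. binary_digit u n / 2 ^ Suc n) = real_of_int \<lfloor>2 ^ N * u\<rfloor> / 2 ^ N" for N
  proof (induction N)
    case 0
    show ?case using assms by (simp add: floor_eq_iff)
  next
    case (Suc N)
    then show ?case by (simp add: binary_digit_def field_simps)
  qed
  have "(\<lambda>N. real_of_int \<lfloor>2 ^ N * u\<rfloor> / 2 ^ N) \<longlonglongrightarrow> u"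
  proof (rule tendsto_sandwich[of "\<lambda>N. u - (1/2) ^ N" _ _ "\<lambda>N. u"])
    show "\<forall>\<^sub>F N in sequentially. u - (1/2) ^ N \<le> real_of_int \<lfloor>2 ^ N * u\<rfloor> / 2 ^ N"
    proof (intro always_eventually allI)
      fix N
      have "2 ^ N * u - 1 \<le> real_of_int \<lfloor>2 ^ N * u\<rfloor>" by linarith
      then have "(2 ^ N * u - 1) / 2 ^ N \<le> real_of_int \<lfloor>2 ^ N * u\<rfloor> / 2 ^ N"
        by (rule divide_right_mono) simp
      then show "u - (1/2) ^ N \<le> real_of_int \<lfloor>2 ^ N * u\<rfloor> / 2 ^ N"
        by (simp add: diff_divide_distrib power_one_over)
    qed
    show "\<forall>\<^sub>F N in sequentially. real_of_int \<lfloor>2 ^ N * u\<rfloor> / 2 ^ N \<le> u"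
    proof (intro always_eventually allI)
      fix N
      have "real_of_int \<lfloor>2 ^ N * u\<rfloor> / 2 ^ N \<le> (2 ^ N * u) / 2 ^ N"
        by (rule divide_right_mono) (auto simp: of_int_floor_le)
      then show "real_of_int \<lfloor>2 ^ N * u\<rfloor> / 2 ^ N \<le> u" by simp
    qed
    show "(\<lambda>N. u - (1/2) ^ N) \<longlonglongrightarrow> u"
      using tendsto_diff[OF tendsto_const[of u] LIMSEQ_realpow_zero[of "1/2 :: real"]] by simp
  qed simp
  then show ?thesis unfolding sums_def sum .
qed

text \<open>Transporting measures along \<open>s\<close> and back along \<open>q\<close> reduces weak compactness to Helly's selection
  theorem on the real line.  The map \<open>q\<close> reads the coordinates of a point off the digits of a point of
  the Cantor set.\<close>

lemma Cantor_coding: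
  fixes Y :: "('w::countable \<Rightarrow> real) set"
  assumes "compact Y"
  obtains K :: "real set" and q :: "real \<Rightarrow> 'w \<Rightarrow> real" and s
  where "compact K" "continuous_on K q" "q ` K \<subseteq> Y" "s \<in> borel_measurable borel" "s ` Y \<subseteq> K"
    "\<forall>y\<in>Y. q (s y) = y"
proof -
  have coord: "continuous_on S (\<lambda>y. y w)" for S :: "('b \<Rightarrow> real) set" and w
    by (rule continuous_on_product_then_coordinatewise) (rule continuous_on_id)
  \<comment> \<open>The bound is strict so that the rescaled coordinate
    \<open>(y w / B w + 1) / 2\<close> stays below 1, as the binary expansion requires.\<close>
  have "\<exists>B>0. \<forall>y\<in>Y. \<bar>y w\<bar> < B" for w
  proof -
    have "bounded ((\<lambda>y. y w) ` Y)"
      by (intro compact_imp_bounded compact_continuous_image coord assms)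
    then obtain B where "0 < B" "\<forall>y\<in>Y. \<bar>y w\<bar> \<le> B" by (auto simp: bounded_pos)
    then show ?thesis by (intro exI[of _ "B + 1"]) force
  qed
  then obtain B where B: "\<And>w. 0 < B w" "\<And>y w. y \<in> Y \<Longrightarrow> \<bar>y w\<bar> < B w" by metis
  define cube where "cube = {c :: nat \<Rightarrow> real. \<forall>m. c m \<in> {0, 1}}"
  have cube1: "\<bar>c m\<bar> \<le> 1" if "c \<in> cube" for c m
    using that by (auto simp: cube_def elim!: allE[of _ m])
  have "compactin (product_topology (\<lambda>_. euclidean) UNIV) (PiE UNIV (\<lambda>_ :: nat. {0, 1 :: real}))"
    by (subst compactin_PiE) auto
  moreover have "PiE UNIV (\<lambda>_ :: nat. {0, 1 :: real}) = cube" by (auto simp: PiE_def Pi_def cube_def)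
  ultimately have "compact cube" by (simp add: euclidean_product_topology)
  define t where "t c = (\<Sum>n. c n / 3 ^ Suc n)" for c :: "nat \<Rightarrow> real"
  have t: "continuous_on cube t"
    unfolding t_def using continuous_on_digit_series[of 3 cube "\<lambda>n. n"] cube1 by simp
  \<comment> \<open>\<open>prod_encode\<close> interleaves the countably many coordinates in one
    sequence. \<open>Q\<close> decodes the digits of coordinate \<open>w\<close> to a number in
    \<open>[0,1]\<close> and scales it to \<open>[- B w, B w]\<close>.\<close>
  define Q where "Q c w = B w * (2 * (\<Sum>n. c (prod_encode (to_nat w, n)) / 2 ^ Suc n) - 1)" for c and w :: 'w
  have Q: "continuous_on cube Q"
    by (intro continuous_on_coordinatewise_then_product)
       (unfold Q_def, intro continuous_intros continuous_on_digit_series, use cube1 in auto)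
  define bits where "bits y m = (case prod_decode m of (j, n) \<Rightarrow>
      binary_digit ((y (from_nat j) / B (from_nat j) + 1) / 2) n)" for y :: "'w \<Rightarrow> real" and m
  have bits_cube: "bits y \<in> cube" for y
    using binary_digit_range by (auto simp: cube_def bits_def split: prod.splits)
  have Q_bits: "Q (bits y) = y" if "y \<in> Y" for y
  proof
    fix w
    define v where "v = y w / B w"
    have "\<bar>v\<bar> < 1"
      using B(1)[of w] B(2)[OF that, of w] by (simp add: v_def abs_divide)
    then have "(\<lambda>n. binary_digit ((v + 1) / 2) n / 2 ^ Suc n) sums ((v + 1) / 2)"
      by (intro binary_digit_sums) auto
    then have "(\<Sum>n. binary_digit ((v + 1) / 2) n / 2 ^ Suc n) = (v + 1) / 2"
      by (rule sums_unique[symmetric])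
    moreover have "bits y (prod_encode (to_nat w, n)) = binary_digit ((v + 1) / 2) n" for n
      by (simp add: bits_def v_def)
    ultimately have "Q (bits y) w = B w * v" by (simp add: Q_def)
    then show "Q (bits y) w = y w"
      using B(1)[of w] by (simp add: v_def)
  qed
  \<comment> \<open>Not every digit sequence codes a point of \<open>Y\<close>. Those that do form a
    compact set, on which the injective map \<open>t\<close> has a continuous inverse.\<close>
  define D where "D = {c \<in> cube. Q c \<in> Y}"
  have "closedin (top_of_set cube) (cube \<inter> Q -` Y)"
    by (rule continuous_closedin_preimage[OF Q compact_imp_closed[OF assms]])
  moreover have "cube \<inter> Q -` Y = D" by (auto simp: D_def)
  ultimately have "compact D" using \<open>compact cube\<close> closedin_compact by metis
  have "inj_on t D"
    by (rule inj_onI, rule ternary_series_inj) (auto simp: D_def cube_def t_def)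
  have tD: "continuous_on D t" using t by (rule continuous_on_subset) (auto simp: D_def)
  obtain g where g: "homeomorphism D (t ` D) t g"
    using homeomorphism_compact[OF \<open>compact D\<close> tD refl \<open>inj_on t D\<close>] by blast
  show thesis
  proof (rule that[of "t ` D" "Q \<circ> g" "t \<circ> bits"])
    show "compact (t ` D)" by (rule compact_continuous_image[OF tD \<open>compact D\<close>])
    have gD: "g ` (t ` D) = D" using g by (simp add: homeomorphism_def)
    show "continuous_on (t ` D) (Q \<circ> g)"
    proof (rule continuous_on_compose)
      show "continuous_on (t ` D) g" using g by (simp add: homeomorphism_def)
      show "continuous_on (g ` (t ` D)) Q"
        unfolding gD using Q by (rule continuous_on_subset) (auto simp: D_def)
    qed
    show "(Q \<circ> g) ` (t ` D) \<subseteq> Y" using gD by (auto simp: D_def image_comp)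
    have bD: "bits y \<in> D" if "y \<in> Y" for y using that bits_cube Q_bits by (simp add: D_def)
    then show "(t \<circ> bits) ` Y \<subseteq> t ` D" by auto
    show "\<forall>y\<in>Y. (Q \<circ> g) ((t \<circ> bits) y) = y"
      using homeomorphism_apply1[OF g bD] Q_bits by simp
    \<comment> \<open>Reading off digits is discontinuous, but floors are Borel; measurability is
      enough to push measures forward along \<open>s\<close>.\<close>
    have "(\<lambda>y. bits y m) \<in> borel_measurable borel" for m
    proof (cases "prod_decode m")
      case (Pair j n)
      have [measurable]: "(\<lambda>y :: 'w \<Rightarrow> real. y w) \<in> borel_measurable borel" for w
        by (rule borel_measurable_continuous_onI[OF coord])
      show ?thesis unfolding bits_def Pair binary_digit_def by simp
    qed
    then show "t \<circ> bits \<in> borel_measurable borel"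
      unfolding t_def comp_def by (intro borel_measurable_suminf borel_measurable_divide) auto
  qed
qed

section \<open>Borel probability measures on a compact space\<close>

text \<open>Carries only the space and the sigma-algebra, as a target for \<open>distr\<close> and
  for measurability.\<close>

definition borel_of_topology :: "'p topology \<Rightarrow> 'p measure" where
  "borel_of_topology X = sigma (topspace X) {U. openin X U}"

lemma space_borel_of_topology [simp]: "space (borel_of_topology X) = topspace X"
  unfolding borel_of_topology_def by (rule space_measure_of) (use openin_subset in blast)

lemma sets_borel_of_topology:
  "sets (borel_of_topology X) = sigma_sets (topspace X) {U. openin X U}"
  unfolding borel_of_topology_def by (rule sets_measure_of) (use openin_subset in blast)

lemma prob_measures_iff:
  "\<mu> \<in> prob_measures X \<longleftrightarrow> prob_space \<mu> \<and> sets \<mu> = sets (borel_of_topology X)"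
  unfolding prob_measures_def sets_borel_of_topology[symmetric]
  using sets_eq_imp_space_eq[of \<mu> "borel_of_topology X"] by auto

lemma prob_measures_D:
  assumes "\<mu> \<in> prob_measures X"
  shows "prob_space \<mu>" "space \<mu> = topspace X" "sets \<mu> = sets (borel_of_topology X)"
  using assms unfolding prob_measures_def sets_borel_of_topology by auto

lemma continuous_map_borel_measurable:
  fixes f :: "'p \<Rightarrow> 'b::topological_space"
  assumes "continuous_map X euclidean f" "\<mu> \<in> prob_measures X"
  shows "f \<in> borel_measurable \<mu>"
proof (rule borel_measurableI)
  fix S :: "'b set" assume "open S"
  then have "openin X {x \<in> topspace X. f x \<in> S}"
    using assms(1) by (auto simp: continuous_map_def)
  moreover have "f -` S \<inter> space \<mu> = {x \<in> topspace X. f x \<in> S}"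
    using prob_measures_D[OF assms(2)] by auto
  ultimately show "f -` S \<inter> space \<mu> \<in> sets \<mu>"
    using prob_measures_D[OF assms(2)] by (auto simp: sets_borel_of_topology)
qed

lemma continuous_map_bounded:
  fixes f :: "'p \<Rightarrow> real"
  assumes "compact_space X" "continuous_map X euclideanreal f"
  obtains B where "\<And>x. x \<in> topspace X \<Longrightarrow> \<bar>f x\<bar> \<le> B"
proof -
  have "compact (f ` topspace X)"
    using image_compactin[OF _ assms(2), of "topspace X"] assms(1) by (simp add: compact_space_def)
  then have "bounded (f ` topspace X)" by (rule compact_imp_bounded)
  then obtain B where "\<forall>y\<in>f ` topspace X. \<bar>y\<bar> \<le> B"
    by (auto simp: bounded_iff)
  then show thesis using that by blast
qed

lemma integrable_continuous_map:
  fixes f :: "'p \<Rightarrow> real"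
  assumes "compact_space X" "continuous_map X euclideanreal f" "\<mu> \<in> prob_measures X"
  shows "integrable \<mu> f"
proof -
  interpret prob_space \<mu> using prob_measures_D[OF assms(3)] by simp
  obtain B where "\<And>x. x \<in> topspace X \<Longrightarrow> \<bar>f x\<bar> \<le> B" using continuous_map_bounded[OF assms(1,2)] by metis
  then show ?thesis
    using prob_measures_D[OF assms(3)] continuous_map_borel_measurable[OF assms(2,3)]
    by (intro integrable_const_bound[of _ B]) auto
qed

text \<open>A continuous injection of a compact space into a Hausdorff space is a homeomorphism onto
  its image. The abstract space thereby becomes a compact set of real sequences, to which Cantor
  coding and Stone-Weierstrass apply.\<close>

lemma coordinate_homeomorphism:
  fixes h :: "'w::countable \<Rightarrow> 'p \<Rightarrow> real"
  assumes X: "compact_space X"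
    and cont: "\<And>w. continuous_map X euclideanreal (h w)"
    and inj: "inj_on (\<lambda>x w. h w x) (topspace X)"
  defines "H \<equiv> \<lambda>x w. h w x"
  obtains g where "continuous_map X euclidean H" "compact (H ` topspace X)"
    "homeomorphic_maps X (top_of_set (H ` topspace X)) H g"
proof -
  have H: "continuous_map X euclidean H"
    using continuous_map_componentwise_UNIV[of X "\<lambda>_. euclideanreal" H] cont
    by (simp add: H_def euclidean_product_topology)
  have "compact (H ` topspace X)"
    using image_compactin[OF _ H, of "topspace X"] X by (simp add: compact_space_def)
  moreover have "homeomorphic_map X (top_of_set (H ` topspace X)) H"
  proof (rule continuous_imp_homeomorphic_map[OF _ X])
    show "continuous_map X (top_of_set (H ` topspace X)) H"
      using H by (auto simp: continuous_map_in_subtopology)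
    show "Hausdorff_space (top_of_set (H ` topspace X))" by (simp add: Hausdorff_space_subtopology)
  qed (use inj in \<open>auto simp: H_def\<close>)
  ultimately show thesis using that H by (auto simp: homeomorphic_map_maps)
qed

text \<open>The map \<open>\<sigma>\<close> to the line is merely Borel, yet each \<open>h w\<close>
  equals \<open>\<phi> \<circ> \<sigma>\<close> on the space for some bounded continuous
  \<open>\<phi>\<close>. Weak convergence of the image measures therefore yields convergence of
  these moments; other integrands are left to \<open>moments_determine_limit\<close>.\<close>

lemma prob_measures_sequentially_compact:
  fixes h :: "'w::countable \<Rightarrow> 'p \<Rightarrow> real"
  assumes X: "compact_space X"
    and cont: "\<And>w. continuous_map X euclideanreal (h w)"
    and inj: "inj_on (\<lambda>x w. h w x) (topspace X)"
    and \<mu>: "\<And>n. \<mu> n \<in> prob_measures X"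
  obtains r \<mu>' where "strict_mono (r :: nat \<Rightarrow> nat)" "\<mu>' \<in> prob_measures X"
    "\<forall>w. (\<lambda>n. integral\<^sup>L (\<mu> (r n)) (h w)) \<longlonglongrightarrow> integral\<^sup>L \<mu>' (h w)"
proof -
  define H where "H = (\<lambda>x w. h w x)"
  define Y where "Y = H ` topspace X"
  obtain g where H: "continuous_map X euclidean H" and "compact Y"
    and g: "homeomorphic_maps X (top_of_set Y) H g"
    using coordinate_homeomorphism[of X h, OF X cont inj] unfolding H_def[symmetric] Y_def by metis
  then have g_cont: "continuous_map (top_of_set Y) X g"
    and Hg: "\<And>y. y \<in> Y \<Longrightarrow> H (g y) = y" by (auto simp: homeomorphic_maps_def)
  have gY: "g y \<in> topspace X" if "y \<in> Y" for y
    using continuous_map_funspace[OF g_cont] that by auto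
  obtain K :: "real set" and q s where K: "compact K" and q: "continuous_on K q" "q ` K \<subseteq> Y"
    and s: "s \<in> borel_measurable borel" "s ` Y \<subseteq> K" and qs: "\<forall>y\<in>Y. q (s y) = y"
    using Cantor_coding[OF \<open>compact Y\<close>] by metis
  define \<sigma> where "\<sigma> x = s (H x)" for x
  have \<sigma>K: "\<sigma> x \<in> K" if "x \<in> topspace X" for x using s(2) that unfolding \<sigma>_def Y_def by blast
  have \<sigma>_meas: "\<sigma> \<in> borel_measurable (\<mu> n)" for n
    unfolding \<sigma>_def using measurable_compose[OF continuous_map_borel_measurable[OF H \<mu>] s(1)] .
  define \<nu> where "\<nu> n = distr (\<mu> n) borel \<sigma>" for n
  interpret \<mu>: prob_space "\<mu> n" for n using prob_measures_D[OF \<mu>] by simp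
  have \<nu>: "real_distribution (\<nu> n)" for n
    unfolding \<nu>_def by (intro real_distribution.intro real_distribution_axioms.intro \<mu>.prob_space_distr \<sigma>_meas) simp
  have tight: "tight \<nu>"
    unfolding tight_def
  proof (intro conjI allI impI \<nu>)
    fix \<epsilon> :: real assume "0 < \<epsilon>"
    obtain B where B: "0 < B" "\<forall>x\<in>K. \<bar>x\<bar> \<le> B" using compact_imp_bounded[OF K] by (auto simp: bounded_pos)
    \<comment> \<open>All image measures live on the bounded set \<open>K\<close>. The left end is
      \<open>- B - 1\<close> because the interval is open there and \<open>K\<close> may contain
      \<open>- B\<close>.\<close>
    have "measure (\<nu> n) {- B - 1<..B} > 1 - \<epsilon>" for n
    proof -
      have "measure (\<nu> n) {- B - 1<..B} = measure (\<mu> n) (\<sigma> -` {- B - 1<..B} \<inter> space (\<mu> n))"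
        unfolding \<nu>_def using \<sigma>_meas by (intro measure_distr) auto
      also have "\<sigma> -` {- B - 1<..B} \<inter> space (\<mu> n) = space (\<mu> n)"
        using \<sigma>K B prob_measures_D(2)[OF \<mu>] by (fastforce simp: abs_le_iff)
      finally show ?thesis using \<open>0 < \<epsilon>\<close> by (simp add: \<mu>.prob_space)
    qed
    then show "\<exists>a b. a < b \<and> (\<forall>n. measure (\<nu> n) {a<..b} > 1 - \<epsilon>)"
      using B by (intro exI[of _ "- B - 1"] exI[of _ B]) auto
  qed
  obtain r M where r: "strict_mono r" and M: "real_distribution M" and conv: "weak_conv_m (\<nu> \<circ> id \<circ> r) M"
    using tight_imp_convergent_subsubsequence[OF tight strict_mono_id] by blast
  interpret M: real_distribution M by (rule M)
  have lim: "(\<lambda>n. integral\<^sup>L (\<mu> (r n)) (\<lambda>x. \<phi> (\<sigma> x))) \<longlonglongrightarrow> integral\<^sup>L M \<phi>"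
    if \<phi>: "continuous_on UNIV \<phi>" "\<And>x. \<bar>\<phi> x\<bar> \<le> B" for \<phi> :: "real \<Rightarrow> real" and B
  proof -
    have "(\<lambda>n. integral\<^sup>L ((\<nu> \<circ> id \<circ> r) n) \<phi>) \<longlonglongrightarrow> integral\<^sup>L M \<phi>"
    proof (rule weak_conv_imp_integral_bdd_continuous_conv[OF _ M conv])
      show "real_distribution ((\<nu> \<circ> id \<circ> r) n)" for n using \<nu> by simp
      show "isCont \<phi> x" for x using \<phi>(1) by (simp add: continuous_on_eq_continuous_at)
      show "norm (\<phi> x) \<le> B" for x using \<phi>(2) by simp
    qed
    moreover have "integral\<^sup>L (\<nu> n) \<phi> = integral\<^sup>L (\<mu> n) (\<lambda>x. \<phi> (\<sigma> x))" for n
      unfolding \<nu>_def by (intro integral_distr \<sigma>_meas borel_measurable_continuous_onI \<phi>)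
    ultimately show ?thesis by simp
  qed
  obtain x0 where x0: "x0 \<in> topspace X"
    using \<mu>.not_empty[of 0] prob_measures_D(2)[OF \<mu>, of 0] by blast
  then have "K \<noteq> {}" using \<sigma>K by blast
  have "AE x in M. x \<in> K"
  proof -
    \<comment> \<open>Truncation makes the distance to \<open>K\<close> an admissible test function.
      Its integral is 0 along the sequence, hence also for the limit \<open>M\<close>, which is thus
      concentrated on \<open>K\<close>.\<close>
    define \<phi> where "\<phi> x = min 1 (infdist x K)" for x
    have \<phi>: "continuous_on UNIV \<phi>" "0 \<le> \<phi> x" "\<bar>\<phi> x\<bar> \<le> 1" for x
      unfolding \<phi>_def by (auto intro!: continuous_intros simp: infdist_nonneg)
    have "integral\<^sup>L (\<mu> (r n)) (\<lambda>x. \<phi> (\<sigma> x)) = 0" for n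
    proof -
      have "integral\<^sup>L (\<mu> (r n)) (\<lambda>x. \<phi> (\<sigma> x)) = integral\<^sup>L (\<mu> (r n)) (\<lambda>x. 0)"
        using \<sigma>K prob_measures_D(2)[OF \<mu>] by (intro Bochner_Integration.integral_cong) (auto simp: \<phi>_def)
      then show ?thesis by simp
    qed
    then have "integral\<^sup>L M \<phi> = 0"
      using lim[of \<phi> 1] \<phi> LIMSEQ_unique[OF _ tendsto_const] by simp
    moreover have "integrable M \<phi>"
      using \<phi>(3) borel_measurable_continuous_onI[OF \<phi>(1)] by (intro M.integrable_const_bound[of _ 1]) auto
    ultimately have "AE x in M. \<phi> x = 0"
      using integral_nonneg_eq_0_iff_AE[of M \<phi>] \<phi>(2) by simp
    then show ?thesis
    proof (rule AE_mp, intro AE_I2 impI)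
      fix x assume "\<phi> x = 0"
      then show "x \<in> K"
        using in_closed_iff_infdist_zero[OF compact_imp_closed[OF K] \<open>K \<noteq> {}\<close>, of x]
        by (simp add: \<phi>_def min_def split: if_splits)
    qed
  qed
  have "closed K" using K by (rule compact_imp_closed)
  \<comment> \<open>\<open>x0\<close> is a default value off \<open>K\<close>, a null set of
    \<open>M\<close>.\<close>
  define k where "k x = (if x \<in> K then g (q x) else x0)" for x
  have k_meas: "k \<in> M \<rightarrow>\<^sub>M borel_of_topology X"
    unfolding borel_of_topology_def
  proof (rule measurable_measure_of)
    show "{U. openin X U} \<subseteq> Pow (topspace X)" by (auto dest: openin_subset)
    show "k \<in> space M \<rightarrow> topspace X" using gY q(2) x0 by (auto simp: k_def image_subset_iff)
    fix U assume "U \<in> {U. openin X U}"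
    then have "openin (top_of_set Y) {y \<in> Y. g y \<in> U}"
      using g_cont by (auto simp: continuous_map_def)
    then obtain V where "open V" and V: "{y \<in> Y. g y \<in> U} = Y \<inter> V" by (auto simp: openin_open)
    have "openin (top_of_set K) (K \<inter> q -` V)"
      by (rule continuous_openin_preimage_gen[OF q(1) \<open>open V\<close>])
    then obtain W where "open W" and W: "K \<inter> q -` V = K \<inter> W" by (auto simp: openin_open)
    have "x \<in> W \<longleftrightarrow> g (q x) \<in> U" if "x \<in> K" for x using V W q(2) that by blast
    then have "k -` U \<inter> space M = (K \<inter> W) \<union> (if x0 \<in> U then - K else {})"
      by (auto simp: k_def split: if_splits)
    moreover have "(K \<inter> W) \<union> (if x0 \<in> U then - K else {}) \<in> sets borel"
      using \<open>closed K\<close> \<open>open W\<close> by auto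
    ultimately show "k -` U \<inter> space M \<in> sets M" by simp
  qed
  define \<mu>' where "\<mu>' = distr M (borel_of_topology X) k"
  have \<mu>': "\<mu>' \<in> prob_measures X"
    unfolding prob_measures_iff \<mu>'_def using M.prob_space_distr[OF k_meas] by simp
  have "(\<lambda>n. integral\<^sup>L (\<mu> (r n)) (h w)) \<longlonglongrightarrow> integral\<^sup>L \<mu>' (h w)" for w
  proof -
    have qw: "continuous_on K (\<lambda>x. q x w)" using q(1) by (rule continuous_on_product_then_coordinatewise)
    obtain B where B: "0 < B" "\<forall>x\<in>K. \<bar>q x w\<bar> \<le> B"
      using compact_imp_bounded[OF compact_continuous_image[OF qw K]] by (auto simp: bounded_pos)
    \<comment> \<open>Test functions must be continuous on the whole line, whereas \<open>q\<close>
      is continuous only on \<open>K\<close>; Tietze extends each coordinate with the same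
      bound.\<close>
    obtain \<phi> where \<phi>: "continuous_on UNIV \<phi>" "\<And>x. x \<in> K \<Longrightarrow> \<phi> x = q x w" "\<And>x. \<bar>\<phi> x\<bar> \<le> B"
      using Tietze[OF qw, of UNIV B] \<open>closed K\<close> B by auto
    have "integral\<^sup>L \<mu>' (h w) = integral\<^sup>L M (\<lambda>x. h w (k x))"
      unfolding \<mu>'_def
    proof (rule integral_distr[OF k_meas])
      show "h w \<in> borel_measurable (borel_of_topology X)"
        using continuous_map_borel_measurable[OF cont \<mu>'] measurable_cong_sets[OF prob_measures_D(3)[OF \<mu>'] refl]
        by blast
    qed
    also have "\<dots> = integral\<^sup>L M \<phi>"
    proof (rule integral_cong_AE)
      show "(\<lambda>x. h w (k x)) \<in> borel_measurable M"
        using measurable_compose[OF k_meas] continuous_map_borel_measurable[OF cont \<mu>']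
          measurable_cong_sets[OF prob_measures_D(3)[OF \<mu>'] refl] by blast
      show "\<phi> \<in> borel_measurable M" using borel_measurable_continuous_onI[OF \<phi>(1)] by simp
      show "AE x in M. h w (k x) = \<phi> x"
        using \<open>AE x in M. x \<in> K\<close>
      proof (rule AE_mp, intro AE_I2 impI)
        fix x assume "x \<in> K"
        then have "H (g (q x)) = q x" using Hg q(2) by blast
        then show "h w (k x) = \<phi> x"
          using \<open>x \<in> K\<close> \<phi>(2) by (simp add: k_def H_def fun_eq_iff)
      qed
    qed
    finally have "integral\<^sup>L \<mu>' (h w) = integral\<^sup>L M \<phi>" .
    moreover have "integral\<^sup>L (\<mu> n) (h w) = integral\<^sup>L (\<mu> n) (\<lambda>x. \<phi> (\<sigma> x))" for n
    proof (rule Bochner_Integration.integral_cong[OF refl])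
      fix x assume "x \<in> space (\<mu> n)"
      then have x: "x \<in> topspace X" using prob_measures_D(2)[OF \<mu>] by simp
      then have "q (\<sigma> x) = H x" using qs by (simp add: \<sigma>_def Y_def)
      then show "h w x = \<phi> (\<sigma> x)" using \<phi>(2)[OF \<sigma>K[OF x]] by (simp add: H_def)
    qed
    ultimately show ?thesis using lim[OF \<phi>(1,3)] by simp
  qed
  then show thesis using that r \<mu>' by blast
qed

section \<open>Approximation of weakly continuous functions\<close>

lemma tendsto_fun_iff:
  fixes f :: "'n \<Rightarrow> 'w \<Rightarrow> 'b::topological_space"
  shows "(f \<longlongrightarrow> l) F \<longleftrightarrow> (\<forall>w. ((\<lambda>n. f n w) \<longlongrightarrow> l w) F)"
proof -
  have "(f \<longlongrightarrow> l) F \<longleftrightarrow> limitin (product_topology (\<lambda>_. euclidean) UNIV) f l F"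
    by (simp add: euclidean_product_topology)
  also have "\<dots> \<longleftrightarrow> (\<forall>w. ((\<lambda>n. f n w) \<longlongrightarrow> l w) F)"
    by (subst limitin_componentwise) simp
  finally show ?thesis .
qed

text \<open>Lying eventually in every set of a given kind around \<open>\<mu>'\<close> holds for the
  generating sets by hypothesis and passes to finite intersections and arbitrary unions, so
  induction on the generated topology applies.\<close>

lemma weakly_continuous_tendsto:
  assumes F: "continuous_map (weak_topology X) euclideanreal F"
    and \<mu>: "\<And>n. \<mu> n \<in> prob_measures X" and \<mu>': "\<mu>' \<in> prob_measures X"
    and lim: "\<And>f. continuous_map X euclideanreal f \<Longrightarrow>
      (\<lambda>n. integral\<^sup>L (\<mu> n) f) \<longlonglongrightarrow> integral\<^sup>L \<mu>' f"
  shows "(\<lambda>n. F (\<mu> n)) \<longlonglongrightarrow> F \<mu>'"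
proof (rule topological_tendstoI)
  fix S assume "open S" "F \<mu>' \<in> S"
  let ?\<G> = "{{\<mu> \<in> prob_measures X. integral\<^sup>L \<mu> f \<in> U} | f U.
        continuous_map X euclideanreal f \<and> open U}"
  have "openin (weak_topology X) {\<nu> \<in> prob_measures X. F \<nu> \<in> S}"
    using F \<open>open S\<close> by (auto simp: continuous_map_def)
  then have gen: "generate_topology_on ?\<G> {\<nu> \<in> prob_measures X. F \<nu> \<in> S}"
    unfolding weak_topology_def by (rule openin_topology_generated_by)
  have "\<mu>' \<in> W \<longrightarrow> (\<forall>\<^sub>F n in sequentially. \<mu> n \<in> W)" if "generate_topology_on ?\<G> W" for W
    using that
  proof induction
    case (Int W W')
    then show ?case by (auto intro: eventually_conj)
  next
    case (UN K)
    show ?case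
    proof
      assume "\<mu>' \<in> \<Union>K"
      then obtain k where "k \<in> K" "\<mu>' \<in> k" by blast
      then have "\<forall>\<^sub>F n in sequentially. \<mu> n \<in> k" using UN.IH by blast
      then show "\<forall>\<^sub>F n in sequentially. \<mu> n \<in> \<Union>K"
        by (rule eventually_mono) (use \<open>k \<in> K\<close> in blast)
    qed
  next
    case (Basis W)
    then obtain f U where W: "W = {\<mu> \<in> prob_measures X. integral\<^sup>L \<mu> f \<in> U}"
      and f: "continuous_map X euclideanreal f" and "open U" by blast
    show ?case
    proof
      assume "\<mu>' \<in> W"
      then have "\<forall>\<^sub>F n in sequentially. integral\<^sup>L (\<mu> n) f \<in> U"
        using topological_tendstoD[OF lim[OF f] \<open>open U\<close>] by (simp add: W)
      then show "\<forall>\<^sub>F n in sequentially. \<mu> n \<in> W" using \<mu> by (simp add: W)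
    qed
  qed simp
  from this[OF gen] show "\<forall>\<^sub>F n in sequentially. F (\<mu> n) \<in> S"
    using \<mu>' \<open>F \<mu>' \<in> S\<close> \<mu> by simp
qed

lemma integral_prob_measure_close:
  assumes \<mu>: "\<mu> \<in> prob_measures X" and f: "integrable \<mu> f" and g: "integrable \<mu> g"
    and close: "\<And>x. x \<in> topspace X \<Longrightarrow> \<bar>f x - g x\<bar> \<le> (c :: real)"
  shows "\<bar>integral\<^sup>L \<mu> f - integral\<^sup>L \<mu> g\<bar> \<le> c"
proof -
  interpret prob_space \<mu> using prob_measures_D[OF \<mu>] by simp
  have sp: "space \<mu> = topspace X" using prob_measures_D[OF \<mu>] by simp
  have "integral\<^sup>L \<mu> (\<lambda>x. f x - g x) \<le> integral\<^sup>L \<mu> (\<lambda>x. c)"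
    using f g close by (intro integral_mono) (auto simp: sp abs_le_iff)
  moreover have "integral\<^sup>L \<mu> (\<lambda>x. g x - f x) \<le> integral\<^sup>L \<mu> (\<lambda>x. c)"
    using f g close by (intro integral_mono) (auto simp: sp abs_le_iff)
  ultimately show ?thesis using f g by (simp add: prob_space abs_le_iff)
qed

text \<open>Transported to the image of \<open>H\<close>, \<open>f\<close> is uniformly within
  \<open>\<epsilon> / 4\<close> of a finite combination of the \<open>h w\<close>. Integration
  preserves this for every probability measure, so there are two approximation errors and one error
  from finitely many moments, together below \<open>\<epsilon>\<close>.\<close>

lemma moments_determine_limit:
  fixes h :: "'w::countable \<Rightarrow> 'p \<Rightarrow> real"
  assumes X: "compact_space X"
    and cont: "\<And>w. continuous_map X euclideanreal (h w)"
    and inj: "inj_on (\<lambda>x w. h w x) (topspace X)"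
    and one: "in_span_on (topspace X) h (\<lambda>_. 1)"
    and closed: "\<And>v w. in_span_on (topspace X) h (\<lambda>x. h v x * h w x)"
    and \<mu>: "\<And>n. \<mu> n \<in> prob_measures X" and \<mu>': "\<mu>' \<in> prob_measures X"
    and lim: "\<And>w. (\<lambda>n. integral\<^sup>L (\<mu> n) (h w)) \<longlonglongrightarrow> integral\<^sup>L \<mu>' (h w)"
    and f: "continuous_map X euclideanreal f"
  shows "(\<lambda>n. integral\<^sup>L (\<mu> n) f) \<longlonglongrightarrow> integral\<^sup>L \<mu>' f"
proof (rule LIMSEQ_I)
  fix \<epsilon> :: real assume "0 < \<epsilon>"
  define H where "H = (\<lambda>x w. h w x)"
  obtain g where "continuous_map X euclidean H" and compact: "compact (H ` topspace X)"
    and g: "homeomorphic_maps X (top_of_set (H ` topspace X)) H g"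
    using coordinate_homeomorphism[of X h, OF X cont inj] unfolding H_def[symmetric] by metis
  have gH: "g (H x) = x" if "x \<in> topspace X" for x using g that by (simp add: homeomorphic_maps_def)
  have "continuous_map (top_of_set (H ` topspace X)) X g" using g by (simp add: homeomorphic_maps_def)
  from continuous_map_compose[OF this f]
  have fg: "continuous_on (H ` topspace X) (f \<circ> g)" by simp
  have coord: "in_span_on (topspace X) h (\<lambda>x. H x w)" for w
    unfolding H_def by (rule in_span_on_base)
  have "0 < \<epsilon> / 4" using \<open>0 < \<epsilon>\<close> by simp
  obtain p where p: "in_span_on (topspace X) h p"
    and pf: "\<And>x. x \<in> topspace X \<Longrightarrow> \<bar>(f \<circ> g) (H x) - p x\<bar> < \<epsilon> / 4"
    using Stone_Weierstrass_in_span[of H, OF compact one closed coord fg \<open>0 < \<epsilon> / 4\<close>] by metis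
  have fp: "\<bar>f x - p x\<bar> \<le> \<epsilon> / 4" if "x \<in> topspace X" for x
    using pf[OF that] gH[OF that] by simp
  obtain J \<alpha> where "finite J" and J: "\<And>x. x \<in> topspace X \<Longrightarrow> p x = (\<Sum>j\<in>J. \<alpha> j * h j x)"
    using p by (auto simp: in_span_on_def)
  have int: "integrable \<nu> (h w)" if "\<nu> \<in> prob_measures X" for \<nu> w
    by (rule integrable_continuous_map[OF X cont that])
  define P where "P x = (\<Sum>j\<in>J. \<alpha> j * h j x)" for x
  have intP: "integrable \<nu> P" if "\<nu> \<in> prob_measures X" for \<nu>
    unfolding P_def using int[OF that] by simp
  have close: "\<bar>integral\<^sup>L \<nu> f - integral\<^sup>L \<nu> P\<bar> \<le> \<epsilon> / 4" if "\<nu> \<in> prob_measures X" for \<nu>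
  proof (rule integral_prob_measure_close[OF that integrable_continuous_map[OF X f that] intP[OF that]])
    show "\<bar>f x - P x\<bar> \<le> \<epsilon> / 4" if "x \<in> topspace X" for x
      using fp[OF that] J[OF that] by (simp add: P_def)
  qed
  have "integral\<^sup>L \<nu> P = (\<Sum>j\<in>J. \<alpha> j * integral\<^sup>L \<nu> (h j))" if "\<nu> \<in> prob_measures X" for \<nu>
    unfolding P_def using int[OF that] by simp
  then have "(\<lambda>n. integral\<^sup>L (\<mu> n) P) \<longlonglongrightarrow> integral\<^sup>L \<mu>' P"
    using \<mu> \<mu>' by (auto intro!: tendsto_sum tendsto_mult lim)
  from LIMSEQ_D[OF this, of "\<epsilon> / 4"] \<open>0 < \<epsilon>\<close> obtain N
    where N: "\<And>n. n \<ge> N \<Longrightarrow> \<bar>integral\<^sup>L (\<mu> n) P - integral\<^sup>L \<mu>' P\<bar> < \<epsilon> / 4" by auto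
  have "\<bar>integral\<^sup>L (\<mu> n) f - integral\<^sup>L \<mu>' f\<bar> < \<epsilon>" if "n \<ge> N" for n
    using N[OF that] close[OF \<mu>, of n] close[OF \<mu>'] \<open>0 < \<epsilon>\<close> by linarith
  then show "\<exists>N. \<forall>n\<ge>N. norm (integral\<^sup>L (\<mu> n) f - integral\<^sup>L \<mu>' f) < \<epsilon>" by auto
qed

text \<open>The family \<open>h\<close> lives on points and \<open>\<sigma>\<close> on measures;
  they are linked only by the moments lying in the span of \<open>\<sigma>\<close>. The countable
  product of lines is metrizable, so both compactness of the set of moment sequences and continuity
  on it can be checked with sequences.\<close>

theorem weakly_continuous_approximation:
  fixes h :: "'w::countable \<Rightarrow> 'p \<Rightarrow> real" and \<sigma> :: "'j \<Rightarrow> 'p measure \<Rightarrow> real"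
  assumes X: "compact_space X"
    and cont: "\<And>w. continuous_map X euclideanreal (h w)"
    and inj: "inj_on (\<lambda>x w. h w x) (topspace X)"
    and one: "in_span_on (topspace X) h (\<lambda>_. 1)"
    and closed: "\<And>v w. in_span_on (topspace X) h (\<lambda>x. h v x * h w x)"
    and one': "in_span_on (prob_measures X) \<sigma> (\<lambda>_. 1)"
    and closed': "\<And>i j. in_span_on (prob_measures X) \<sigma> (\<lambda>\<mu>. \<sigma> i \<mu> * \<sigma> j \<mu>)"
    and coord: "\<And>w. in_span_on (prob_measures X) \<sigma> (\<lambda>\<mu>. integral\<^sup>L \<mu> (h w))"
    and F: "continuous_map (weak_topology X) euclideanreal F" and "0 < \<epsilon>"
  obtains G where "in_span_on (prob_measures X) \<sigma> G"
    "\<And>\<mu>. \<mu> \<in> prob_measures X \<Longrightarrow> \<bar>F \<mu> - G \<mu>\<bar> < \<epsilon>"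
proof -
  define H where "H \<mu> = (\<lambda>w. integral\<^sup>L \<mu> (h w))" for \<mu>
  define f where "f k = F (inv_into (prob_measures X) H k)" for k
  have lim: "(\<lambda>n. F (\<mu> n)) \<longlonglongrightarrow> F \<mu>'"
    if "\<And>n. \<mu> n \<in> prob_measures X" "\<mu>' \<in> prob_measures X" "(\<lambda>n. H (\<mu> n)) \<longlonglongrightarrow> H \<mu>'" for \<mu> \<mu>'
  proof (rule weakly_continuous_tendsto[OF F that(1,2)])
    show "(\<lambda>n. integral\<^sup>L (\<mu> n) f) \<longlonglongrightarrow> integral\<^sup>L \<mu>' f" if "continuous_map X euclideanreal f" for f
      using \<open>(\<lambda>n. H (\<mu> n)) \<longlonglongrightarrow> H \<mu>'\<close>
      by (intro moments_determine_limit[OF X cont inj one closed _ _ _ that]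
          \<open>\<And>n. \<mu> n \<in> prob_measures X\<close> \<open>\<mu>' \<in> prob_measures X\<close>) (simp add: tendsto_fun_iff H_def)
  qed
  have inv: "inv_into (prob_measures X) H k \<in> prob_measures X" "H (inv_into (prob_measures X) H k) = k"
    if "k \<in> H ` prob_measures X" for k
    using that by (auto intro: inv_into_into f_inv_into_f)
  have fH: "f (H \<mu>) = F \<mu>" if "\<mu> \<in> prob_measures X" for \<mu>
  proof -
    \<comment> \<open>A constant sequence shows that equal moments force equal values of
      \<open>F\<close>, so the representative chosen by \<open>inv_into\<close> is
      immaterial.\<close>
    have "(\<lambda>n. F \<mu>) \<longlonglongrightarrow> F (inv_into (prob_measures X) H (H \<mu>))"
      using inv[of "H \<mu>"] that by (intro lim) auto
    then show ?thesis unfolding f_def using LIMSEQ_unique tendsto_const by blast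
  qed
  have compactH: "compact (H ` prob_measures X)"
    unfolding compact_eq_seq_compact_metric
  proof (rule seq_compactI)
    fix k :: "nat \<Rightarrow> 'w \<Rightarrow> real" assume "\<forall>n. k n \<in> H ` prob_measures X"
    then have "\<forall>n. \<exists>\<mu>. \<mu> \<in> prob_measures X \<and> k n = H \<mu>" by blast
    then obtain \<mu> where \<mu>: "\<And>n. \<mu> n \<in> prob_measures X" "\<And>n. k n = H (\<mu> n)" by metis
    obtain r :: "nat \<Rightarrow> nat" and \<mu>' where r: "strict_mono r" "\<mu>' \<in> prob_measures X"
      "\<forall>w. (\<lambda>n. integral\<^sup>L (\<mu> (r n)) (h w)) \<longlonglongrightarrow> integral\<^sup>L \<mu>' (h w)"
      by (rule prob_measures_sequentially_compact[of X h \<mu>, OF X cont inj \<mu>(1)]) (rule that, assumption+)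
    have "(k \<circ> r) \<longlonglongrightarrow> H \<mu>'" using r(3) by (simp add: tendsto_fun_iff comp_def \<mu>(2) H_def)
    then show "\<exists>l\<in>H ` prob_measures X. \<exists>r. strict_mono r \<and> (k \<circ> r) \<longlonglongrightarrow> l" using r by blast
  qed
  have contf: "continuous_on (H ` prob_measures X) f"
  proof (rule continuous_on_sequentiallyI)
    fix k l assume k: "\<forall>n. k n \<in> H ` prob_measures X" "l \<in> H ` prob_measures X" "k \<longlonglongrightarrow> l"
    show "(\<lambda>n. f (k n)) \<longlonglongrightarrow> f l"
      unfolding f_def using k inv by (intro lim) auto
  qed
  have coordH: "in_span_on (prob_measures X) \<sigma> (\<lambda>\<mu>. H \<mu> w)" for w
    unfolding H_def by (rule coord)
  obtain G where "in_span_on (prob_measures X) \<sigma> G"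
    "\<And>\<mu>. \<mu> \<in> prob_measures X \<Longrightarrow> \<bar>f (H \<mu>) - G \<mu>\<bar> < \<epsilon>"
    using Stone_Weierstrass_in_span[of H, OF compactH one' closed' coordH contf \<open>0 < \<epsilon>\<close>] by metis
  then show thesis using that fH by simp
qed

section \<open>The pathwise expected signature\<close>

text \<open>The list of shuffles is the same for every \<open>p\<close>, so the shuffle identity is
  a single linear relation on all of \<open>P\<close>. It serves both the paths in \<open>X\<close>
  and the paths \<open>\<Phi> \<mu>\<close>.\<close>

lemma in_span_on_sig_coord_mult:
  assumes "\<And>p. p \<in> P \<Longrightarrow> lipschitz_coords b a T (x p)" "a \<le> T"
  shows "in_span_on P (\<lambda>w p. sig_coord b a T (x p) w) (\<lambda>p. sig_coord b a T (x p) v * sig_coord b a T (x p) w)"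
proof -
  obtain us where "\<And>x t. lipschitz_coords b a T x \<Longrightarrow> a \<le> t \<Longrightarrow> t \<le> T \<Longrightarrow>
      sig_coord b a t x v * sig_coord b a t x w = (\<Sum>u\<leftarrow>us. sig_coord b a t x u)"
    using sig_coord_shuffle by blast
  then show ?thesis
    using assms by (intro in_span_on_cong[OF in_span_on_sum_list[of _ _ us]]) auto
qed

text \<open>Nonnegativity of the variance bounds the square of an expectation by the expectation of
  the square. The uniform bound on square sums thus passes to the expected coordinates, and
  \<open>Abs_ell2\<close> in the definition keeps them.\<close>

lemma ell2_nth_expected_signature:
  fixes e :: "'i \<Rightarrow> 'v::real_inner"
  assumes e: "orthonormal_basis e" and X: "compact_space X"
    and L: "\<And>x. x \<in> topspace X \<Longrightarrow> L-lipschitz_on {a..T} x"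
    and cont: "\<And>w. continuous_map X euclideanreal (\<lambda>x. sig_coord e a t x w)"
    and \<mu>: "\<mu> \<in> prob_measures X" and t: "a \<le> t" "t \<le> T"
  shows "ell2_nth (expected_signature e a T \<mu> t) w = integral\<^sup>L \<mu> (\<lambda>x. sig_coord e a t x w)"
proof -
  interpret prob_space \<mu> using prob_measures_D[OF \<mu>] by simp
  have sp: "space \<mu> = topspace X" using prob_measures_D[OF \<mu>] by simp
  let ?s = "\<lambda>x w. sig_coord e a t x w"
  let ?I = "\<lambda>w. integral\<^sup>L \<mu> (\<lambda>x. ?s x w)"
  have int: "integrable \<mu> (\<lambda>x. ?s x w)" for w
    by (rule integrable_continuous_map[OF X cont \<mu>])
  have int2: "integrable \<mu> (\<lambda>x. (?s x w)\<^sup>2)" for w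
    using integrable_continuous_map[OF X continuous_map_real_mult[OF cont cont] \<mu>, of w w]
    by (simp add: power2_eq_square)
  have "(\<Sum>w\<in>W. (?I w)\<^sup>2) \<le> exp ((L * (T - a))\<^sup>2)" if W: "finite W" for W
  proof -
    have "(?I w)\<^sup>2 \<le> integral\<^sup>L \<mu> (\<lambda>x. (?s x w)\<^sup>2)" for w
      using variance_eq[OF int int2, of w] variance_positive[of "\<lambda>x. ?s x w"] by simp
    then have "(\<Sum>w\<in>W. (?I w)\<^sup>2) \<le> (\<Sum>w\<in>W. integral\<^sup>L \<mu> (\<lambda>x. (?s x w)\<^sup>2))"
      by (intro sum_mono)
    also have "\<dots> = integral\<^sup>L \<mu> (\<lambda>x. \<Sum>w\<in>W. (?s x w)\<^sup>2)"
      using int2 by (intro Bochner_Integration.integral_sum[symmetric])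
    also have "\<dots> \<le> integral\<^sup>L \<mu> (\<lambda>x. exp ((L * (T - a))\<^sup>2))"
      using int2 sig_coord_square_sum_bound[OF e L W t]
      by (intro integral_mono Bochner_Integration.integrable_sum) (auto simp: sp)
    finally show ?thesis by (simp add: prob_space)
  qed
  then have sq: "(\<lambda>w. (?I w)\<^sup>2) summable_on UNIV"
    by (intro nonneg_bdd_above_summable_on bdd_aboveI2[where M = "exp ((L * (T - a))\<^sup>2)"]) auto
  have "(LINT x|\<mu>. ell2_nth (signature e a t (restrict x {a..t})) w) = ?I w" for w
  proof (rule Bochner_Integration.integral_cong[OF refl])
    fix x assume "x \<in> space \<mu>"
    then have "L-lipschitz_on {a..t} x"
      using lipschitz_on_subset[OF L] t unfolding sp by simp
    then have "L-lipschitz_on {a..t} (restrict x {a..t})"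
      by (rule lipschitz_on_transform) simp
    then have "ell2_nth (signature e a t (restrict x {a..t})) w = sig_coord e a t (restrict x {a..t}) w"
      using t(1) by (intro ell2_nth_signature[OF e]) auto
    also have "\<dots> = ?s x w" by (rule sig_coord_cong[of a t]) auto
    finally show "ell2_nth (signature e a t (restrict x {a..t})) w = ?s x w" .
  qed
  then show ?thesis
    using t sq by (simp add: expected_signature_def Abs_ell2_inverse)
qed

theorem theorem3p2:
  fixes e :: "'i::countable \<Rightarrow> 'v::{real_inner, complete_space}"
    and a T :: real
    and X :: "(real \<Rightarrow> 'v) set"
    and F :: "(real \<Rightarrow> 'v) measure \<Rightarrow> real"
  assumes "orthonormal_basis e"
    and "0 \<le> a" and "a < T"
    and "X \<subseteq> lip_paths a T"
    and "compactin (lip_topology a T) X"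
    and "\<And>x y. x \<in> X \<Longrightarrow> y \<in> X \<Longrightarrow> x \<noteq> y \<Longrightarrow> \<not> tree_like_equiv e a T x y"
    and "continuous_map (weak_topology (subtopology (lip_topology a T) X)) euclideanreal F"
  shows "\<forall>\<epsilon>>0. \<exists>m (\<alpha> :: 'i list list \<Rightarrow> real).
           finite {J. length J \<le> m \<and> \<alpha> J \<noteq> 0} \<and>
           (\<forall>\<mu> \<in> prob_measures (subtopology (lip_topology a T) X).
              \<bar>F \<mu> - (\<Sum>k=0..m. \<Sum>J | length J = k \<and> \<alpha> J \<noteq> 0.
                 \<alpha> J * sig_coord ell2_unit a T (expected_signature e a T \<mu>) J)\<bar> < \<epsilon>)"
proof (intro allI impI)
  fix \<epsilon> :: real assume "0 < \<epsilon>"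
  note e = assms(1) and aT = assms(3)
  then have aT': "a \<le> T" by simp
  interpret Metric_space "lip_paths a T :: (real \<Rightarrow> 'v) set" "lip_dist a T"
    by (rule Metric_space_lip[OF aT])
  define \<tau> where "\<tau> = subtopology (lip_topology a T) X"
  have top: "topspace \<tau> = X" using assms(4) by (auto simp: \<tau>_def lip_topology_def)
  have compact: "compact_space \<tau>" unfolding \<tau>_def by (rule compact_space_subtopology[OF assms(5)])
  obtain L where L: "0 \<le> L" "\<And>x. x \<in> X \<Longrightarrow> L-lipschitz_on {a..T} x"
    using compactin_lip_topology_lipschitz[OF assms(5,4) aT] by blast
  have cont: "continuous_map \<tau> euclideanreal (\<lambda>x. sig_coord e a t x w)" if "a \<le> t" "t \<le> T" for t w
    unfolding \<tau>_def by (rule continuous_map_sig_coord[OF e aT that assms(4) L])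
  define h where "h = (\<lambda>w (x :: real \<Rightarrow> 'v). sig_coord e a T x w)"
  define \<Phi> where "\<Phi> = expected_signature e a T"
  define \<sigma> where "\<sigma> J \<mu> = sig_coord ell2_unit a T (\<Phi> \<mu>) J" for J \<mu>
  have \<Phi>: "inner (\<Phi> \<mu> t) (ell2_unit w) = integral\<^sup>L \<mu> (\<lambda>x. sig_coord e a t x w)"
    if "\<mu> \<in> prob_measures \<tau>" "a \<le> t" "t \<le> T" for \<mu> t w
    unfolding \<Phi>_def inner_ell2_unit
    by (rule ell2_nth_expected_signature[OF e compact _ cont that]) (use L(2) top that in auto)
  have lip\<Phi>: "lipschitz_coords ell2_unit a T (\<Phi> \<mu>)" if \<mu>: "\<mu> \<in> prob_measures \<tau>" for \<mu>
    unfolding lipschitz_coords_def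
  proof
    fix w
    interpret prob_space \<mu> using prob_measures_D[OF \<mu>] by simp
    obtain K where K: "\<And>x :: real \<Rightarrow> 'v. L-lipschitz_on {a..T} x \<Longrightarrow>
        K-lipschitz_on {a..T} (\<lambda>t. sig_coord e a t x w)"
      using sig_coord_lipschitz_uniform[OF e L(1) aT'] by blast
    have "K-lipschitz_on {a..T} (\<lambda>t. inner (\<Phi> \<mu> t) (ell2_unit w))"
    proof (rule lipschitz_on_realI)
      \<comment> \<open>\<open>K\<close> is a Lipschitz constant only once a path is given; a space
        carrying a probability measure has one.\<close>
      obtain x where "x \<in> X" using not_empty prob_measures_D(2)[OF \<mu>] top by auto
      then show "0 \<le> K" using lipschitz_on_nonneg[OF K[OF L(2)]] by blast
      fix s t assume st: "a \<le> s" "s \<le> t" "t \<le> T"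
      have "\<bar>integral\<^sup>L \<mu> (\<lambda>x. sig_coord e a t x w) - integral\<^sup>L \<mu> (\<lambda>x. sig_coord e a s x w)\<bar> \<le> K * (t - s)"
      proof (rule integral_prob_measure_close[OF \<mu>])
        show "\<bar>sig_coord e a t x w - sig_coord e a s x w\<bar> \<le> K * (t - s)" if "x \<in> topspace \<tau>" for x
          using lipschitz_on_realD[OF K[OF L(2)] st] that top by simp
      qed (use st in \<open>auto intro!: integrable_continuous_map[OF compact cont \<mu>]\<close>)
      then show "norm (inner (\<Phi> \<mu> t) (ell2_unit w) - inner (\<Phi> \<mu> s) (ell2_unit w)) \<le> K * (t - s)"
        using \<Phi>[OF \<mu>] st by simp
    qed
    then show "\<exists>K. K-lipschitz_on {a..T} (\<lambda>t. inner (\<Phi> \<mu> t) (ell2_unit w))" by blast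
  qed
  have lipX: "lipschitz_coords e a T x" if "x \<in> topspace \<tau>" for x
    using lipschitz_coords_orthonormal[OF e L(2)] that top by simp
  have inj: "inj_on (\<lambda>x w. h w x) (topspace \<tau>)"
  proof (rule inj_onI, rule ccontr)
    fix x y assume xy: "x \<in> topspace \<tau>" "y \<in> topspace \<tau>" "(\<lambda>w. h w x) = (\<lambda>w. h w y)" "x \<noteq> y"
    then have "sig_coord e a T x = sig_coord e a T y" by (simp add: h_def fun_eq_iff)
    then show False
      using assms(6)[of x y] xy top by (simp add: tree_like_equiv_def signature_def)
  qed
  have one: "in_span_on (topspace \<tau>) h (\<lambda>_. 1)"
    by (rule in_span_on_cong[OF in_span_on_base[of _ _ "[]"]]) (simp add: h_def)
  have closed: "in_span_on (topspace \<tau>) h (\<lambda>x. h v x * h w x)" for v w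
    using in_span_on_sig_coord_mult[of "topspace \<tau>" e a T "\<lambda>x. x" v w] lipX aT'
    unfolding h_def by simp
  have one': "in_span_on (prob_measures \<tau>) \<sigma> (\<lambda>_. 1)"
    by (rule in_span_on_cong[OF in_span_on_base[of _ _ "[]"]]) (simp add: \<sigma>_def)
  have closed': "in_span_on (prob_measures \<tau>) \<sigma> (\<lambda>\<mu>. \<sigma> I \<mu> * \<sigma> J \<mu>)" for I J
    using in_span_on_sig_coord_mult[of "prob_measures \<tau>" ell2_unit a T \<Phi> I J] lip\<Phi> aT'
    unfolding \<sigma>_def by simp
  have coord: "in_span_on (prob_measures \<tau>) \<sigma> (\<lambda>\<mu>. integral\<^sup>L \<mu> (h w))" for w
  proof (rule in_span_on_cong)
    \<comment> \<open>A letter of an outer word is itself a word \<open>w\<close>, and the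
      one-letter word \<open>[w]\<close> gives the increment of coordinate \<open>w\<close> of
      \<open>\<Phi> \<mu>\<close> from \<open>a\<close> to \<open>T\<close>. The initial value, 1
      for the empty word and 0 otherwise, has to be added back.\<close>
    show "in_span_on (prob_measures \<tau>) \<sigma> (\<lambda>\<mu>. \<sigma> [w] \<mu> + (if w = [] then 1 else 0) * 1)"
      by (intro in_span_on_add in_span_on_base in_span_on_cmult one')
    fix \<mu> assume \<mu>: "\<mu> \<in> prob_measures \<tau>"
    then interpret prob_space \<mu> using prob_measures_D by blast
    have "integral\<^sup>L \<mu> (\<lambda>x. sig_coord e a a x w) = integral\<^sup>L \<mu> (\<lambda>x. if w = [] then 1 else 0)"
      using sig_coord_initial[OF lipX aT'] prob_measures_D(2)[OF \<mu>]
      by (intro Bochner_Integration.integral_cong) auto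
    then have "integral\<^sup>L \<mu> (\<lambda>x. sig_coord e a a x w) = (if w = [] then 1 else 0)"
      by (simp add: prob_space)
    then show "integral\<^sup>L \<mu> (h w) = \<sigma> [w] \<mu> + (if w = [] then 1 else 0) * 1"
      using sig_coord_singleton[OF lip\<Phi>[OF \<mu>] aT' order_refl, of w] \<Phi>[OF \<mu>] aT'
      by (simp add: \<sigma>_def h_def)
  qed
  have conth: "continuous_map \<tau> euclideanreal (h w)" for w
    unfolding h_def using cont aT' by simp
  obtain G where G: "in_span_on (prob_measures \<tau>) \<sigma> G"
    "\<And>\<mu>. \<mu> \<in> prob_measures \<tau> \<Longrightarrow> \<bar>F \<mu> - G \<mu>\<bar> < \<epsilon>"
    using weakly_continuous_approximation[of \<tau> h \<sigma> F \<epsilon>, OF compact conth inj one closed one' closed' coord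
        assms(7)[folded \<tau>_def] \<open>0 < \<epsilon>\<close>] by metis
  obtain \<alpha> where \<alpha>: "finite {J. \<alpha> J \<noteq> 0}"
    "\<forall>\<mu>\<in>prob_measures \<tau>. G \<mu> = (\<Sum>J | \<alpha> J \<noteq> 0. \<alpha> J * \<sigma> J \<mu>)"
    by (rule in_span_on_finite_support[OF G(1)]) (rule that, assumption+)
  \<comment> \<open>The truncation level bounds the lengths of the finitely many words with nonzero
    coefficient; sorting these words by length gives the double sum.\<close>
  obtain m where "\<forall>k\<in>length ` {J. \<alpha> J \<noteq> 0}. k \<le> m"
    using finite_nat_set_iff_bounded_le[of "length ` {J. \<alpha> J \<noteq> 0}"] \<alpha>(1) by blast
  then have m: "length ` {J. \<alpha> J \<noteq> 0} \<subseteq> {0..m}" by auto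
  have "(\<Sum>k=0..m. \<Sum>J | length J = k \<and> \<alpha> J \<noteq> 0. \<alpha> J * \<sigma> J \<mu>) = (\<Sum>J | \<alpha> J \<noteq> 0. \<alpha> J * \<sigma> J \<mu>)" for \<mu>
    using sum.group[OF \<alpha>(1) _ m, of "\<lambda>J. \<alpha> J * \<sigma> J \<mu>"] by (simp add: conj_commute)
  then have "\<forall>\<mu>\<in>prob_measures \<tau>. \<bar>F \<mu> - (\<Sum>k=0..m. \<Sum>J | length J = k \<and> \<alpha> J \<noteq> 0. \<alpha> J * \<sigma> J \<mu>)\<bar> < \<epsilon>"
    using G(2) \<alpha>(2) by simp
  moreover have "finite {J. length J \<le> m \<and> \<alpha> J \<noteq> 0}"
    using \<alpha>(1) by (rule rev_finite_subset) auto
  ultimately show "\<exists>m (\<alpha> :: 'i list list \<Rightarrow> real).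
           finite {J. length J \<le> m \<and> \<alpha> J \<noteq> 0} \<and>
           (\<forall>\<mu> \<in> prob_measures (subtopology (lip_topology a T) X).
              \<bar>F \<mu> - (\<Sum>k=0..m. \<Sum>J | length J = k \<and> \<alpha> J \<noteq> 0.
                 \<alpha> J * sig_coord ell2_unit a T (expected_signature e a T \<mu>) J)\<bar> < \<epsilon>)"
    unfolding \<sigma>_def \<Phi>_def \<tau>_def by blast
qed

end
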